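(* Let $(T,L,c,r)$ be a rooted WDTAP instance that is a willow, and let $M\in\{0,1\}^{A\times L}$ be its arc-link-coverage matrix. Then $M$ is totally unimodular. In particular, an optimum integral solution to the linear program $\min\{\sum_{\ell\in L}c(\ell)x_\ell : Mx\ge \mathbf{1},\ x\ge 0\}$ can be found in polynomial time.
   Context: A WDTAP instance $(T,L,c)$ consists of an oriented tree $T=(V,A)$ (a directed graph whose underlying undirected graph is a tree), links $L\subseteq V\times V$ and costs $c\colon L\to\mathbb{R}_{>0}$. For $\ell=(u,v)$, $P_\ell$ is the unique $u$-$v$ path in the underlying undirected tree, traversed from $u$ to $v$, and $\overrightarrow{\mathrm{cov}}(\ell)$ is the set of arcs of $P_\ell$ traversed against their orientation. The arc-link-coverage matrix $M$ has $M_{a,\ell}=1$ iff $a\in\overrightarrow{\mathrm{cov}}(\ell)$. A rooted instance additionally fixes a root $r\in V$. Up-arcs are arcs pointing towards $r$ (their head is closer to $r$), down-arcs point away from $r$; $A_{up},A_{down}$ denote these sets. For $v\in V$, $T_v=(U_v,A_v)$ is the subtree of descendants of $v$ (vertices whose path to $r$ contains $v$). For a link $\ell=(u,v)$, $\mathrm{apex}(\ell)$ is the least common ancestor of $u$ and $v$. $\ell$ is an up-link if $v=\mathrm{apex}(\ell)$ and a down-link if $u=\mathrm{apex}(\ell)$. For $W\subseteq V$, $\ell$ is a $W$-cross-link if $\mathrm{apex}(\ell)\in W$ and $\ell$ is neither an up- nor a down-link. A vertex $v$ is up-independent with respect to $L'\subseteq L$ if for every $\ell\in L'$, $\overrightarrow{\mathrm{cov}}(\ell)\cap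 A_v\cap A_{up}=\emptyset$ or $\overrightarrow{\mathrm{cov}}(\ell)\subseteq A_v$; it is down-independent with respect to $L'$ if for every $\ell\in L'$, $\overrightarrow{\mathrm{cov}}(\ell)\cap A_v\cap A_{down}=\emptyset$ or $\overrightarrow{\mathrm{cov}}(\ell)\subseteq A_v$. The rooted instance $(T,L,c,r)$ is a willow if there is $W\subseteq V$ such that every vertex of $W$ is up-independent or down-independent with respect to $L$, and every link of $L$ is an up-link, a down-link, or a $W$-cross-link. *)

theory Defs
  imports "Graph_Theory.Graph_Theory" "Jordan_Normal_Form.Determinant"
begin

section \<open>Instances\<close>

text \<open>
  The predicate \<open>tree\<close> of Graph_Theory only excludes directed cycles, so it is not the notion
  of a tree needed here. An antiparallel pair of arcs would be a cycle of length two in the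
  underlying multigraph and is excluded separately.
\<close>

definition oriented_tree :: "'v pair_pre_digraph \<Rightarrow> bool" where
  "oriented_tree T \<longleftrightarrow>
     pair_digraph T \<and> connected (with_proj T) \<and>
     (\<forall>u v. (u, v) \<in> parcs T \<longrightarrow> (v, u) \<notin> parcs T) \<and>
     \<not> (\<exists>p. vpath p (with_proj (mk_symmetric (with_proj T))) \<and> 3 \<le> length p \<and>
            (last p, hd p) \<in> parcs (mk_symmetric (with_proj T)))"

definition tree_path :: "'v pair_pre_digraph \<Rightarrow> 'v \<Rightarrow> 'v \<Rightarrow> 'v list" where
  "tree_path T u v =
     (THE p. vpath p (with_proj (mk_symmetric (with_proj T))) \<and> hd p = u \<and> last p = v)"

definition wdtap_instance ::
  "'v pair_pre_digraph \<Rightarrow> ('v \<times> 'v) set \<Rightarrow> ('v \<times> 'v \<Rightarrow> real) \<Rightarrow> bool" where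
  "wdtap_instance T L c \<longleftrightarrow>
     oriented_tree T \<and> L \<subseteq> pverts T \<times> pverts T \<and> (\<forall>l\<in>L. 0 < c l)"

definition rooted_wdtap_instance ::
  "'v pair_pre_digraph \<Rightarrow> ('v \<times> 'v) set \<Rightarrow> ('v \<times> 'v \<Rightarrow> real) \<Rightarrow> 'v \<Rightarrow> bool" where
  "rooted_wdtap_instance T L c r \<longleftrightarrow> wdtap_instance T L c \<and> r \<in> pverts T"

text \<open>\<open>vwalk_arcs p\<close> lists the steps of \<open>p\<close> in the direction of travel.\<close>

definition cov :: "'v pair_pre_digraph \<Rightarrow> 'v \<times> 'v \<Rightarrow> ('v \<times> 'v) set" where
  "cov T l = {(x, y) \<in> parcs T. (y, x) \<in> set (vwalk_arcs (tree_path T (fst l) (snd l)))}"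

definition coverage_matrix :: "'v pair_pre_digraph \<Rightarrow> 'v \<times> 'v \<Rightarrow> 'v \<times> 'v \<Rightarrow> int" where
  "coverage_matrix T a l = (if a \<in> cov T l then 1 else 0)"


section \<open>Willows\<close>

text \<open>The number of vertices on a path orders vertices in the same way as their distance to \<open>r\<close>.\<close>

definition up_arcs :: "'v pair_pre_digraph \<Rightarrow> 'v \<Rightarrow> ('v \<times> 'v) set" where
  "up_arcs T r = {(x, y) \<in> parcs T. length (tree_path T y r) < length (tree_path T x r)}"

definition down_arcs :: "'v pair_pre_digraph \<Rightarrow> 'v \<Rightarrow> ('v \<times> 'v) set" where
  "down_arcs T r = {(x, y) \<in> parcs T. length (tree_path T x r) < length (tree_path T y r)}"

definition descendants :: "'v pair_pre_digraph \<Rightarrow> 'v \<Rightarrow> 'v \<Rightarrow> 'v set" where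
  "descendants T r v = {w \<in> pverts T. v \<in> set (tree_path T w r)}"

definition subtree_arcs :: "'v pair_pre_digraph \<Rightarrow> 'v \<Rightarrow> 'v \<Rightarrow> ('v \<times> 'v) set" where
  "subtree_arcs T r v =
     {(x, y) \<in> parcs T. x \<in> descendants T r v \<and> y \<in> descendants T r v}"

definition common_ancestor :: "'v pair_pre_digraph \<Rightarrow> 'v \<Rightarrow> 'v \<times> 'v \<Rightarrow> 'v \<Rightarrow> bool" where
  "common_ancestor T r l w \<longleftrightarrow>
     w \<in> pverts T \<and> fst l \<in> descendants T r w \<and> snd l \<in> descendants T r w"

definition apex :: "'v pair_pre_digraph \<Rightarrow> 'v \<Rightarrow> 'v \<times> 'v \<Rightarrow> 'v" where
  "apex T r l =
     (THE w. common_ancestor T r l w \<and>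
        (\<forall>w'. common_ancestor T r l w' \<longrightarrow> w \<in> descendants T r w'))"

definition up_link :: "'v pair_pre_digraph \<Rightarrow> 'v \<Rightarrow> 'v \<times> 'v \<Rightarrow> bool" where
  "up_link T r l \<longleftrightarrow> snd l = apex T r l"

definition down_link :: "'v pair_pre_digraph \<Rightarrow> 'v \<Rightarrow> 'v \<times> 'v \<Rightarrow> bool" where
  "down_link T r l \<longleftrightarrow> fst l = apex T r l"

definition cross_link ::
  "'v pair_pre_digraph \<Rightarrow> 'v \<Rightarrow> 'v set \<Rightarrow> 'v \<times> 'v \<Rightarrow> bool" where
  "cross_link T r W l \<longleftrightarrow> apex T r l \<in> W \<and> \<not> up_link T r l \<and> \<not> down_link T r l"

definition up_independent ::
  "'v pair_pre_digraph \<Rightarrow> 'v \<Rightarrow> ('v \<times> 'v) set \<Rightarrow> 'v \<Rightarrow> bool" where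
  "up_independent T r L v \<longleftrightarrow>
     (\<forall>l\<in>L. cov T l \<inter> subtree_arcs T r v \<inter> up_arcs T r = {} \<or> cov T l \<subseteq> subtree_arcs T r v)"

definition down_independent ::
  "'v pair_pre_digraph \<Rightarrow> 'v \<Rightarrow> ('v \<times> 'v) set \<Rightarrow> 'v \<Rightarrow> bool" where
  "down_independent T r L v \<longleftrightarrow>
     (\<forall>l\<in>L. cov T l \<inter> subtree_arcs T r v \<inter> down_arcs T r = {} \<or> cov T l \<subseteq> subtree_arcs T r v)"

definition willow ::
  "'v pair_pre_digraph \<Rightarrow> ('v \<times> 'v) set \<Rightarrow> ('v \<times> 'v \<Rightarrow> real) \<Rightarrow> 'v \<Rightarrow> bool" where
  "willow T L c r \<longleftrightarrow>
     rooted_wdtap_instance T L c r \<and>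
     (\<exists>W \<subseteq> pverts T.
        (\<forall>w\<in>W. up_independent T r L w \<or> down_independent T r L w) \<and>
        (\<forall>l\<in>L. up_link T r l \<or> down_link T r l \<or> cross_link T r W l))"


section \<open>Total unimodularity and the linear program\<close>

text \<open>
  The injections \<open>f\<close> and \<open>g\<close> select the rows and columns of a square submatrix. The order in which
  they list them only affects the sign of the determinant.
\<close>

definition totally_unimodular :: "'a set \<Rightarrow> 'b set \<Rightarrow> ('a \<Rightarrow> 'b \<Rightarrow> int) \<Rightarrow> bool" where
  "totally_unimodular R C M \<longleftrightarrow>
     (\<forall>k f g. inj_on f {..<k} \<and> f ` {..<k} \<subseteq> R \<and> inj_on g {..<k} \<and> g ` {..<k} \<subseteq> C \<longrightarrow>
        det (mat k k (\<lambda>(i, j). M (f i) (g j))) \<in> {-1, 0, 1})"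

definition lp_feasible :: "'a set \<Rightarrow> 'b set \<Rightarrow> ('a \<Rightarrow> 'b \<Rightarrow> int) \<Rightarrow> ('b \<Rightarrow> real) \<Rightarrow> bool" where
  "lp_feasible R C M x \<longleftrightarrow>
     (\<forall>a\<in>R. 1 \<le> (\<Sum>l\<in>C. real_of_int (M a l) * x l)) \<and> (\<forall>l\<in>C. 0 \<le> x l)"

definition lp_optimal ::
  "'a set \<Rightarrow> 'b set \<Rightarrow> ('a \<Rightarrow> 'b \<Rightarrow> int) \<Rightarrow> ('b \<Rightarrow> real) \<Rightarrow> ('b \<Rightarrow> real) \<Rightarrow> bool" where
  "lp_optimal R C M c x \<longleftrightarrow>
     lp_feasible R C M x \<and>
     (\<forall>y. lp_feasible R C M y \<longrightarrow> (\<Sum>l\<in>C. c l * x l) \<le> (\<Sum>l\<in>C. c l * y l))"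


section \<open>Polynomial time\<close>

text \<open>
  As costs are arbitrary positive reals, running time is measured on a real RAM with separate
  integer and real memories. Both are divided into arrays; a program mentions finitely many arrays,
  but can address every cell of them. The only arithmetic operations are addition and subtraction,
  and reals influence integers only through comparisons. Hence after \<open>t\<close> steps of a fixed program
  every real cell holds an integer combination of the input costs and \<open>1\<close> whose coefficients have
  \<open>O(t)\<close> bits, and every integer cell has \<open>O(t)\<close> more bits than the integer input. For rational
  costs in binary encoding, a polynomial number of steps is therefore also polynomial time on a
  Turing machine. Multiplication is left out because with unit-cost multiplication this would fail.
\<close>

datatype iexp = IConst int | IGet nat iexp | IAdd iexp iexp | ISub iexp iexp

datatype rexp = RConst int | RGet nat iexp | RAdd rexp rexp | RSub rexp rexp

datatype bexp = ILess iexp iexp | RLess rexp rexp | BNot bexp | BAnd bexp bexp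

datatype com =
    Skip
  | ISet nat iexp iexp
  | RSet nat iexp rexp
  | Seq com com
  | If bexp com com
  | While bexp com

text \<open>The first argument of \<open>IGet\<close>, \<open>RGet\<close>, \<open>ISet\<close>, \<open>RSet\<close> is an array, the second an index.\<close>

record state =
  ints :: "nat \<Rightarrow> int \<Rightarrow> int"
  reals :: "nat \<Rightarrow> int \<Rightarrow> real"

primrec ival :: "iexp \<Rightarrow> state \<Rightarrow> int" where
  "ival (IConst z) s = z"
| "ival (IGet a e) s = ints s a (ival e s)"
| "ival (IAdd e f) s = ival e s + ival f s"
| "ival (ISub e f) s = ival e s - ival f s"

primrec rval :: "rexp \<Rightarrow> state \<Rightarrow> real" where
  "rval (RConst z) s = of_int z"
| "rval (RGet a e) s = reals s a (ival e s)"
| "rval (RAdd e f) s = rval e s + rval f s"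
| "rval (RSub e f) s = rval e s - rval f s"

primrec bval :: "bexp \<Rightarrow> state \<Rightarrow> bool" where
  "bval (ILess e f) s \<longleftrightarrow> ival e s < ival f s"
| "bval (RLess e f) s \<longleftrightarrow> rval e s < rval f s"
| "bval (BNot b) s \<longleftrightarrow> \<not> bval b s"
| "bval (BAnd b b') s \<longleftrightarrow> bval b s \<and> bval b' s"

definition set_int :: "nat \<Rightarrow> int \<Rightarrow> int \<Rightarrow> state \<Rightarrow> state" where
  "set_int a i z s = s\<lparr>ints := (ints s)(a := (ints s a)(i := z))\<rparr>"

definition set_real :: "nat \<Rightarrow> int \<Rightarrow> real \<Rightarrow> state \<Rightarrow> state" where
  "set_real a i z s = s\<lparr>reals := (reals s)(a := (reals s a)(i := z))\<rparr>"

text \<open>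
  \<open>exec p s t s'\<close>: started in \<open>s\<close>, program \<open>p\<close> halts in \<open>s'\<close> after \<open>t\<close> steps. Assignments and tests
  count as one step each, since the expressions in a fixed program have bounded size.
\<close>

inductive exec :: "com \<Rightarrow> state \<Rightarrow> nat \<Rightarrow> state \<Rightarrow> bool" where
  Skip: "exec Skip s 1 s"
| ISet: "exec (ISet a i e) s 1 (set_int a (ival i s) (ival e s) s)"
| RSet: "exec (RSet a i e) s 1 (set_real a (ival i s) (rval e s) s)"
| Seq: "exec p s t s' \<Longrightarrow> exec q s' t' s'' \<Longrightarrow> exec (Seq p q) s (t + t') s''"
| IfTrue: "bval b s \<Longrightarrow> exec p s t s' \<Longrightarrow> exec (If b p q) s (1 + t) s'"
| IfFalse: "\<not> bval b s \<Longrightarrow> exec q s t s' \<Longrightarrow> exec (If b p q) s (1 + t) s'"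
| WhileFalse: "\<not> bval b s \<Longrightarrow> exec (While b p) s 1 s"
| WhileTrue: "bval b s \<Longrightarrow> exec p s t s' \<Longrightarrow> exec (While b p) s' t' s'' \<Longrightarrow>
    exec (While b p) s (1 + t + t') s''"

lemma exec_deterministic:
  assumes "exec p s t s1" and "exec p s u s2"
  shows "u = t \<and> s2 = s1"
  using assms
proof (induction arbitrary: u s2 rule: exec.induct)
  case (Seq p s t s' q t' s'')
  from Seq.prems show ?case
    by (cases rule: exec.cases) (use Seq.IH in blast)
next
  case (IfTrue b s p t s' q)
  from IfTrue.prems show ?case
    by (cases rule: exec.cases) (use IfTrue.IH IfTrue.hyps in blast)+
next
  case (IfFalse b s q t s' p)
  from IfFalse.prems show ?case
    by (cases rule: exec.cases) (use IfFalse.IH IfFalse.hyps in blast)+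
next
  case (WhileTrue b s p t s' t' s'')
  from WhileTrue.prems show ?case
    by (cases rule: exec.cases) (use WhileTrue.IH WhileTrue.hyps in blast)+
next
  case (WhileFalse b s p)
  from WhileFalse.prems show ?case
    by (cases rule: exec.cases) (use WhileFalse.hyps in blast)+
next
  case (Skip s)
  from Skip.prems show ?case by (cases rule: exec.cases) blast
next
  case (ISet a i e s)
  from ISet.prems show ?case by (cases rule: exec.cases) blast
next
  case (RSet a i e s)
  from RSet.prems show ?case by (cases rule: exec.cases) blast
qed

text \<open>
  The input consists of the number \<open>n\<close> of vertices, which are numbered \<open>0, \<dots>, n - 1\<close>, the root,
  a list of the arcs, a list of the links, and the costs of the links. The set \<open>W\<close> witnessing that
  the instance is a willow is not part of the input. All other cells are initially \<open>0\<close>.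
\<close>

definition array_of :: "'a::zero list \<Rightarrow> int \<Rightarrow> 'a" where
  "array_of xs i = (if 0 \<le> i \<and> i < int (length xs) then xs ! nat i else 0)"

definition encode_input ::
  "nat \<Rightarrow> nat \<Rightarrow> (nat \<times> nat) list \<Rightarrow> (nat \<times> nat) list \<Rightarrow> (nat \<times> nat \<Rightarrow> real) \<Rightarrow> state" where
  "encode_input n r as ls c =
     \<lparr>ints = (\<lambda>_ _. 0)
        (0 := array_of [int n, int r, int (length as), int (length ls)],
         1 := array_of (map (int \<circ> fst) as),
         2 := array_of (map (int \<circ> snd) as),
         3 := array_of (map (int \<circ> fst) ls),
         4 := array_of (map (int \<circ> snd) ls)),
      reals = (\<lambda>_ _. 0)(0 := array_of (map c ls))\<rparr>"

text \<open>
  Cell \<open>0\<close> of integer array \<open>5\<close> reports whether the linear program is feasible (\<open>1\<close>) or not (\<open>0\<close>);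
  in the feasible case, integer array \<open>6\<close> holds the solution, indexed like the list of links.
\<close>

definition correct_output ::
  "'a set \<Rightarrow> 'b list \<Rightarrow> ('a \<Rightarrow> 'b \<Rightarrow> int) \<Rightarrow> ('b \<Rightarrow> real) \<Rightarrow> state \<Rightarrow> bool" where
  "correct_output R ls M c s \<longleftrightarrow>
     (if \<exists>x. lp_feasible R (set ls) M x
      then ints s 5 0 = 1 \<and>
        (\<exists>x. lp_optimal R (set ls) M c x \<and> (\<forall>l\<in>set ls. x l \<in> \<int>) \<and>
             (\<forall>j<length ls. x (ls ! j) = of_int (ints s 6 (int j))))
      else ints s 5 0 = 0)"

end

theory Submission
  imports Defs
begin

text \<open>
  Take one copy of the tree for the up-arcs and one for the down-arcs, contracting in each
  copy the arcs of the other kind. At a vertex \<open>w\<close> that is up-independent (down-independent), no link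
  uses both up-arcs (down-arcs) inside the subtree of \<open>w\<close> and arcs outside of it, so the subtree
  can be cut off in the respective copy and be hung below \<open>w\<close> in the other copy. In the resulting
  forest every link, including the cross-links, covers exactly the arcs of a directed path. Hence the
  coverage matrix is a network matrix: up to signs, its rows are given by the cuts of the forest,
  which are laminar, and total unimodularity follows by contracting edges.

  For the algorithm, \<open>M x \<ge> 1\<close> becomes a transshipment problem without capacities: links are arcs
  from one end of their path to the other, slack variables are reversed arcs of the forest with cost
  \<open>0\<close>, and every row demands one unit along its arc. There are less than \<open>n\<close> units of demand, so they
  can be routed one by one along shortest residual paths. This needs only additions and comparisons
  of costs, the flow stays integral, and the potentials certify optimality.
\<close>

section \<open>Determinants of laminar families\<close>

text \<open>One identity, \<open>potential_difference\<close>, carries both halves. For a potential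
  that is constant across contracted edges, the change along a link is a signed sum of the changes
  over the covered arcs. For indicators of cuts this yields the signed rows of the coverage matrix
  and the validity of the computed cover, for node potentials of the network it yields dual
  feasibility, and for the set reached by a failed search it yields a row that no link covers. The
  obstacle is the apex of a cross-link: the path has to change copies there, but must not be
  diverted at a vertex that it merely passes. A vertex strictly inside the stretch that a link
  covers in copy \<open>s\<close> is never cut in copy \<open>s\<close>, because that link makes it
  dependent. So cuts can be made at every vertex with an independent type, which the program can
  read off the links. If both types are independent only one cut is made; otherwise each copy would
  hang below the other. Contraction is never carried out: in the network a contracted edge is a pair
  of opposite arcs of cost \<open>0\<close>, hence \<open>3 n\<close> nodes and
  \<open>m + n + 4 n\<close> arcs.\<close>

lemma det_add_multiples_of_row:
  fixes A :: "'a :: comm_ring_1 mat"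
  assumes A: "A \<in> carrier_mat n n" and i: "i < n" and u: "u i = 0"
  shows "det (mat n n (\<lambda>(p, j). A $$ (p, j) + u p * A $$ (i, j))) = det A"
proof -
  \<comment> \<open>Rows below \<open>m\<close> are already changed. Row \<open>i\<close> stays
    intact because \<open>u i = 0\<close>, so each further row costs one elementary
    operation.\<close>
  let ?B = "\<lambda>m. mat n n (\<lambda>(p, j). if p < m then A $$ (p, j) + u p * A $$ (i, j) else A $$ (p, j))"
  have "det (?B m) = det A" if "m \<le> n" for m
    using that
  proof (induction m)
    case 0
    have "?B 0 = A" using A by auto
    then show ?case by simp
  next
    case (Suc m)
    have "det (?B (Suc m)) = det (?B m)"
    proof (cases "m = i")
      case True
      then have "?B (Suc m) = ?B m" using u by (auto simp: less_Suc_eq)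
      then show ?thesis by simp
    next
      case False
      have "?B (Suc m) = addrow (u m) m i (?B m)"
        using False Suc.prems i u by (intro eq_matI) (auto simp: less_Suc_eq)
      moreover have "det (addrow (u m) m i (?B m)) = det (?B m)"
        using False i by (intro det_addrow[of _ n]) auto
      ultimately show ?thesis by simp
    qed
    then show ?case using Suc by simp
  qed
  moreover have "mat n n (\<lambda>(p, j). A $$ (p, j) + u p * A $$ (i, j)) = ?B n"
    by (intro eq_matI) auto
  ultimately show ?thesis by simp
qed

lemma det_column_single_entry:
  fixes A :: "int mat"
  assumes A: "A \<in> carrier_mat (Suc k) (Suc k)" and i: "i < Suc k"
    and zero: "\<And>p. p < Suc k \<Longrightarrow> p \<noteq> i \<Longrightarrow> A $$ (p, 0) = 0"
    and unit: "A $$ (i, 0) \<in> {-1, 1}"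
    and minor: "det (mat_delete A i 0) \<in> {-1, 0, 1}"
  shows "det A \<in> {-1, 0, 1}"
proof -
  have "det A = (\<Sum>p<Suc k. A $$ (p, 0) * cofactor A p 0)"
    by (rule laplace_expansion_column[OF A]) simp
  also have "\<dots> = A $$ (i, 0) * cofactor A i 0"
    using i zero by (subst sum.remove[of _ i]) (auto intro!: sum.neutral)
  finally have "det A = A $$ (i, 0) * ((-1) ^ i * det (mat_delete A i 0))"
    by (simp add: cofactor_def)
  moreover have "(-1 :: int) ^ i \<in> {-1, 1}" by (cases "even i") auto
  ultimately show ?thesis using unit minor by auto
qed

definition laminar_on :: "nat set \<Rightarrow> (nat \<Rightarrow> 'x set) \<Rightarrow> bool" where
  "laminar_on I S \<longleftrightarrow> (\<forall>i\<in>I. \<forall>j\<in>I. S i \<subseteq> S j \<or> S j \<subseteq> S i \<or> S i \<inter> S j = {})"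

text \<open>
  Induction on the size: pick an inclusion-minimal set \<open>S i\<close> separating the two ends \<open>a\<close>, \<open>b\<close> of the
  first column, \<open>a\<close> inside. Adding multiples of row \<open>i\<close> clears the column and replaces the other
  separating sets by \<open>S p - S i\<close> (if they contain \<open>a\<close>) or \<open>S p \<union> S i\<close> (if they contain \<open>b\<close>), which
  is again a laminar family: in terms of trees, an edge is contracted.
\<close>

lemma det_laminar:
  fixes S :: "nat \<Rightarrow> 'x set" and e :: "nat \<Rightarrow> int"
  assumes "laminar_on {..<k} S" and "\<And>i. i < k \<Longrightarrow> e i \<in> {-1, 1}"
  shows "det (mat k k (\<lambda>(i, j). e i * (of_bool (s j \<in> S i) - of_bool (t j \<in> S i)))) \<in> {-1, 0, 1}"
  using assms
proof (induction k arbitrary: S e s t)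
  case 0
  then show ?case by simp
next
  case (Suc k)
  define A where "A = mat (Suc k) (Suc k)
    (\<lambda>(i, j). e i * (of_bool (s j \<in> S i) - of_bool (t j \<in> S i)))"
  have A: "A \<in> carrier_mat (Suc k) (Suc k)" by (simp add: A_def)
  define Sep where "Sep = {i. i < Suc k \<and> (s 0 \<in> S i) \<noteq> (t 0 \<in> S i)}"
  show ?case
  proof (cases "Sep = {}")
    case True
    have "det A = (\<Sum>p<Suc k. A $$ (p, 0) * cofactor A p 0)"
      by (rule laplace_expansion_column[OF A]) simp
    also have "\<dots> = 0"
      using True by (intro sum.neutral) (auto simp: A_def Sep_def)
    finally show ?thesis by (simp add: A_def)
  next
    case False
    have "finite (S ` Sep)" by (simp add: Sep_def)
    then obtain i where i: "i \<in> Sep" and min: "\<And>p. p \<in> Sep \<Longrightarrow> S p \<subseteq> S i \<Longrightarrow> S p = S i"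
      using False finite_has_minimal[of "S ` Sep"] by (auto simp: image_iff)
    have ik: "i < Suc k" using i by (simp add: Sep_def)
    have lam: "S p \<subseteq> S q \<or> S q \<subseteq> S p \<or> S p \<inter> S q = {}" if "p < Suc k" "q < Suc k" for p q
      using Suc.prems(1) that by (auto simp: laminar_on_def)
    obtain a b where ab: "a \<in> S i" "b \<notin> S i" "(a = s 0 \<and> b = t 0) \<or> (a = t 0 \<and> b = s 0)"
      using i by (auto simp: Sep_def)
    have sepD: "(a \<in> S p \<and> b \<notin> S p) \<or> (b \<in> S p \<and> a \<notin> S p)" if "p \<in> Sep" for p
      using that ab by (auto simp: Sep_def)
    have nsepD: "(a \<in> S p) = (b \<in> S p)" if "p < Suc k" "p \<notin> Sep" for p
      using that ab by (auto simp: Sep_def)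
    define S' where "S' p = (if p \<in> Sep then (if a \<in> S p then S p - S i else S p \<union> S i) else S p)" for p
    \<comment> \<open>The factor \<open>e i\<close> undoes the sign of row \<open>i\<close>, and
      \<open>e p\<close> imposes the sign of row \<open>p\<close>.\<close>
    define u where "u p = (if p \<in> Sep \<and> p \<noteq> i then (if a \<in> S p then - e p * e i else e p * e i) else 0)" for p
    \<comment> \<open>A separating set with \<open>a\<close> inside meets \<open>S i\<close> in
      \<open>a\<close>, so laminarity makes the two comparable and minimality of \<open>S i\<close>
      decides the direction. Any other separating set contains \<open>b\<close> but not
      \<open>a\<close>, so neither set includes the other and they are disjoint.\<close>
    have sup: "S i \<subseteq> S p" if "p \<in> Sep" "a \<in> S p" for p
    proof -
      have "p < Suc k" using that by (simp add: Sep_def)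
      then show ?thesis using lam[OF ik, of p] min[OF that(1)] ab(1) that(2) by blast
    qed
    have disj: "S i \<inter> S p = {}" if "p \<in> Sep" "a \<notin> S p" for p
    proof -
      have "p < Suc k" using that by (simp add: Sep_def)
      then show ?thesis using lam[OF ik, of p] sepD[OF that(1)] ab(1,2) that(2) by blast
    qed
    define B where "B = mat (Suc k) (Suc k) (\<lambda>(p, j). A $$ (p, j) + u p * A $$ (i, j))"
    have B: "B \<in> carrier_mat (Suc k) (Suc k)" by (simp add: B_def)
    have detB: "det B = det A"
      unfolding B_def by (rule det_add_multiples_of_row[OF A ik]) (simp add: u_def)
    have ei: "e i * e i = 1" using Suc.prems(2)[OF ik] by auto
    have entry: "B $$ (p, j) = e p * (of_bool (s j \<in> S' p) - of_bool (t j \<in> S' p))"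
      if p: "p < Suc k" "p \<noteq> i" and j: "j < Suc k" for p j
    proof -
      have *: "B $$ (p, j) = e p * (of_bool (s j \<in> S p) - of_bool (t j \<in> S p))
          + u p * e i * (of_bool (s j \<in> S i) - of_bool (t j \<in> S i))"
        using p j ik by (simp add: B_def A_def mult.assoc)
      consider "p \<notin> Sep" | "p \<in> Sep" "a \<in> S p" | "p \<in> Sep" "a \<notin> S p" by blast
      then show ?thesis
      proof cases
        case 1
        then show ?thesis using * by (simp add: u_def S'_def)
      next
        case 2
        have u: "u p * e i = - e p" using 2 p ei by (simp add: u_def mult.assoc)
        have m: "of_bool (x \<in> S' p) = (of_bool (x \<in> S p) - of_bool (x \<in> S i) :: int)" for x
          using sup[OF 2] 2 by (auto simp: S'_def)
        show ?thesis unfolding * u m by (simp only: algebra_simps mult_minus_left)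
      next
        case 3
        have u: "u p * e i = e p" using 3 p ei by (simp add: u_def mult.assoc)
        have m: "of_bool (x \<in> S' p) = (of_bool (x \<in> S p) + of_bool (x \<in> S i) :: int)" for x
          using disj[OF 3] 3 by (auto simp: S'_def)
        show ?thesis unfolding * u m by (simp only: algebra_simps mult_minus_left)
      qed
    qed
    have lam': "S' p \<subseteq> S' q \<or> S' q \<subseteq> S' p \<or> S' p \<inter> S' q = {}"
      if pq: "p < Suc k" "q < Suc k" "p \<noteq> i" "q \<noteq> i" for p q
    proof -
      have one: ?thesis if "x \<in> Sep" "y \<notin> Sep" "x < Suc k" "y < Suc k"
        "{x, y} = {p, q}" for x y
      proof -
        have y: "S' y = S y" using that by (simp add: S'_def)
        have "S' x \<subseteq> S y \<or> S y \<subseteq> S' x \<or> S' x \<inter> S y = {}"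
        proof (cases "a \<in> S x")
          case True
          have x: "S' x = S x - S i" "S i \<subseteq> S x" using True that sup[of x] by (auto simp: S'_def)
          have "\<not> S y \<subseteq> S i \<Longrightarrow> \<not> S y \<inter> S i = {} \<Longrightarrow> b \<in> S y"
            using lam[OF ik that(4)] nsepD[OF that(4,2)] ab(1) by blast
          then show ?thesis using lam[OF that(3,4)] sepD[OF that(1)] True x by blast
        next
          case False
          have x: "S' x = S x \<union> S i" "S i \<inter> S x = {}" "b \<in> S x"
            using False that disj[of x] sepD[of x] by (auto simp: S'_def)
          have "\<not> S y \<subseteq> S i \<Longrightarrow> \<not> S y \<inter> S i = {} \<Longrightarrow> S i \<subseteq> S y \<and> b \<in> S y"
            using lam[OF ik that(4)] nsepD[OF that(4,2)] ab(1) by blast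
          moreover have "b \<in> S y \<Longrightarrow> S i \<subseteq> S y"
            using lam[OF ik that(4)] nsepD[OF that(4,2)] ab(1,2) by blast
          ultimately show ?thesis using lam[OF that(3,4)] x by blast
        qed
        then show ?thesis using that(5) y by (auto simp: doubleton_eq_iff)
      qed
      have two: ?thesis if "x \<in> Sep" "y \<in> Sep" "a \<in> S x" "a \<notin> S y" "x < Suc k" "y < Suc k"
        "{x, y} = {p, q}" for x y
      proof -
        have "S' x = S x - S i" "S i \<subseteq> S x" "S' y = S y \<union> S i" "S i \<inter> S y = {}"
          using that sup[of x] disj[of y] by (auto simp: S'_def)
        moreover have "S x \<inter> S y = {}"
          using lam[OF that(5,6)] sepD[OF that(1)] sepD[OF that(2)] that(3,4) by blast
        ultimately have "S' x \<inter> S' y = {}" by blast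
        then show ?thesis using that(7) by (auto simp: doubleton_eq_iff)
      qed
      consider "p \<notin> Sep" "q \<notin> Sep" | "p \<in> Sep" "q \<notin> Sep" | "p \<notin> Sep" "q \<in> Sep"
        | "p \<in> Sep" "q \<in> Sep" "a \<in> S p" "a \<notin> S q" | "p \<in> Sep" "q \<in> Sep" "a \<notin> S p" "a \<in> S q"
        | "p \<in> Sep" "q \<in> Sep" "(a \<in> S p) = (a \<in> S q)"
        by blast
      then show ?thesis
      proof cases
        case 1
        then show ?thesis using lam[OF pq(1,2)] by (simp add: S'_def)
      next
        case 2
        then show ?thesis using one[of p q] pq by simp
      next
        case 3
        then show ?thesis using one[of q p] pq by (simp add: insert_commute)
      next
        case 4
        then show ?thesis using two[of p q] pq by simp
      next
        case 5
        then show ?thesis using two[of q p] pq by (simp add: insert_commute)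
      next
        case 6
        have "S p \<subseteq> S q \<or> S q \<subseteq> S p"
          using lam[OF pq(1,2)] 6 sepD[of p] sepD[of q] by blast
        then show ?thesis using 6 by (auto simp: S'_def)
      qed
    qed
    define h where "h p = (if p < i then p else Suc p)" for p
    have h: "h p < Suc k" "h p \<noteq> i" if "p < k" for p using that ik by (auto simp: h_def)
    let ?M = "mat k k (\<lambda>(p, j). (e \<circ> h) p *
      (of_bool ((s \<circ> Suc) j \<in> (S' \<circ> h) p) - of_bool ((t \<circ> Suc) j \<in> (S' \<circ> h) p)))"
    have "mat_delete B i 0 = ?M"
    proof (intro eq_matI)
      fix p j assume "p < dim_row ?M" "j < dim_col ?M"
      then have pj: "p < k" "j < k" by auto
      have "mat_delete B i 0 $$ (p, j) = B $$ (h p, Suc j)"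
        using pj B by (simp add: mat_delete_def h_def)
      then show "mat_delete B i 0 $$ (p, j) = ?M $$ (p, j)"
        using entry[OF h[OF pj(1)], of "Suc j"] pj by simp
    qed (use B in auto)
    moreover have "det ?M \<in> {-1, 0, 1}"
    proof (rule Suc.IH)
      show "laminar_on {..<k} (S' \<circ> h)" using h lam' by (auto simp: laminar_on_def)
      show "(e \<circ> h) p \<in> {-1, 1}" if "p < k" for p using Suc.prems(2) h[OF that] by auto
    qed
    ultimately have minor: "det (mat_delete B i 0) \<in> {-1, 0, 1}" by simp
    have "det B \<in> {-1, 0, 1}"
    proof (rule det_column_single_entry[OF B ik _ _ minor])
      fix p assume p: "p < Suc k" "p \<noteq> i"
      \<comment> \<open>Removing \<open>S i\<close> takes \<open>a\<close> out of the set, and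
        adding \<open>S i\<close> puts \<open>a\<close> next to \<open>b\<close>; either way both
        ends lie on the same side.\<close>
      have "(s 0 \<in> S' p) = (t 0 \<in> S' p)"
      proof (cases "p \<in> Sep")
        case True
        then show ?thesis using sepD[OF True] ab by (auto simp: S'_def)
      next
        case False
        then show ?thesis using nsepD[OF p(1) False] ab by (auto simp: S'_def)
      qed
      then show "B $$ (p, 0) = 0" using entry[OF p] by simp
    next
      have "B $$ (i, 0) = A $$ (i, 0)" using ik by (simp add: B_def u_def)
      then show "B $$ (i, 0) \<in> {-1, 1}" using ab ik Suc.prems(2)[OF ik] by (auto simp: A_def)
    qed
    then show ?thesis using detB by (simp add: A_def)
  qed
qed

section \<open>Programs with bounded loops\<close>

text \<open>With counted loops only, termination is built in: a program denotes a total function on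
  states, and correctness can be proved about that function instead of about
  \<open>exec\<close>.\<close>

datatype fcom =
    FSkip
  | FI nat iexp iexp
  | FR nat iexp rexp
  | FSeq fcom fcom (infixr ";;" 60)
  | FIf bexp fcom fcom
  | FFor nat iexp fcom

definition incr :: "nat \<Rightarrow> state \<Rightarrow> state" where
  "incr k s = set_int k 0 (ints s k 0 + 1) s"

primrec den :: "fcom \<Rightarrow> state \<Rightarrow> state" where
  "den FSkip s = s"
| "den (FI a i e) s = set_int a (ival i s) (ival e s) s"
| "den (FR a i e) s = set_real a (ival i s) (rval e s) s"
| "den (FSeq c d) s = den d (den c s)"
| "den (FIf b c d) s = (if bval b s then den c s else den d s)"
| "den (FFor k b c) s = ((\<lambda>s. incr k (den c s)) ^^ nat (ival b s)) (set_int k 0 0 s)"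

text \<open>The compiled loop evaluates its bound before every round, while \<open>den\<close>
  evaluates it once; \<open>wf_fcom\<close> makes the two agree.\<close>

primrec compile :: "fcom \<Rightarrow> com" where
  "compile FSkip = Skip"
| "compile (FI a i e) = ISet a i e"
| "compile (FR a i e) = RSet a i e"
| "compile (FSeq c d) = Seq (compile c) (compile d)"
| "compile (FIf b c d) = If b (compile c) (compile d)"
| "compile (FFor k b c) = Seq (ISet k (IConst 0) (IConst 0))
     (While (ILess (IGet k (IConst 0)) b)
        (Seq (compile c) (ISet k (IConst 0) (IAdd (IGet k (IConst 0)) (IConst 1)))))"

text \<open>Integer arrays that may be written, the footprint in the frame lemmas; \<open>rw\<close>
  is its counterpart for real arrays.\<close>

primrec iw :: "fcom \<Rightarrow> nat set" where
  "iw FSkip = {}"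
| "iw (FI a i e) = {a}"
| "iw (FR a i e) = {}"
| "iw (FSeq c d) = iw c \<union> iw d"
| "iw (FIf b c d) = iw c \<union> iw d"
| "iw (FFor k b c) = insert k (iw c)"

primrec rw :: "fcom \<Rightarrow> nat set" where
  "rw FSkip = {}"
| "rw (FI a i e) = {}"
| "rw (FR a i e) = {a}"
| "rw (FSeq c d) = rw c \<union> rw d"
| "rw (FIf b c d) = rw c \<union> rw d"
| "rw (FFor k b c) = rw c"

text \<open>
  Loop bounds read only the input array \<open>0\<close>, which is never overwritten; hence the running time is
  bounded by a polynomial that can be read off the program.
\<close>

primrec input_bound :: "iexp \<Rightarrow> bool" where
  "input_bound (IConst z) \<longleftrightarrow> True"
| "input_bound (IGet a e) \<longleftrightarrow> a = 0 \<and> (\<exists>z. e = IConst z)"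
| "input_bound (IAdd e f) \<longleftrightarrow> input_bound e \<and> input_bound f"
| "input_bound (ISub e f) \<longleftrightarrow> False"

text \<open>A read becomes the indeterminate, since the polynomial is evaluated at a number that
  bounds every cell of array \<open>0\<close>.\<close>

primrec bound_poly :: "iexp \<Rightarrow> nat poly" where
  "bound_poly (IConst z) = [:nat z:]"
| "bound_poly (IGet a e) = [:0, 1:]"
| "bound_poly (IAdd e f) = bound_poly e + bound_poly f"
| "bound_poly (ISub e f) = 0"

primrec wf_fcom :: "fcom \<Rightarrow> bool" where
  "wf_fcom FSkip \<longleftrightarrow> True"
| "wf_fcom (FI a i e) \<longleftrightarrow> a \<noteq> 0"
| "wf_fcom (FR a i e) \<longleftrightarrow> True"
| "wf_fcom (FSeq c d) \<longleftrightarrow> wf_fcom c \<and> wf_fcom d"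
| "wf_fcom (FIf b c d) \<longleftrightarrow> wf_fcom c \<and> wf_fcom d"
| "wf_fcom (FFor k b c) \<longleftrightarrow> input_bound b \<and> k \<noteq> 0 \<and> k \<notin> iw c \<and> wf_fcom c"

text \<open>Sums stand in for maxima at a branch. A loop pays \<open>2\<close> for the
  initialization and the last test, and another \<open>2\<close> per round for the test and the
  increment.\<close>

primrec time_poly :: "fcom \<Rightarrow> nat poly" where
  "time_poly FSkip = 1"
| "time_poly (FI a i e) = 1"
| "time_poly (FR a i e) = 1"
| "time_poly (FSeq c d) = time_poly c + time_poly d"
| "time_poly (FIf b c d) = 1 + time_poly c + time_poly d"
| "time_poly (FFor k b c) = 2 + bound_poly b * (2 + time_poly c)"

lemma ints_set_int [simp]: "ints (set_int a i z s) = (ints s)(a := (ints s a)(i := z))"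
  and reals_set_int [simp]: "reals (set_int a i z s) = reals s"
  and ints_set_real [simp]: "ints (set_real a i x s) = ints s"
  and reals_set_real [simp]: "reals (set_real a i x s) = (reals s)(a := (reals s a)(i := x))"
  by (simp_all add: set_int_def set_real_def)

lemma funpow_invariant: "(\<And>s. f (g s) = f s) \<Longrightarrow> f ((g ^^ m) s) = f s"
  by (induction m) auto

lemma den_frame: "a \<notin> iw c \<Longrightarrow> ints (den c s) a = ints s a"
proof (induction c arbitrary: s)
  case (FFor k b c)
  then have "ints (((\<lambda>s. incr k (den c s)) ^^ m) s) a = ints s a" for m s
    by (intro funpow_invariant) (simp add: incr_def)
  then show ?case using FFor by simp
qed auto

lemma den_frame_reals: "a \<notin> rw c \<Longrightarrow> reals (den c s) a = reals s a"
proof (induction c arbitrary: s)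
  case (FFor k b c)
  then have "reals (((\<lambda>s. incr k (den c s)) ^^ m) s) a = reals s a" for m s
    by (intro funpow_invariant) (simp add: incr_def)
  then show ?case using FFor by simp
qed auto

lemma wf_input_unchanged: "wf_fcom c \<Longrightarrow> 0 \<notin> iw c"
  by (induction c) auto

lemma ival_input_bound:
  assumes "input_bound b"
  shows "ints s 0 = ints s' 0 \<Longrightarrow> ival b s = ival b s'"
    and "(\<And>i. ints s 0 i \<le> int n) \<Longrightarrow> ival b s \<le> int (poly (bound_poly b) n)"
  using assms by (induction b) (auto intro!: add_mono)

lemma poly_numeral_nat: "poly (2 :: nat poly) n = 2"
  by (metis of_nat_numeral poly_of_nat of_nat_id)

theorem exec_compile:
  assumes "wf_fcom c" and "\<And>i. ints s 0 i \<le> int n"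
  shows "\<exists>t. exec (compile c) s t (den c s) \<and> t \<le> poly (time_poly c) n"
  using assms
proof (induction c arbitrary: s)
  case FSkip
  then show ?case using exec.Skip by fastforce
next
  case (FI a i e)
  then show ?case using exec.ISet by fastforce
next
  case (FR a i e)
  then show ?case using exec.RSet by fastforce
next
  case (FSeq c d)
  obtain t where t: "exec (compile c) s t (den c s)" "t \<le> poly (time_poly c) n"
    using FSeq.IH(1)[of s] FSeq.prems by auto
  have "ints (den c s) 0 = ints s 0"
    using den_frame wf_input_unchanged FSeq.prems(1) by auto
  then obtain u where u: "exec (compile d) (den c s) u (den d (den c s))" "u \<le> poly (time_poly d) n"
    using FSeq.IH(2)[of "den c s"] FSeq.prems by auto
  show ?case using exec.Seq[OF t(1) u(1)] t(2) u(2) by (intro exI[of _ "t + u"]) auto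
next
  case (FIf b c d)
  obtain t where t: "exec (compile c) s t (den c s)" "t \<le> poly (time_poly c) n"
    using FIf.IH(1)[of s] FIf.prems by auto
  obtain u where u: "exec (compile d) s u (den d s)" "u \<le> poly (time_poly d) n"
    using FIf.IH(2)[of s] FIf.prems by auto
  show ?case
  proof (cases "bval b s")
    case True
    then show ?thesis using exec.IfTrue[OF True t(1)] t(2) by (intro exI[of _ "1 + t"]) auto
  next
    case False
    then show ?thesis using exec.IfFalse[OF False u(1)] u(2) by (intro exI[of _ "1 + u"]) auto
  qed
next
  case (FFor k b c)
  let ?K = "IGet k (IConst 0)"
  let ?body = "Seq (compile c) (ISet k (IConst 0) (IAdd ?K (IConst 1)))"
  let ?tc = "poly (time_poly c) n"
  define B where "B = nat (ival b s)"
  have wf: "input_bound b" "k \<noteq> 0" "k \<notin> iw c" "wf_fcom c" using FFor.prems(1) by auto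
  \<comment> \<open>Induction on the number \<open>m\<close> of rounds still to come; the counter
    then shows \<open>B - m\<close>.\<close>
  have loop: "\<exists>t. exec (While (ILess ?K b) ?body) s' t (((\<lambda>s. incr k (den c s)) ^^ m) s') \<and> t \<le> m * (2 + ?tc) + 1"
    if "ints s' 0 = ints s 0" "ints s' k 0 = int (B - m)" "m \<le> B" for m s'
    using that
  proof (induction m arbitrary: s')
    case 0
    have "ival b s' = ival b s" by (rule ival_input_bound(1)[OF wf(1) 0(1)])
    then have "\<not> bval (ILess ?K b) s'" using 0 by (auto simp: B_def)
    from exec.WhileFalse[OF this] show ?case by auto
  next
    case (Suc m)
    have "ival b s' = ival b s" by (rule ival_input_bound(1)[OF wf(1) Suc.prems(1)])
    then have b: "bval (ILess ?K b) s'" using Suc.prems by (auto simp: B_def)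
    obtain t where t: "exec (compile c) s' t (den c s')" "t \<le> ?tc"
      using FFor.IH[of s'] wf FFor.prems(2) Suc.prems(1) by auto
    have "exec (ISet k (IConst 0) (IAdd ?K (IConst 1))) (den c s') 1 (incr k (den c s'))"
      using exec.ISet[of k "IConst 0" "IAdd ?K (IConst 1)" "den c s'"] by (simp add: incr_def)
    note body = exec.Seq[OF t(1) this]
    have "ints (incr k (den c s')) 0 = ints s 0"
      using Suc.prems(1) den_frame[OF wf_input_unchanged[OF wf(4)]] wf(2) by (simp add: incr_def)
    moreover have "ints (incr k (den c s')) k 0 = int (B - m)"
      using Suc.prems den_frame[OF wf(3)] by (simp add: incr_def)
    ultimately obtain u where u: "exec (While (ILess ?K b) ?body) (incr k (den c s')) u
        (((\<lambda>s. incr k (den c s)) ^^ m) (incr k (den c s')))" "u \<le> m * (2 + ?tc) + 1"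
      using Suc.IH[of "incr k (den c s')"] Suc.prems(3) by auto
    show ?case
      using exec.WhileTrue[OF b body u(1)] t(2) u(2)
      by (intro exI[of _ "1 + (t + 1) + u"]) (auto simp: funpow_Suc_right simp del: funpow.simps)
  qed
  obtain t where t: "exec (While (ILess ?K b) ?body) (set_int k 0 0 s) t
      (((\<lambda>s. incr k (den c s)) ^^ B) (set_int k 0 0 s))" "t \<le> B * (2 + ?tc) + 1"
    using loop[of "set_int k 0 0 s" B] wf(2) by auto
  have "B \<le> poly (bound_poly b) n"
    using ival_input_bound(2)[OF wf(1) FFor.prems(2)] by (simp add: B_def)
  then have "1 + t \<le> poly (time_poly (FFor k b c)) n"
    using t(2) mult_le_mono1[of B "poly (bound_poly b) n" "2 + ?tc"] by (simp add: poly_numeral_nat)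
  moreover have "exec (compile (FFor k b c)) s (1 + t) (den (FFor k b c) s)"
    using exec.Seq[OF exec.ISet[of k "IConst 0" "IConst 0" s], of _ t] t(1) by (simp add: B_def)
  ultimately show ?case by blast
qed

text \<open>The step case is also given what the loop leaves untouched relative to the initial state
  \<open>s0\<close>, so an invariant only has to speak about the arrays that the body
  changes.\<close>

lemma for_invariant:
  assumes N: "ival b s0 = int N" and k: "k \<notin> iw c"
    and init: "I 0 (set_int k 0 0 s0)"
    and step: "\<And>i s. i < N \<Longrightarrow> I i s \<Longrightarrow> ints s k 0 = int i \<Longrightarrow>
      (\<And>a. a \<notin> iw c \<Longrightarrow> a \<noteq> k \<Longrightarrow> ints s a = ints s0 a) \<Longrightarrow>
      (\<And>a. a \<notin> rw c \<Longrightarrow> reals s a = reals s0 a) \<Longrightarrow>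
      I (Suc i) (set_int k 0 (int (Suc i)) (den c s))"
  shows "I N (den (FFor k b c) s0)"
proof -
  let ?s = "\<lambda>i. ((\<lambda>s. incr k (den c s)) ^^ i) (set_int k 0 0 s0)"
  have "I i (?s i) \<and> ints (?s i) k 0 = int i \<and> (\<forall>a. a \<notin> iw c \<longrightarrow> a \<noteq> k \<longrightarrow> ints (?s i) a = ints s0 a) \<and>
      (\<forall>a. a \<notin> rw c \<longrightarrow> reals (?s i) a = reals s0 a)" if "i \<le> N" for i
    using that
  proof (induction i)
    case 0
    then show ?case using init by simp
  next
    case (Suc i)
    let ?t = "?s i"
    have IH: "I i ?t" "ints ?t k 0 = int i"
      "\<And>a. a \<notin> iw c \<Longrightarrow> a \<noteq> k \<Longrightarrow> ints ?t a = ints s0 a"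
      "\<And>a. a \<notin> rw c \<Longrightarrow> reals ?t a = reals s0 a" using Suc by auto
    have s: "?s (Suc i) = set_int k 0 (int (Suc i)) (den c ?t)"
      using den_frame[OF k, of ?t] IH(2) by (simp add: incr_def add.commute)
    have "I (Suc i) (?s (Suc i))" unfolding s
      by (rule step) (use IH Suc.prems in auto)
    then show ?case unfolding s using IH den_frame[of _ c ?t] den_frame_reals[of _ c ?t] by auto
  qed
  from this[of N] show ?thesis using N by simp
qed

section \<open>Minimum cost flows\<close>

abbreviation scalar :: "nat \<Rightarrow> iexp" where "scalar a \<equiv> IGet a (IConst 0)"
abbreviation set_scalar :: "nat \<Rightarrow> iexp \<Rightarrow> fcom" where "set_scalar a e \<equiv> FI a (IConst 0) e"
abbreviation beq :: "iexp \<Rightarrow> iexp \<Rightarrow> bexp" where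
  "beq e f \<equiv> BAnd (BNot (ILess e f)) (BNot (ILess f e))"
abbreviation bor :: "bexp \<Rightarrow> bexp \<Rightarrow> bexp" where
  "bor b c \<equiv> BNot (BAnd (BNot b) (BNot c))"
abbreviation flag :: "nat \<Rightarrow> iexp \<Rightarrow> bexp" where "flag a e \<equiv> beq (IGet a e) (IConst 1)"
abbreviation n_exp :: iexp where "n_exp \<equiv> IGet 0 (IConst 0)"
abbreviation m_exp :: iexp where "m_exp \<equiv> IGet 0 (IConst 3)"
abbreviation n2_exp :: iexp where "n2_exp \<equiv> IAdd n_exp n_exp"
abbreviation n3_exp :: iexp where "n3_exp \<equiv> IAdd n2_exp n_exp"
abbreviation arcs_exp :: iexp where "arcs_exp \<equiv> IAdd m_exp (IAdd n2_exp n3_exp)"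

lemma eq_iff_not_less: "\<not> (x :: int) < y \<and> \<not> y < x \<longleftrightarrow> x = y"
  by auto

text \<open>
  The arcs \<open>0, \<dots>, m + 5 n - 1\<close> of the network have unbounded capacity; arc \<open>m + x\<close> with \<open>x < n\<close>
  has cost \<open>0\<close> and comes with the demand of sending one unit from its head to its tail. The demands
  are met one by one along shortest paths, keeping nonnegative reduced costs.
\<close>

locale flow_net =
  fixes n m :: nat and fr to :: "nat \<Rightarrow> nat" and cost :: "nat \<Rightarrow> real"
  assumes ends: "e < m + 5 * n \<Longrightarrow> fr e < 3 * n \<and> to e < 3 * n"
begin

abbreviation "E \<equiv> m + 5 * n"
abbreviation "K \<equiv> 3 * n"

definition rc :: "(nat \<Rightarrow> real) \<Rightarrow> nat \<Rightarrow> real" where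
  "rc \<pi> e = cost e + \<pi> (fr e) - \<pi> (to e)"

text \<open>Dual feasibility together with complementary slackness, in the form for unbounded
  capacities.\<close>

definition optimal_pair :: "(nat \<Rightarrow> real) \<Rightarrow> (nat \<Rightarrow> int) \<Rightarrow> bool" where
  "optimal_pair \<pi> f \<longleftrightarrow> (\<forall>e<E. 0 \<le> rc \<pi> e \<and> 0 \<le> f e \<and> (0 < f e \<longrightarrow> rc \<pi> e = 0))"

text \<open>For one unit along a path this is the potential of its end minus that of its start,
  which is how conservation is expressed below.\<close>

definition flow_sum :: "(nat \<Rightarrow> int) \<Rightarrow> (nat \<Rightarrow> real) \<Rightarrow> real" where
  "flow_sum f \<psi> = (\<Sum>e<E. of_int (f e) * (\<psi> (to e) - \<psi> (fr e)))"

text \<open>Flow conservation, tested against all potentials instead of stated node by node.\<close>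

definition meets :: "(nat \<Rightarrow> int) \<Rightarrow> nat \<Rightarrow> bool" where
  "meets f k \<longleftrightarrow> (\<forall>\<psi>. flow_sum f \<psi> = (\<Sum>x<k. \<psi> (fr (m + x)) - \<psi> (to (m + x))))"

text \<open>A certificate of infeasibility: no directed path can lead from the head of the slack arc
  to its tail. It refers to the network alone, not to the flow at the time of failure.\<close>

definition blocked :: "nat \<Rightarrow> bool" where
  "blocked x \<longleftrightarrow> (\<exists>S. to (m + x) \<in> S \<and> fr (m + x) \<notin> S \<and> (\<forall>e<E. fr e \<in> S \<longrightarrow> to e \<in> S))"

text \<open>
  A residual arc is a pair of an arc \<open>e\<close> and a direction \<open>d\<close>, where \<open>True\<close> means forward. Backward
  arcs are only used where the flow is positive, and there the reduced cost is \<open>0\<close>.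
\<close>

definition src :: "nat \<Rightarrow> bool \<Rightarrow> nat" where "src e d = (if d then fr e else to e)"
definition dst :: "nat \<Rightarrow> bool \<Rightarrow> nat" where "dst e d = (if d then to e else fr e)"
definition len :: "(nat \<Rightarrow> real) \<Rightarrow> nat \<Rightarrow> bool \<Rightarrow> real" where
  "len \<pi> e d = (if d then rc \<pi> e else 0)"

definition leaving :: "(nat \<Rightarrow> int) \<Rightarrow> nat set \<Rightarrow> nat \<Rightarrow> bool \<Rightarrow> bool" where
  "leaving f S e d \<longleftrightarrow> (d \<or> 0 < f e) \<and> src e d \<in> S \<and> dst e d \<notin> S"

text \<open>Each reached node \<open>z\<close> except the start \<open>t\<close> was entered by a
  tight residual arc \<open>pa z\<close> in direction \<open>di z\<close>. The rank
  \<open>rk z\<close> is the round of entry; it drops towards \<open>t\<close>, so the way back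
  ends. By the last clause every round adds a node or the search is stuck, hence it is stuck after
  \<open>K\<close> rounds.\<close>

definition search_tree :: "(nat \<Rightarrow> int) \<Rightarrow> (nat \<Rightarrow> real) \<Rightarrow> nat \<Rightarrow> nat set \<Rightarrow> (nat \<Rightarrow> nat) \<Rightarrow>
    (nat \<Rightarrow> bool) \<Rightarrow> (nat \<Rightarrow> nat) \<Rightarrow> nat \<Rightarrow> bool" where
  "search_tree f \<pi> t S pa di rk i \<longleftrightarrow>
     optimal_pair \<pi> f \<and> t \<in> S \<and> S \<subseteq> {..<K} \<and>
     (\<forall>z\<in>S. rk z \<le> i \<and> (z \<noteq> t \<longrightarrow> pa z < E \<and> (di z \<or> 0 < f (pa z)) \<and> dst (pa z) (di z) = z \<and>
        src (pa z) (di z) \<in> S \<and> rc \<pi> (pa z) = 0 \<and> rk (src (pa z) (di z)) < rk z)) \<and>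
     (i < card S \<or> (\<forall>e<E. \<forall>d. \<not> leaving f S e d))"

section \<open>Growing a shortest path tree and augmenting along it\<close>

lemma search_tree_start:
  assumes "optimal_pair \<pi> f" "t < K"
  shows "search_tree f \<pi> t {t} pa di (\<lambda>_. 0) 0"
  using assms by (simp add: search_tree_def)

lemma search_tree_stuck:
  assumes "search_tree f \<pi> t S pa di rk i" "\<forall>e<E. \<forall>d. \<not> leaving f S e d"
  shows "search_tree f \<pi> t S pa di rk (Suc i)"
  using assms unfolding search_tree_def by (auto intro: le_SucI)

text \<open>A step of Dijkstra's algorithm carried out on the potentials: all unreached nodes are
  raised by the least residual length. An arc leaving \<open>S\<close> loses no more than its own
  length, so reduced costs stay nonnegative, and the chosen arc becomes tight. An arc entering
  \<open>S\<close> with positive flow is a residual arc of length \<open>0\<close> out of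
  \<open>S\<close>; it forces the raise to be \<open>0\<close> and thus stays tight.\<close>

lemma search_tree_grow:
  assumes tree: "search_tree f \<pi> t S pa di rk i" and e: "e < E" and lv: "leaving f S e d"
    and min: "\<And>e' d'. e' < E \<Longrightarrow> leaving f S e' d' \<Longrightarrow> len \<pi> e d \<le> len \<pi> e' d'"
  defines "\<pi>' \<equiv> \<lambda>z. if z \<in> S then \<pi> z else \<pi> z + len \<pi> e d"
  shows "search_tree f \<pi>' t (insert (dst e d) S) (pa(dst e d := e)) (di(dst e d := d))
    (rk(dst e d := Suc i)) (Suc i)"
proof -
  let ?v = "dst e d" and ?\<delta> = "len \<pi> e d"
  have opt: "\<And>e. e < E \<Longrightarrow> 0 \<le> rc \<pi> e \<and> 0 \<le> f e \<and> (0 < f e \<longrightarrow> rc \<pi> e = 0)"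
    and tS: "t \<in> S" and SK: "S \<subseteq> {..<K}" and card: "i < card S"
    using tree e lv by (auto simp: search_tree_def optimal_pair_def)
  have vS: "?v \<notin> S" and sS: "src e d \<in> S" and res: "d \<or> 0 < f e" using lv by (auto simp: leaving_def)
  have \<delta>: "0 \<le> ?\<delta>" using opt[OF e] by (simp add: len_def)
  have rc': "rc \<pi>' a = rc \<pi> a + (if fr a \<in> S then 0 else ?\<delta>) - (if to a \<in> S then 0 else ?\<delta>)" for a
    by (simp add: rc_def \<pi>'_def)
  have "optimal_pair \<pi>' f"
    unfolding optimal_pair_def
  proof (intro allI impI)
    fix a assume a: "a < E"
    have 1: "?\<delta> \<le> rc \<pi> a" if "fr a \<in> S" "to a \<notin> S"
      using min[OF a, of True] that by (simp add: leaving_def src_def dst_def len_def)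
    have 2: "?\<delta> \<le> 0" if "to a \<in> S" "fr a \<notin> S" "0 < f a"
      using min[OF a, of False] that by (simp add: leaving_def src_def dst_def len_def)
    show "0 \<le> rc \<pi>' a \<and> 0 \<le> f a \<and> (0 < f a \<longrightarrow> rc \<pi>' a = 0)"
      using opt[OF a] 1 2 \<delta> unfolding rc' by (cases "fr a \<in> S"; cases "to a \<in> S") force+
  qed
  moreover have "rc \<pi>' e = 0"
    using vS sS opt[OF e] res unfolding rc' by (auto simp: src_def dst_def len_def split: if_splits)
  moreover have "rc \<pi>' (pa z) = 0" if "z \<in> S" "z \<noteq> t" for z
  proof -
    have "rc \<pi> (pa z) = 0" "fr (pa z) \<in> S" "to (pa z) \<in> S"
      using tree that by (auto simp: search_tree_def src_def dst_def split: if_splits)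
    then show ?thesis by (simp add: rc')
  qed
  moreover have "?v < K" using ends[OF e] by (simp add: dst_def)
  moreover have "finite S" using SK finite_subset by blast
  ultimately show ?thesis
    using tree vS sS tS res card e SK unfolding search_tree_def
    by (auto intro: le_SucI simp: less_Suc_eq_le)
qed

lemma search_tree_complete:
  assumes "search_tree f \<pi> t S pa di rk K"
  shows "\<not> leaving f S e d \<or> \<not> e < E"
proof -
  have "S \<subseteq> {..<K}" using assms by (simp add: search_tree_def)
  then have "card S \<le> K" using card_mono[of "{..<K}" S] by simp
  then show ?thesis using assms by (auto simp: search_tree_def)
qed

text \<open>The path is traced backwards from \<open>h\<close> to \<open>t\<close>, and
  \<open>g\<close> is \<open>f\<close> plus one unit sent from the current node \<open>c\<close> to
  \<open>h\<close>. Only nodes of rank at most \<open>rk c\<close> can still be visited, so residual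
  capacity is claimed only for them. The last clause bounds the number of steps by
  \<open>K\<close>.\<close>

definition walk_inv :: "(nat \<Rightarrow> int) \<Rightarrow> (nat \<Rightarrow> real) \<Rightarrow> nat \<Rightarrow> nat \<Rightarrow> nat set \<Rightarrow> (nat \<Rightarrow> nat) \<Rightarrow>
    (nat \<Rightarrow> bool) \<Rightarrow> (nat \<Rightarrow> nat) \<Rightarrow> nat \<Rightarrow> (nat \<Rightarrow> int) \<Rightarrow> nat \<Rightarrow> bool" where
  "walk_inv f \<pi> t h S pa di rk c g j \<longleftrightarrow>
     c \<in> S \<and> optimal_pair \<pi> g \<and>
     (\<forall>\<psi>. flow_sum g \<psi> = flow_sum f \<psi> + \<psi> h - \<psi> c) \<and>
     (\<forall>z\<in>S. z \<noteq> t \<longrightarrow> rk z \<le> rk c \<longrightarrow> di z \<or> 0 < g (pa z)) \<and>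
     (c = t \<or> rk c + j \<le> K)"

lemma flow_sum_update:
  assumes "e < E"
  shows "flow_sum (g(e := g e + x)) \<psi> = flow_sum g \<psi> + of_int x * (\<psi> (to e) - \<psi> (fr e))"
proof -
  have "flow_sum (g(e := g e + x)) \<psi> = (\<Sum>a<E. of_int (g a) * (\<psi> (to a) - \<psi> (fr a)) +
      (if a = e then of_int x * (\<psi> (to e) - \<psi> (fr e)) else 0))"
    unfolding flow_sum_def by (intro sum.cong) (auto simp: algebra_simps)
  then show ?thesis using assms by (simp add: flow_sum_def sum.distrib)
qed

text \<open>The arcs of the search tree are tight, so changing the flow on them preserves
  complementary slackness with the same potentials.\<close>

lemma walk_step:
  assumes tree: "search_tree f \<pi> t S pa di rk K" and inv: "walk_inv f \<pi> t h S pa di rk c g j"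
    and c: "c \<noteq> t"
  shows "walk_inv f \<pi> t h S pa di rk (src (pa c) (di c))
    (g(pa c := g (pa c) + (if di c then 1 else -1))) (Suc j) \<and> pa c < E"
proof -
  let ?e = "pa c" and ?x = "if di c then 1 else - 1 :: int"
  let ?g = "g(?e := g ?e + ?x)"
  have cS: "c \<in> S" and opt: "\<And>a. a < E \<Longrightarrow> 0 \<le> rc \<pi> a \<and> 0 \<le> g a \<and> (0 < g a \<longrightarrow> rc \<pi> a = 0)"
    and fs: "\<And>\<psi>. flow_sum g \<psi> = flow_sum f \<psi> + \<psi> h - \<psi> c"
    and pos: "\<And>z. z \<in> S \<Longrightarrow> z \<noteq> t \<Longrightarrow> rk z \<le> rk c \<Longrightarrow> di z \<or> 0 < g (pa z)"
    and j: "rk c + j \<le> K"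
    using inv c by (auto simp: walk_inv_def optimal_pair_def)
  have e: "?e < E" "dst ?e (di c) = c" "src ?e (di c) \<in> S" "rc \<pi> ?e = 0" "rk (src ?e (di c)) < rk c"
    using tree cS c by (auto simp: search_tree_def)
  have "optimal_pair \<pi> ?g"
    using opt e(1,4) pos[OF cS c] by (force simp: optimal_pair_def)
  moreover have "flow_sum ?g \<psi> = flow_sum f \<psi> + \<psi> h - \<psi> (src ?e (di c))" for \<psi>
    using flow_sum_update[OF e(1), of g ?x \<psi>] fs[of \<psi>] e(2)
    by (auto simp: src_def dst_def split: if_splits)
  moreover have "di z \<or> 0 < ?g (pa z)" if z: "z \<in> S" "z \<noteq> t" "rk z \<le> rk (src ?e (di c))" for z
  \<comment> \<open>The same arc might have to be used backwards at a later node \<open>z\<close>.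
    Then \<open>z\<close> is its tail; since \<open>z\<close> has smaller rank than
    \<open>c\<close>, node \<open>c\<close> is its head, so the flow on it has just been
    increased.\<close>
  proof (cases "pa z = ?e \<and> \<not> di z")
    case True
    have "dst (pa z) (di z) = z" using tree z by (auto simp: search_tree_def)
    then have "di c" using True e(2,5) z(3) by (auto simp: dst_def split: if_splits)
    then show ?thesis using True opt[OF e(1)] by auto
  next
    case False
    then show ?thesis using pos[OF z(1,2)] z(3) e(5) by auto
  qed
  ultimately show ?thesis using e j by (auto simp: walk_inv_def)
qed

end

text \<open>
  Integer array \<open>6\<close> holds the flow and real array \<open>4\<close> the potentials. Arrays \<open>23\<close>, \<open>24\<close> hold the tails
  and heads of the arcs, \<open>25\<close> marks the nodes reached by the search, and \<open>26\<close>, \<open>27\<close> hold the arc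
  by which a node was reached and its direction. Scalars: \<open>28\<close>, \<open>29\<close> and the real \<open>2\<close> describe
  the best residual arc leaving the reached set, \<open>30\<close> is the current node of the walk back, \<open>31\<close>
  records failure, \<open>32\<close> is the slack arc of the current demand.
\<close>

definition scan_body :: fcom where
  "scan_body =
     FIf (BAnd (flag 25 (IGet 23 (scalar 42))) (BNot (flag 25 (IGet 24 (scalar 42)))))
       (FR 3 (IConst 0) (RSub (RAdd (RGet 0 (scalar 42)) (RGet 4 (IGet 23 (scalar 42))))
          (RGet 4 (IGet 24 (scalar 42)))) ;;
        FIf (bor (ILess (scalar 28) (IConst 0)) (RLess (RGet 3 (IConst 0)) (RGet 2 (IConst 0))))
          (set_scalar 28 (scalar 42) ;; set_scalar 29 (IConst 1) ;; FR 2 (IConst 0) (RGet 3 (IConst 0)))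
          FSkip)
       (FIf (BAnd (BAnd (flag 25 (IGet 24 (scalar 42))) (BNot (flag 25 (IGet 23 (scalar 42)))))
            (ILess (IConst 0) (IGet 6 (scalar 42))))
          (FIf (bor (ILess (scalar 28) (IConst 0)) (RLess (RConst 0) (RGet 2 (IConst 0))))
            (set_scalar 28 (scalar 42) ;; set_scalar 29 (IConst 0) ;; FR 2 (IConst 0) (RConst 0))
            FSkip)
          FSkip)"

definition scan :: fcom where
  "scan = set_scalar 28 (IConst (-1)) ;; FFor 42 arcs_exp scan_body"

definition shift_body :: fcom where
  "shift_body = FIf (flag 25 (scalar 42)) FSkip
     (FR 4 (scalar 42) (RAdd (RGet 4 (scalar 42)) (RGet 2 (IConst 0))))"

definition add_node :: "iexp \<Rightarrow> fcom" where
  "add_node v = FI 26 v (scalar 28) ;; FI 27 v (scalar 29) ;; FI 25 v (IConst 1)"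

definition search_step :: fcom where
  "search_step = scan ;; FIf (ILess (scalar 28) (IConst 0)) FSkip
     (FFor 42 n3_exp shift_body ;;
      FIf (flag 29 (IConst 0)) (add_node (IGet 24 (scalar 28))) (add_node (IGet 23 (scalar 28))))"

definition walk_step_prog :: fcom where
  "walk_step_prog = FIf (beq (scalar 30) (IGet 24 (scalar 32))) FSkip
     (set_scalar 33 (IGet 26 (scalar 30)) ;;
      FIf (flag 27 (scalar 30))
        (FI 6 (scalar 33) (IAdd (IGet 6 (scalar 33)) (IConst 1)) ;; set_scalar 30 (IGet 23 (scalar 33)))
        (FI 6 (scalar 33) (ISub (IGet 6 (scalar 33)) (IConst 1)) ;; set_scalar 30 (IGet 24 (scalar 33))))"

definition meet_demand :: fcom where
  "meet_demand = set_scalar 32 (IAdd m_exp (scalar 40)) ;;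
     FFor 41 n3_exp (FI 25 (scalar 41) (IConst 0)) ;;
     FI 25 (IGet 24 (scalar 32)) (IConst 1) ;;
     FFor 41 n3_exp search_step ;;
     FIf (flag 25 (IGet 23 (scalar 32)))
       (set_scalar 30 (IGet 23 (scalar 32)) ;; FFor 41 n3_exp walk_step_prog)
       (set_scalar 31 (IConst 1))"

definition flow_prog :: fcom where
  "flow_prog = FFor 40 n_exp meet_demand"

lemma writes_flow:
  "iw scan_body = {28, 29}" "rw scan_body = {2, 3}"
  "iw scan = {28, 29, 42}" "rw scan = {2, 3}"
  "iw shift_body = {}" "rw shift_body = {4}"
  "iw (add_node v) = {25, 26, 27}" "rw (add_node v) = {}"
  "iw search_step = {25, 26, 27, 28, 29, 42}" "rw search_step = {2, 3, 4}"
  "iw walk_step_prog = {6, 30, 33}" "rw walk_step_prog = {}"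
  "iw meet_demand = {6, 25, 26, 27, 28, 29, 30, 31, 32, 33, 41, 42}" "rw meet_demand = {2, 3, 4}"
  by (auto simp: scan_body_def scan_def shift_body_def add_node_def search_step_def
      walk_step_prog_def meet_demand_def)

section \<open>The flow program carries out this search and augmentation\<close>

context flow_net
begin

definition represents :: "state \<Rightarrow> bool" where
  "represents s \<longleftrightarrow> ints s 0 0 = int n \<and> ints s 0 3 = int m \<and>
     (\<forall>e<E. ints s 23 (int e) = int (fr e) \<and> ints s 24 (int e) = int (to e) \<and> reals s 0 (int e) = cost e)"

definition fl :: "state \<Rightarrow> nat \<Rightarrow> int" where "fl s e = ints s 6 (int e)"
definition pot :: "state \<Rightarrow> nat \<Rightarrow> real" where "pot s z = reals s 4 (int z)"
definition reached :: "state \<Rightarrow> nat set" where "reached s = {z. z < K \<and> ints s 25 (int z) = 1}"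

lemma fl_set_int [simp]: "a \<noteq> 6 \<Longrightarrow> fl (set_int a i z s) = fl s"
  and pot_set_int [simp]: "pot (set_int a i z s) = pot s"
  and reached_set_int [simp]: "a \<noteq> 25 \<Longrightarrow> reached (set_int a i z s) = reached s"
  by (auto simp: fl_def pot_def reached_def fun_eq_iff)

lemma representsD:
  assumes "represents s"
  shows "ints s 0 0 = int n" "ints s 0 3 = int m"
    "e < E \<Longrightarrow> ints s 23 (int e) = int (fr e)" "e < E \<Longrightarrow> ints s 24 (int e) = int (to e)"
    "e < E \<Longrightarrow> reals s 0 (int e) = cost e" "e < E \<Longrightarrow> fr e < K" "e < E \<Longrightarrow> to e < K"
  using assms ends by (auto simp: represents_def)

lemma represents_cong:
  "represents s \<Longrightarrow> ints s' 0 = ints s 0 \<Longrightarrow> ints s' 23 = ints s 23 \<Longrightarrow> ints s' 24 = ints s 24 \<Longrightarrow>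
    reals s' 0 = reals s 0 \<Longrightarrow> represents s'"
  by (simp add: represents_def)

lemma scan_spec:
  assumes rep: "represents s0"
  defines "s \<equiv> den scan s0"
  shows "(ints s 28 0 = -1 \<and> (\<forall>e<E. \<forall>d. \<not> leaving (fl s0) (reached s0) e d)) \<or>
    (\<exists>e<E. ints s 28 0 = int e \<and> leaving (fl s0) (reached s0) e (ints s 29 0 = 1) \<and>
      reals s 2 0 = len (pot s0) e (ints s 29 0 = 1) \<and>
      (\<forall>e'<E. \<forall>d'. leaving (fl s0) (reached s0) e' d' \<longrightarrow> reals s 2 0 \<le> len (pot s0) e' d'))"
proof -
  let ?f = "fl s0" and ?S = "reached s0" and ?\<pi> = "pot s0"
  let ?I = "\<lambda>i s. (ints s 28 0 = -1 \<and> (\<forall>e<i. \<forall>d. \<not> leaving ?f ?S e d)) \<or>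
    (\<exists>e<i. ints s 28 0 = int e \<and> leaving ?f ?S e (ints s 29 0 = 1) \<and>
      reals s 2 0 = len ?\<pi> e (ints s 29 0 = 1) \<and>
      (\<forall>e'<i. \<forall>d'. leaving ?f ?S e' d' \<longrightarrow> reals s 2 0 \<le> len ?\<pi> e' d'))"
  let ?s1 = "set_int 28 0 (-1) s0"
  have "?I E (den (FFor 42 arcs_exp scan_body) ?s1)"
  proof (rule for_invariant[where I = ?I and N = E])
    show "ival arcs_exp ?s1 = int E" using representsD[OF rep] by simp
    show "42 \<notin> iw scan_body" by (simp add: writes_flow)
    show "?I 0 (set_int 42 0 0 ?s1)" by simp
  next
    fix i and s :: state assume i: "i < E" and I: "?I i s" and k: "ints s 42 0 = int i"
      and fi: "\<And>a. a \<notin> iw scan_body \<Longrightarrow> a \<noteq> 42 \<Longrightarrow> ints s a = ints ?s1 a"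
      and frr: "\<And>a. a \<notin> rw scan_body \<Longrightarrow> reals s a = reals ?s1 a"
    have cells: "ints s 23 (int i) = int (fr i)" "ints s 24 (int i) = int (to i)"
      "reals s 0 (int i) = cost i" "ints s 6 (int i) = ?f i"
      "ints s 25 (int (fr i)) = 1 \<longleftrightarrow> fr i \<in> ?S" "ints s 25 (int (to i)) = 1 \<longleftrightarrow> to i \<in> ?S"
      "reals s 4 (int (fr i)) = ?\<pi> (fr i)" "reals s 4 (int (to i)) = ?\<pi> (to i)"
      using fi[of 23] fi[of 24] fi[of 6] fi[of 25] frr[of 0] frr[of 4] representsD(3-7)[OF rep i]
      by (auto simp: writes_flow fl_def reached_def pot_def)
    \<comment> \<open>An arc can leave the reached set in one direction only, so each arc has a
      single key to compare.\<close>
    have one: "\<not> (leaving ?f ?S i True \<and> leaving ?f ?S i False)"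
      by (auto simp: leaving_def src_def dst_def)
    consider d where "leaving ?f ?S i d" | "\<And>d. \<not> leaving ?f ?S i d" by blast
    then show "?I (Suc i) (set_int 42 0 (int (Suc i)) (den scan_body s))"
    proof cases
      case (1 d)
      have d: "d' = d" if "leaving ?f ?S i d'" for d' using one 1 that by (cases d; cases d') auto
      let ?key = "len ?\<pi> i d"
      have upd: "ints (den scan_body s) 28 0 = int i \<and> (ints (den scan_body s) 29 0 = 1) = d \<and>
          reals (den scan_body s) 2 0 = ?key"
        if "ints s 28 0 < 0 \<or> ?key < reals s 2 0"
        using that 1 k by (cases d)
          (auto simp: scan_body_def cells eq_iff_not_less len_def rc_def leaving_def src_def dst_def)
      have same: "ints (den scan_body s) 28 = ints s 28 \<and> ints (den scan_body s) 29 = ints s 29 \<and>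
          reals (den scan_body s) 2 = reals s 2"
        if "\<not> (ints s 28 0 < 0 \<or> ?key < reals s 2 0)"
        using that 1 k by (cases d)
          (auto simp: scan_body_def cells eq_iff_not_less len_def rc_def leaving_def src_def dst_def)
      show ?thesis
      proof (cases "ints s 28 0 < 0 \<or> ?key < reals s 2 0")
        case True
        have "?key \<le> len ?\<pi> e' d'" if "e' < Suc i" "leaving ?f ?S e' d'" for e' d'
        proof (cases "e' = i")
          case True
          then show ?thesis using d that by auto
        next
          case False
          then have "e' < i" using that by simp
          then show ?thesis using I that True by force
        qed
        then show ?thesis using upd[OF True] 1 by auto
      next
        case False
        have "reals s 2 0 \<le> len ?\<pi> i d'" if "leaving ?f ?S i d'" for d'
          using False d[OF that] by simp
        moreover obtain e where "e < i" "ints s 28 0 = int e" "leaving ?f ?S e (ints s 29 0 = 1)"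
          "reals s 2 0 = len ?\<pi> e (ints s 29 0 = 1)"
          "\<And>e' d'. e' < i \<Longrightarrow> leaving ?f ?S e' d' \<Longrightarrow> reals s 2 0 \<le> len ?\<pi> e' d'"
          using I False by auto
        ultimately show ?thesis using same[OF False]
          by (intro disjI2 exI[of _ e]) (auto simp: less_Suc_eq)
      qed
    next
      case 2
      have c: "\<not> (fr i \<in> ?S \<and> to i \<notin> ?S)" "\<not> (to i \<in> ?S \<and> fr i \<notin> ?S \<and> 0 < ?f i)"
        using 2[of True] 2[of False] by (auto simp: leaving_def src_def dst_def)
      have "den scan_body s = s"
        using c k by (auto simp: scan_body_def cells eq_iff_not_less)
      then show ?thesis using I 2 by (auto simp: less_Suc_eq)
    qed
  qed
  then show ?thesis unfolding s_def scan_def by simp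
qed

lemma shift_spec:
  assumes rep: "represents s0" and z: "z < K"
  shows "pot (den (FFor 42 n3_exp shift_body) s0) z =
    (if z \<in> reached s0 then pot s0 z else pot s0 z + reals s0 2 0)"
proof -
  let ?I = "\<lambda>i s. \<forall>z<K. pot s z =
    (if z < i \<and> z \<notin> reached s0 then pot s0 z + reals s0 2 0 else pot s0 z)"
  have "?I K (den (FFor 42 n3_exp shift_body) s0)"
  proof (rule for_invariant[where I = ?I and N = K])
    show "ival n3_exp s0 = int K" using representsD[OF rep] by simp
    show "42 \<notin> iw shift_body" by (simp add: writes_flow)
    show "?I 0 (set_int 42 0 0 s0)" by (simp add: pot_def)
  next
    fix i and s :: state assume i: "i < K" and I: "?I i s" and k: "ints s 42 0 = int i"
      and fi: "\<And>a. a \<notin> iw shift_body \<Longrightarrow> a \<noteq> 42 \<Longrightarrow> ints s a = ints s0 a"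
      and frr: "\<And>a. a \<notin> rw shift_body \<Longrightarrow> reals s a = reals s0 a"
    have cells: "ints s 25 (int i) = 1 \<longleftrightarrow> i \<in> reached s0" "reals s 2 0 = reals s0 2 0"
      using fi[of 25] frr[of 2] i by (auto simp: writes_flow reached_def)
    show "?I (Suc i) (set_int 42 0 (int (Suc i)) (den shift_body s))"
    proof (intro allI impI)
      fix z assume "z < K"
      then have "pot s z = (if z < i \<and> z \<notin> reached s0 then pot s0 z + reals s0 2 0 else pot s0 z)"
        using I by blast
      then show "pot (set_int 42 0 (int (Suc i)) (den shift_body s)) z =
          (if z < Suc i \<and> z \<notin> reached s0 then pot s0 z + reals s0 2 0 else pot s0 z)"
        using k by (auto simp: shift_body_def cells eq_iff_not_less pot_def less_Suc_eq)
    qed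
  qed
  then show ?thesis using z by simp
qed

definition search_inv :: "nat \<Rightarrow> nat \<Rightarrow> state \<Rightarrow> bool" where
  "search_inv t i s \<longleftrightarrow> (\<exists>pa rk. (\<forall>z\<in>reached s. z \<noteq> t \<longrightarrow> ints s 26 (int z) = int (pa z)) \<and>
     search_tree (fl s) (pot s) t (reached s) pa (\<lambda>z. ints s 27 (int z) = 1) rk i)"

text \<open>The program raises only the cells below \<open>K\<close>, whereas
  \<open>search_tree_grow\<close> raises the potential of every number outside \<open>S\<close>. All
  arcs end below \<open>K\<close>, so the difference is invisible.\<close>

lemma search_tree_cong:
  assumes "search_tree f \<pi> t S pa di rk i" "\<And>z. z < K \<Longrightarrow> \<pi>' z = \<pi> z" "\<And>z. z \<in> S \<Longrightarrow> di' z = di z"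
  shows "search_tree f \<pi>' t S pa di' rk i"
proof -
  have "rc \<pi>' e = rc \<pi> e" if "e < E" for e using ends[OF that] assms(2) by (simp add: rc_def)
  then show ?thesis using assms(1,3) unfolding search_tree_def optimal_pair_def by auto
qed

lemma search_step_spec:
  assumes rep: "represents s0" and inv: "search_inv t i s0"
  shows "search_inv t (Suc i) (den search_step s0)"
proof -
  define s1 where "s1 = den scan s0"
  have fr1: "\<And>a. a \<notin> {28, 29, 42} \<Longrightarrow> ints s1 a = ints s0 a"
    "\<And>a. a \<notin> {2, 3} \<Longrightarrow> reals s1 a = reals s0 a"
    unfolding s1_def using den_frame[of _ scan s0] den_frame_reals[of _ scan s0]
    by (auto simp: writes_flow)
  have same1: "fl s1 = fl s0" "pot s1 = pot s0" "reached s1 = reached s0"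
    using fr1 by (auto simp: fl_def pot_def reached_def fun_eq_iff)
  have rep1: "represents s1" using rep by (rule represents_cong) (auto simp: fr1)
  obtain pa rk where pa: "\<forall>z\<in>reached s0. z \<noteq> t \<longrightarrow> ints s0 26 (int z) = int (pa z)"
    and tree: "search_tree (fl s0) (pot s0) t (reached s0) pa (\<lambda>z. ints s0 27 (int z) = 1) rk i"
    using inv by (auto simp: search_inv_def)
  from scan_spec[OF rep] consider
    "ints s1 28 0 = -1" "\<forall>e<E. \<forall>d. \<not> leaving (fl s0) (reached s0) e d"
    | e where "e < E" "ints s1 28 0 = int e" "leaving (fl s0) (reached s0) e (ints s1 29 0 = 1)"
      "reals s1 2 0 = len (pot s0) e (ints s1 29 0 = 1)"
      "\<And>e' d'. e' < E \<Longrightarrow> leaving (fl s0) (reached s0) e' d' \<Longrightarrow> reals s1 2 0 \<le> len (pot s0) e' d'"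
    unfolding s1_def by blast
  then show ?thesis
  proof cases
    case 1
    then have "den search_step s0 = s1" by (simp add: search_step_def s1_def)
    moreover have "search_inv t (Suc i) s1"
      unfolding search_inv_def same1
      using search_tree_stuck[OF tree 1(2)] pa fr1 by (intro exI[of _ pa] exI[of _ rk]) auto
    ultimately show ?thesis by simp
  next
    case (2 e)
    let ?d = "ints s1 29 0 = 1"
    define s2 where "s2 = den (FFor 42 n3_exp shift_body) s1"
    define v where "v = dst e ?d"
    have fr2: "\<And>a. a \<noteq> 42 \<Longrightarrow> ints s2 a = ints s1 a" "\<And>a. a \<noteq> 4 \<Longrightarrow> reals s2 a = reals s1 a"
      unfolding s2_def using den_frame[of _ "FFor 42 n3_exp shift_body" s1]
        den_frame_reals[of _ "FFor 42 n3_exp shift_body" s1] by (auto simp: writes_flow)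
    define s3 where "s3 = set_int 25 (int v) 1 (set_int 27 (int v) (ints s1 29 0) (set_int 26 (int v) (int e) s2))"
    have den: "den search_step s0 = s3"
      using 2(2) fr2 representsD[OF rep1] 2(1)
      by (auto simp: search_step_def s1_def[symmetric] s2_def[symmetric] s3_def v_def dst_def
          add_node_def eq_iff_not_less simp del: den.simps(6))
    have vK: "v < K" using ends[OF 2(1)] by (simp add: v_def dst_def)
    have vS: "v \<notin> reached s0" using 2(3) by (simp add: leaving_def v_def)
    have fl3: "fl s3 = fl s0" using fr1 fr2 by (auto simp: s3_def fl_def fun_eq_iff)
    have S3: "reached s3 = insert v (reached s0)"
      using fr1 fr2 vK by (auto simp: s3_def reached_def)
    have pot2: "pot s2 z = (if z \<in> reached s0 then pot s0 z else pot s0 z + len (pot s0) e ?d)"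
      if "z < K" for z
      using shift_spec[OF rep1 that] 2(4) same1
      by (simp add: s2_def[symmetric] del: den.simps)
    have st: "search_tree (fl s0) (\<lambda>z. if z \<in> reached s0 then pot s0 z else pot s0 z + len (pot s0) e ?d) t
        (insert v (reached s0)) (pa(v := e)) ((\<lambda>z. ints s0 27 (int z) = 1)(v := ?d))
        (rk(v := Suc i)) (Suc i)"
      unfolding v_def by (rule search_tree_grow[OF tree 2(1,3)]) (use 2(4,5) in auto)
    have "search_tree (fl s3) (pot s3) t (reached s3) (pa(v := e)) (\<lambda>z. ints s3 27 (int z) = 1)
        (rk(v := Suc i)) (Suc i)"
      unfolding fl3 S3
      by (rule search_tree_cong[OF st]) (use fr1 fr2 in \<open>auto simp: pot2 s3_def\<close>)
    moreover have "\<forall>z\<in>reached s3. z \<noteq> t \<longrightarrow> ints s3 26 (int z) = int ((pa(v := e)) z)"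
      unfolding S3 using pa fr1 fr2 by (auto simp: s3_def)
    ultimately show ?thesis unfolding den search_inv_def by blast
  qed
qed

lemma search_spec:
  assumes rep: "represents s0" and inv: "search_inv t 0 s0"
  shows "search_inv t K (den (FFor 41 n3_exp search_step) s0)"
proof (rule for_invariant[where I = "search_inv t" and N = K])
  show "ival n3_exp s0 = int K" using representsD[OF rep] by simp
  show "41 \<notin> iw search_step" by (simp add: writes_flow)
  show "search_inv t 0 (set_int 41 0 0 s0)" using inv by (simp add: search_inv_def)
next
  fix i and s :: state assume I: "search_inv t i s"
    and fi: "\<And>a. a \<notin> iw search_step \<Longrightarrow> a \<noteq> 41 \<Longrightarrow> ints s a = ints s0 a"
    and frr: "\<And>a. a \<notin> rw search_step \<Longrightarrow> reals s a = reals s0 a"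
  have "represents s" using rep by (rule represents_cong) (auto simp: fi frr writes_flow)
  from search_step_spec[OF this I]
  show "search_inv t (Suc i) (set_int 41 0 (int (Suc i)) (den search_step s))"
    by (simp add: search_inv_def)
qed

lemma walk_spec:
  assumes rep: "represents s0" and q: "ints s0 32 0 = int q" "q < E"
    and pa: "\<forall>z\<in>reached s0. z \<noteq> to q \<longrightarrow> ints s0 26 (int z) = int (pa z)"
    and tree: "search_tree (fl s0) (pot s0) (to q) (reached s0) pa (\<lambda>z. ints s0 27 (int z) = 1) rk K"
    and h: "h \<in> reached s0" "ints s0 30 0 = int h"
  defines "s \<equiv> den (FFor 41 n3_exp walk_step_prog) s0"
  shows "optimal_pair (pot s) (fl s) \<and> (\<forall>\<psi>. flow_sum (fl s) \<psi> = flow_sum (fl s0) \<psi> + \<psi> h - \<psi> (to q))"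
proof -
  let ?di = "\<lambda>z. ints s0 27 (int z) = 1"
  let ?W = "walk_inv (fl s0) (pot s0) (to q) h (reached s0) pa ?di rk"
  let ?I = "\<lambda>j s. \<exists>c. ints s 30 0 = int c \<and> ?W c (fl s) j"
  have "?I K s"
    unfolding s_def
  proof (rule for_invariant[where I = ?I and N = K])
    show "ival n3_exp s0 = int K" using representsD[OF rep] by simp
    show "41 \<notin> iw walk_step_prog" by (simp add: writes_flow)
    have "?W h (fl s0) 0"
      using tree h by (auto simp: walk_inv_def search_tree_def)
    then show "?I 0 (set_int 41 0 0 s0)" using h by simp
  next
    fix j and s :: state assume I: "?I j s"
      and fi: "\<And>a. a \<notin> iw walk_step_prog \<Longrightarrow> a \<noteq> 41 \<Longrightarrow> ints s a = ints s0 a"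
    obtain c where c: "ints s 30 0 = int c" "?W c (fl s) j" using I by blast
    have cS: "c \<in> reached s0" using c(2) by (simp add: walk_inv_def)
    have cells: "ints s 32 0 = int q" "ints s 24 (int q) = int (to q)" "ints s 27 = ints s0 27"
      "c \<noteq> to q \<Longrightarrow> ints s 26 (int c) = int (pa c)"
      using fi q representsD(4)[OF rep q(2)] pa cS by (auto simp: writes_flow)
    have cells2: "ints s 23 (int e) = int (fr e)" "ints s 24 (int e) = int (to e)" if "e < E" for e
      using fi representsD(3,4)[OF rep that] by (auto simp: writes_flow)
    show "?I (Suc j) (set_int 41 0 (int (Suc j)) (den walk_step_prog s))"
    proof (cases "c = to q")
      case True
      then have "den walk_step_prog s = s" using c(1) cells by (simp add: walk_step_prog_def)
      moreover have "?W c (fl s) (Suc j)" using c(2) True by (simp add: walk_inv_def)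
      ultimately show ?thesis using c(1) by auto
    next
      case False
      let ?e = "pa c"
      have st: "?W (src ?e (?di c)) ((fl s)(?e := fl s ?e + (if ?di c then 1 else -1))) (Suc j)"
        and e: "?e < E" using walk_step[OF tree c(2) False] by auto
      define s' where "s' = den walk_step_prog s"
      have "ints s' 30 0 = int (src ?e (?di c))"
        "fl s' = (fl s)(?e := fl s ?e + (if ?di c then 1 else -1))"
        using c(1) cells False cells2[OF e]
        by (auto simp: s'_def walk_step_prog_def fl_def src_def fun_eq_iff eq_iff_not_less)
      then show ?thesis unfolding s'_def[symmetric]
        using st by (intro exI[of _ "src ?e (?di c)"]) simp
    qed
  qed
  then obtain c where c: "?W c (fl s) K" by blast
  have rep': "reals s = reals s0"
    unfolding s_def by (rule ext) (simp add: den_frame_reals writes_flow del: den.simps)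
  \<comment> \<open>After \<open>K\<close> steps a node other than the start would have rank
    \<open>0\<close>, yet its predecessor would have a smaller rank.\<close>
  have "c = to q"
  proof (rule ccontr)
    assume "c \<noteq> to q"
    then have "rk c = 0" "rk (src (pa c) (?di c)) < rk c"
      using c tree by (auto simp: walk_inv_def search_tree_def)
    then show False by simp
  qed
  then show ?thesis using c rep' by (simp add: walk_inv_def pot_def[abs_def])
qed

lemma clear_spec:
  assumes rep: "represents s0"
  shows "\<forall>z<K. ints (den (FFor 41 n3_exp (FI 25 (scalar 41) (IConst 0))) s0) 25 (int z) = 0"
proof (rule for_invariant[where I = "\<lambda>i s. \<forall>z<i. ints s 25 (int z) = 0" and N = K])
  show "ival n3_exp s0 = int K" using representsD[OF rep] by simp
qed (auto simp: less_Suc_eq)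

text \<open>The failure flag is never reset, and later demands are still processed after a failure.
  A failed search changes the potentials but not the flow, so the pair remains optimal in every
  case.\<close>

lemma meet_demand_spec:
  assumes rep: "represents s0" and x: "ints s0 40 0 = int x" "x < n"
    and opt: "optimal_pair (pot s0) (fl s0)"
    and prev: "ints s0 31 0 = 0 \<and> meets (fl s0) x \<or> ints s0 31 0 = 1 \<and> (\<exists>y<n. blocked y)"
  defines "s \<equiv> den meet_demand s0"
  shows "optimal_pair (pot s) (fl s) \<and>
    (ints s 31 0 = 0 \<and> meets (fl s) (Suc x) \<or> ints s 31 0 = 1 \<and> (\<exists>y<n. blocked y))"
proof -
  let ?q = "m + x"
  have q: "?q < E" using x by simp
  let ?clear = "FFor 41 n3_exp (FI 25 (scalar 41) (IConst 0))"
  define s1 where "s1 = set_int 32 0 (int ?q) s0"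
  have rep1: "represents s1" using rep by (rule represents_cong) (auto simp: s1_def)
  define s2 where "s2 = den ?clear s1"
  have fr2: "\<And>a. a \<notin> {25, 41} \<Longrightarrow> ints s2 a = ints s1 a" "reals s2 = reals s1"
    unfolding s2_def using den_frame[of _ ?clear s1] den_frame_reals[of _ ?clear s1]
    by (auto simp: fun_eq_iff)
  have clear: "\<forall>z<K. ints s2 25 (int z) = 0" unfolding s2_def by (rule clear_spec[OF rep1])
  have rep2: "represents s2" using rep1 by (rule represents_cong) (auto simp: fr2)
  define s3 where "s3 = set_int 25 (int (to ?q)) 1 s2"
  have rep3: "represents s3" using rep2 by (rule represents_cong) (auto simp: s3_def)
  have tK: "to ?q < K" using ends[OF q] by simp
  have S3: "reached s3 = {to ?q}" using clear tK by (auto simp: reached_def s3_def)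
  have fl3: "fl s3 = fl s0" "pot s3 = pot s0"
    using fr2 by (auto simp: fl_def pot_def s3_def s1_def fun_eq_iff)
  have inv3: "search_inv (to ?q) 0 s3"
    using search_tree_start[OF opt tK] unfolding search_inv_def S3 fl3 by auto
  define s4 where "s4 = den (FFor 41 n3_exp search_step) s3"
  have fr4: "\<And>a. a \<notin> {25, 26, 27, 28, 29, 41, 42} \<Longrightarrow> ints s4 a = ints s3 a"
    "\<And>a. a \<notin> {2, 3, 4} \<Longrightarrow> reals s4 a = reals s3 a"
    unfolding s4_def using den_frame[of _ "FFor 41 n3_exp search_step" s3]
      den_frame_reals[of _ "FFor 41 n3_exp search_step" s3] by (auto simp: writes_flow)
  have rep4: "represents s4" using rep3 by (rule represents_cong) (auto simp: fr4)
  have fl4: "fl s4 = fl s0" using fl3(1) fr4 by (auto simp: fl_def fun_eq_iff)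
  have "search_inv (to ?q) K s4" unfolding s4_def by (rule search_spec[OF rep3 inv3])
  then obtain pa rk where pa: "\<forall>z\<in>reached s4. z \<noteq> to ?q \<longrightarrow> ints s4 26 (int z) = int (pa z)"
    and tree: "search_tree (fl s4) (pot s4) (to ?q) (reached s4) pa (\<lambda>z. ints s4 27 (int z) = 1) rk K"
    by (auto simp: search_inv_def)
  have opt4: "optimal_pair (pot s4) (fl s4)" using tree by (simp add: search_tree_def)
  have scal: "ints s4 32 0 = int ?q" "ints s4 31 = ints s0 31" "ints s4 23 (int ?q) = int (fr ?q)"
    using representsD(3)[OF rep4 q] fr2 fr4 by (auto simp: s3_def s1_def)
  have s: "s = (if ints s4 25 (int (fr ?q)) = 1
      then den (FFor 41 n3_exp walk_step_prog) (set_int 30 0 (int (fr ?q)) s4)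
      else set_int 31 0 1 s4)"
  proof -
    have "den (set_scalar 32 (IAdd m_exp (scalar 40))) s0 = s1"
      using representsD(2)[OF rep] x by (simp add: s1_def)
    moreover have "den (FI 25 (IGet 24 (scalar 32)) (IConst 1)) s2 = s3"
      using representsD(4)[OF rep2 q] fr2 by (simp add: s3_def s1_def)
    ultimately show ?thesis
      using scal unfolding s_def meet_demand_def den.simps(4)
      by (simp add: s2_def[symmetric] s4_def[symmetric] eq_iff_not_less del: den.simps(6))
  qed
  have reach: "ints s4 25 (int (fr ?q)) = 1 \<longleftrightarrow> fr ?q \<in> reached s4"
    using ends[OF q] by (simp add: reached_def)
  show ?thesis
  proof (cases "fr ?q \<in> reached s4")
    case False
    have "blocked x"
      unfolding blocked_def
    proof (intro exI[of _ "reached s4"] conjI allI impI)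
      show "to ?q \<in> reached s4" using tree by (simp add: search_tree_def)
      fix e assume e: "e < E" "fr e \<in> reached s4"
      then show "to e \<in> reached s4"
        using search_tree_complete[OF tree, of e True] by (auto simp: leaving_def src_def dst_def)
    qed (rule False)
    moreover have "s = set_int 31 0 1 s4" using s reach False by simp
    ultimately show ?thesis using opt4 x(2) by auto
  next
    case True
    define s5 where "s5 = set_int 30 0 (int (fr ?q)) s4"
    have rep5: "represents s5" using rep4 by (rule represents_cong) (auto simp: s5_def)
    have same5: "fl s5 = fl s4" "pot s5 = pot s4" "reached s5 = reached s4" "ints s5 26 = ints s4 26"
      "ints s5 27 = ints s4 27"
      by (auto simp: s5_def fl_def pot_def reached_def fun_eq_iff)
    have s': "s = den (FFor 41 n3_exp walk_step_prog) s5" using s reach True by (simp add: s5_def)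
    have w: "optimal_pair (pot s) (fl s) \<and>
        (\<forall>\<psi>. flow_sum (fl s) \<psi> = flow_sum (fl s5) \<psi> + \<psi> (fr ?q) - \<psi> (to ?q))"
      unfolding s'
    proof (rule walk_spec[OF rep5 _ q])
      show "ints s5 32 0 = int ?q" using scal by (simp add: s5_def)
      show "\<forall>z\<in>reached s5. z \<noteq> to ?q \<longrightarrow> ints s5 26 (int z) = int (pa z)" using pa same5 by simp
      show "search_tree (fl s5) (pot s5) (to ?q) (reached s5) pa (\<lambda>z. ints s5 27 (int z) = 1) rk K"
        using tree same5 by simp
      show "fr ?q \<in> reached s5" using True same5 by simp
      show "ints s5 30 0 = int (fr ?q)" by (simp add: s5_def)
    qed
    have "ints s 31 = ints s0 31"
      unfolding s' using scal den_frame[of 31 "FFor 41 n3_exp walk_step_prog" s5]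
      by (simp add: writes_flow s5_def del: den.simps)
    moreover have "meets (fl s) (Suc x)" if "meets (fl s0) x"
      using that w fl4 same5 by (simp add: meets_def)
    ultimately show ?thesis using w prev by auto
  qed
qed

theorem flow_prog_spec:
  assumes rep: "represents s0" and "fl s0 = (\<lambda>_. 0)" "pot s0 = (\<lambda>_. 0)" "ints s0 31 0 = 0"
    and cost: "\<And>e. e < E \<Longrightarrow> 0 \<le> cost e"
  defines "s \<equiv> den flow_prog s0"
  shows "ints s 31 0 = 0 \<and> (\<exists>\<pi>. optimal_pair \<pi> (fl s)) \<and> meets (fl s) n \<or>
    ints s 31 0 = 1 \<and> (\<exists>y<n. blocked y)"
proof -
  let ?I = "\<lambda>x s. optimal_pair (pot s) (fl s) \<and>
    (ints s 31 0 = 0 \<and> meets (fl s) x \<or> ints s 31 0 = 1 \<and> (\<exists>y<n. blocked y))"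
  have "?I n s"
    unfolding s_def flow_prog_def
  proof (rule for_invariant[where I = ?I and N = n])
    show "ival n_exp s0 = int n" using representsD[OF rep] by simp
    show "40 \<notin> iw meet_demand" by (simp add: writes_flow)
    have "optimal_pair (pot s0) (fl s0)" using assms(2,3) cost by (simp add: optimal_pair_def rc_def)
    then show "?I 0 (set_int 40 0 0 s0)"
      using assms(2-4) by (simp add: meets_def flow_sum_def)
  next
    fix i and s :: state assume i: "i < n" and I: "?I i s" and k: "ints s 40 0 = int i"
      and fi: "\<And>a. a \<notin> iw meet_demand \<Longrightarrow> a \<noteq> 40 \<Longrightarrow> ints s a = ints s0 a"
      and frr: "\<And>a. a \<notin> rw meet_demand \<Longrightarrow> reals s a = reals s0 a"
    have "represents s" using rep by (rule represents_cong) (auto simp: fi frr writes_flow)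
    from meet_demand_spec[OF this k i] I
    show "?I (Suc i) (set_int 40 0 (int (Suc i)) (den meet_demand s))"
      by simp
  qed
  then show ?thesis by blast
qed

end

section \<open>Rooted trees with links\<close>

text \<open>The root is its own parent, so \<open>par\<close> can be iterated any number of times;
  iteration becomes stationary at \<open>r\<close>.\<close>

locale rooted_tree =
  fixes V :: "'v set" and r :: 'v and par :: "'v \<Rightarrow> 'v"
  assumes finite_V: "finite V" and root_in: "r \<in> V" and par_root: "par r = r"
    and par_in: "x \<in> V \<Longrightarrow> par x \<in> V"
    and reaches_root: "x \<in> V \<Longrightarrow> \<exists>k. (par ^^ k) x = r"
begin

definition below :: "'v \<Rightarrow> 'v \<Rightarrow> bool" (infix "\<sqsubseteq>" 50) where
  "x \<sqsubseteq> y \<longleftrightarrow> (\<exists>k. (par ^^ k) x = y)"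

definition depth :: "'v \<Rightarrow> nat" where
  "depth x = (LEAST k. (par ^^ k) x = r)"

lemma below_refl [simp]: "x \<sqsubseteq> x"
  unfolding below_def by (rule exI[of _ 0]) simp

lemma below_par [simp]: "x \<sqsubseteq> par x"
  unfolding below_def by (rule exI[of _ 1]) simp

lemma below_trans: "x \<sqsubseteq> y \<Longrightarrow> y \<sqsubseteq> z \<Longrightarrow> x \<sqsubseteq> z"
  unfolding below_def by (metis comp_apply funpow_add)

lemma below_iff: "x \<sqsubseteq> y \<longleftrightarrow> x = y \<or> par x \<sqsubseteq> y"
proof
  assume "x \<sqsubseteq> y"
  then obtain k where k: "(par ^^ k) x = y" by (auto simp: below_def)
  then show "x = y \<or> par x \<sqsubseteq> y"
    unfolding below_def by (cases k) (auto simp: funpow_swap1)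
qed (auto intro: below_trans[OF below_par])

lemma below_linear:
  assumes "x \<sqsubseteq> y" "x \<sqsubseteq> z"
  shows "y \<sqsubseteq> z \<or> z \<sqsubseteq> y"
proof -
  obtain j k where jk: "(par ^^ j) x = y" "(par ^^ k) x = z"
    using assms by (auto simp: below_def)
  show ?thesis
  proof (cases "j \<le> k")
    case True
    then have "(par ^^ (k - j)) y = z" using jk by (metis comp_apply funpow_add le_add_diff_inverse2)
    then show ?thesis by (auto simp: below_def)
  next
    case False
    then have "(par ^^ (j - k)) z = y"
      using jk by (metis comp_apply funpow_add le_add_diff_inverse2 nat_le_linear)
    then show ?thesis by (auto simp: below_def)
  qed
qed

lemma funpow_par_root: "(par ^^ k) r = r"
  by (induction k) (simp_all add: par_root)

lemma root_below: "r \<sqsubseteq> y \<longleftrightarrow> y = r"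
  unfolding below_def using funpow_par_root by auto

lemma below_root: "x \<in> V \<Longrightarrow> x \<sqsubseteq> r"
  unfolding below_def by (rule reaches_root)

lemma depth_root [simp]: "depth r = 0"
  unfolding depth_def by (rule Least_eq_0) simp

lemma depth_par:
  assumes "x \<in> V" "x \<noteq> r"
  shows "depth x = Suc (depth (par x))"
proof -
  obtain k where k: "(par ^^ k) x = r" using reaches_root assms by blast
  have "(LEAST k. (par ^^ k) x = r) = Suc (LEAST m. (par ^^ Suc m) x = r)"
    by (rule Least_Suc[where P = "\<lambda>k. (par ^^ k) x = r", OF k]) (use assms in simp)
  then show ?thesis by (simp add: depth_def funpow_Suc_right del: funpow.simps)
qed

lemma below_in: "x \<sqsubseteq> y \<Longrightarrow> x \<in> V \<Longrightarrow> y \<in> V"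
proof -
  have "x \<in> V \<Longrightarrow> (par ^^ k) x \<in> V" for k by (induction k) (auto simp: par_in)
  then show "x \<sqsubseteq> y \<Longrightarrow> x \<in> V \<Longrightarrow> y \<in> V" by (auto simp: below_def)
qed

lemma below_depth:
  assumes "x \<in> V" "x \<sqsubseteq> y"
  shows "x = y \<or> depth y < depth x"
proof -
  have "x \<in> V \<Longrightarrow> (par ^^ k) x = x \<or> depth ((par ^^ k) x) < depth x" for k
  proof (induction k)
    case (Suc k)
    have in': "(par ^^ k) x \<in> V" using below_in Suc.prems by (auto simp: below_def)
    show ?case
    proof (cases "(par ^^ k) x = r")
      case True
      then show ?thesis using Suc by (simp add: par_root)
    next
      case False
      then have "depth ((par ^^ Suc k) x) < depth ((par ^^ k) x)" using depth_par[OF in'] by simp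
      then show ?thesis using Suc by auto
    qed
  qed simp
  then show ?thesis using assms unfolding below_def by metis
qed

lemma below_antisym: "x \<in> V \<Longrightarrow> x \<sqsubseteq> y \<Longrightarrow> y \<sqsubseteq> x \<Longrightarrow> x = y"
  using below_depth[of x y] below_depth[of y x] below_in[of x y] by auto

lemma not_par_below: "x \<in> V \<Longrightarrow> x \<noteq> r \<Longrightarrow> \<not> par x \<sqsubseteq> x"
  using below_depth[of "par x" x] depth_par[of x] par_in[of x] by fastforce

lemma tree_induct [consumes 1, case_names root step]:
  assumes "x \<in> V" "P r" "\<And>x. x \<in> V \<Longrightarrow> x \<noteq> r \<Longrightarrow> P (par x) \<Longrightarrow> P x"
  shows "P x"
  using assms(1)
proof (induction "depth x" arbitrary: x)
  case 0
  then show ?case using depth_par[of x] assms(2) by (cases "x = r") auto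
next
  case (Suc n)
  then show ?case using depth_par[of x] assms(2,3) par_in by (cases "x = r") auto
qed

text \<open>The ancestors of \<open>x\<close> are \<open>Suc (depth x)\<close> distinct vertices.
  This is why \<open>n\<close> rounds suffice in the loops that explore the tree.\<close>

lemma depth_less_card: "x \<in> V \<Longrightarrow> depth x < card V"
proof -
  assume x: "x \<in> V"
  have "Suc (depth x) \<le> card {y. x \<sqsubseteq> y}"
    using x
  proof (induction rule: tree_induct)
    case root
    have "{y. r \<sqsubseteq> y} = {r}" by (auto simp: root_below)
    then show ?case by simp
  next
    case (step x)
    have "{y. x \<sqsubseteq> y} = insert x {y. par x \<sqsubseteq> y}" using below_iff[of x] by auto
    moreover have "finite {y. par x \<sqsubseteq> y}"
      using finite_V by (rule rev_finite_subset) (use below_in par_in step in blast)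
    ultimately show ?case using step not_par_below[of x] depth_par[of x] by simp
  qed
  moreover have "card {y. x \<sqsubseteq> y} \<le> card V"
    using finite_V by (rule card_mono) (use below_in x in blast)
  ultimately show ?thesis by simp
qed

end

text \<open>The lower end \<open>Q x\<close> of an arc is kept apart from the copy
  \<open>N (ty x) x\<close> of the vertex, because the latter may be redirected to the other copy
  while links still have to start at the arc itself.\<close>

datatype 'v node = N bool 'v | Q 'v

text \<open>
  A non-root vertex \<open>x\<close> stands for the arc between \<open>x\<close> and its parent, which is an up-arc iff
  \<open>ty x\<close>. Throughout, \<open>True\<close> stands for up and \<open>False\<close> for down.
\<close>

locale rooted_links = rooted_tree V r par
  for V :: "'v set" and r :: 'v and par :: "'v \<Rightarrow> 'v" +
  fixes ty :: "'v \<Rightarrow> bool" and L :: "('v \<times> 'v) set"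
  assumes links_in: "L \<subseteq> V \<times> V"
begin

definition endp :: "bool \<Rightarrow> 'v \<times> 'v \<Rightarrow> 'v" where
  "endp s l = (if s then snd l else fst l)"

text \<open>Arcs are covered against their orientation: up-arcs on the way down to
  \<open>snd l\<close>, down-arcs on the way up from \<open>fst l\<close>. So covered arcs of type
  \<open>s\<close> lie above \<open>endp s l\<close> but not above the other end.\<close>

definition C :: "bool \<Rightarrow> 'v \<times> 'v \<Rightarrow> 'v set" where
  "C s l = {x \<in> V - {r}. ty x = s \<and> endp s l \<sqsubseteq> x \<and> \<not> endp (\<not> s) l \<sqsubseteq> x}"

text \<open>The negation of up-independence (\<open>s\<close> true) or down-independence
  (\<open>s\<close> false): \<open>par x \<sqsubseteq> w\<close> says that the upper end of the arc,
  and hence the whole arc, lies in the subtree of \<open>w\<close>.\<close>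

definition dependent :: "bool \<Rightarrow> 'v \<Rightarrow> bool" where
  "dependent s w \<longleftrightarrow>
     (\<exists>l\<in>L. (\<exists>x\<in>C s l. par x \<sqsubseteq> w) \<and> (\<exists>x\<in>C True l \<union> C False l. \<not> par x \<sqsubseteq> w))"

text \<open>
  \<open>D w s\<close>: the arcs of type \<open>s\<close> in the subtree of \<open>w\<close> can be cut off from those above \<open>w\<close>,
  because no link covers arcs of type \<open>s\<close> in the subtree together with arcs outside of it.
\<close>

definition D :: "'v \<Rightarrow> bool \<Rightarrow> bool" where
  "D w s \<longleftrightarrow> (if s then \<not> dependent True w else dependent True w \<and> \<not> dependent False w)"

text \<open>
  The auxiliary forest, given by its parent function: one copy of the tree for the up-arcs and one
  for the down-arcs, where arcs of the other type are contracted. At a vertex \<open>w\<close> with \<open>D w s\<close>,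
  the subtree of copy \<open>s\<close> is cut off and hung below \<open>w\<close> in the other copy. The node \<open>Q x\<close> is the
  lower end of the arc represented by \<open>x\<close>.
\<close>

fun up :: "'v node \<Rightarrow> 'v node" where
  "up (N s x) = (if D x s then N (\<not> s) x else if x = r then N s x
     else if ty x = s then Q x else N s (par x))"
| "up (Q x) = N (ty x) (par x)"

definition lowest :: "bool \<Rightarrow> 'v \<times> 'v \<Rightarrow> 'v \<Rightarrow> bool" where
  "lowest s l x \<longleftrightarrow> x \<in> C s l \<and> (\<forall>y\<in>C s l. x \<sqsubseteq> y)"

definition highest :: "bool \<Rightarrow> 'v \<times> 'v \<Rightarrow> 'v \<Rightarrow> bool" where
  "highest s l x \<longleftrightarrow> x \<in> C s l \<and> (\<forall>y\<in>C s l. y \<sqsubseteq> x)"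

definition lo :: "bool \<Rightarrow> 'v \<times> 'v \<Rightarrow> 'v" where "lo s l = (SOME x. lowest s l x)"
definition hi :: "bool \<Rightarrow> 'v \<times> 'v \<Rightarrow> 'v" where "hi s l = (SOME x. highest s l x)"

text \<open>If the link covers both types, its path runs between the two lowest covered arcs. If it
  covers one type only, the path ends on top of the highest covered arc, in the copy of that type. A
  link that covers nothing becomes a loop at a fixed node.\<close>

definition link_end :: "bool \<Rightarrow> 'v \<times> 'v \<Rightarrow> 'v node" where
  "link_end s l = (if C s l \<noteq> {} then Q (lo s l)
     else if C (\<not> s) l \<noteq> {} then N (\<not> s) (par (hi (\<not> s) l)) else N True r)"

text \<open>Contraction seen from the potentials: no change across the edges that leave nodes of the
  form \<open>N s x\<close>, so that only the drops at the arcs \<open>Q x\<close> remain.\<close>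

definition glued :: "('v node \<Rightarrow> 'b) \<Rightarrow> bool" where
  "glued \<pi> \<longleftrightarrow> (\<forall>x\<in>V. \<forall>s. \<pi> (N s x) = \<pi> (up (N s x)))"

definition drop :: "('v node \<Rightarrow> 'b :: ab_group_add) \<Rightarrow> 'v \<Rightarrow> 'b" where
  "drop \<pi> x = \<pi> (Q x) - \<pi> (up (Q x))"

section \<open>Links as directed paths of the auxiliary forest\<close>

lemma C_D:
  "x \<in> C s l \<Longrightarrow> x \<in> V \<and> x \<noteq> r \<and> ty x = s \<and> endp s l \<sqsubseteq> x \<and> \<not> endp (\<not> s) l \<sqsubseteq> x"
  by (simp add: C_def)

lemma finite_C: "finite (C s l)"
  using finite_V by (rule rev_finite_subset) (auto simp: C_def)

lemma endp_in: "l \<in> L \<Longrightarrow> endp s l \<in> V"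
  using links_in by (auto simp: endp_def)

lemma C_comparable: "x \<in> C s l \<Longrightarrow> y \<in> C s l \<Longrightarrow> x \<sqsubseteq> y \<or> y \<sqsubseteq> x"
  using C_D below_linear by blast

lemma lowest_unique: "lowest s l x \<Longrightarrow> lowest s l y \<Longrightarrow> x = y"
  unfolding lowest_def using C_D[of x s l] below_antisym by blast

lemma highest_unique: "highest s l x \<Longrightarrow> highest s l y \<Longrightarrow> x = y"
  unfolding highest_def using C_D[of x s l] below_antisym by blast

lemma lowest_lo:
  assumes "C s l \<noteq> {}"
  shows "lowest s l (lo s l)"
proof -
  have "Max (depth ` C s l) \<in> depth ` C s l" using assms finite_C by (intro Max_in) auto
  then obtain x where x: "x \<in> C s l" "depth x = Max (depth ` C s l)" by force
  have max: "depth y \<le> depth x" if "y \<in> C s l" for y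
    unfolding x(2) using finite_C that by (intro Max_ge) auto
  have "x \<sqsubseteq> y" if "y \<in> C s l" for y
    using C_comparable[OF x(1) that] below_depth[of y x] C_D[OF that] max[OF that]
    by (metis below_refl leD)
  then have "lowest s l x" using x(1) by (simp add: lowest_def)
  then show ?thesis unfolding lo_def by (rule someI)
qed

lemma highest_hi:
  assumes "C s l \<noteq> {}"
  shows "highest s l (hi s l)"
proof -
  have "Min (depth ` C s l) \<in> depth ` C s l" using assms finite_C by (intro Min_in) auto
  then obtain x where x: "x \<in> C s l" "depth x = Min (depth ` C s l)" by force
  have min: "depth x \<le> depth y" if "y \<in> C s l" for y
    unfolding x(2) using finite_C that by (intro Min_le) auto
  have "y \<sqsubseteq> x" if "y \<in> C s l" for y
    using C_comparable[OF x(1) that] below_depth[of x y] C_D[OF x(1)] min[OF that]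
    by (metis below_refl leD)
  then have "highest s l x" using x(1) by (simp add: highest_def)
  then show ?thesis unfolding hi_def by (rule someI)
qed

lemma lo_eq: "lowest s l x \<Longrightarrow> lo s l = x"
  by (rule lowest_unique[OF lowest_lo]) (auto simp: lowest_def)

lemma hi_eq: "highest s l x \<Longrightarrow> hi s l = x"
  by (rule highest_unique[OF highest_hi]) (auto simp: highest_def)

lemma dependentI:
  "l \<in> L \<Longrightarrow> x \<in> C s l \<Longrightarrow> par x \<sqsubseteq> w \<Longrightarrow> y \<in> C s' l \<Longrightarrow> \<not> par y \<sqsubseteq> w \<Longrightarrow> dependent s w"
  unfolding dependent_def by (cases s') auto

text \<open>Having the upper end in the subtree of \<open>w\<close> is inherited by lower arcs of a
  chain, so the two extremes decide. This is the finite test that the program performs.\<close>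

lemma dependent_iff:
  "dependent s w \<longleftrightarrow> (\<exists>l\<in>L. C s l \<noteq> {} \<and> par (lo s l) \<sqsubseteq> w \<and>
     ((C s l \<noteq> {} \<and> \<not> par (hi s l) \<sqsubseteq> w) \<or> (C (\<not> s) l \<noteq> {} \<and> \<not> par (hi (\<not> s) l) \<sqsubseteq> w)))"
proof -
  have par_mono: "par x \<sqsubseteq> par y" if "x \<sqsubseteq> y" for x y
    using that by (metis below_iff below_par below_trans)
  have 1: "(\<exists>x\<in>C s l. par x \<sqsubseteq> w) \<longleftrightarrow> C s l \<noteq> {} \<and> par (lo s l) \<sqsubseteq> w" for s l
    using lowest_lo[of s l] par_mono below_trans unfolding lowest_def by blast
  have 2: "(\<exists>x\<in>C s l. \<not> par x \<sqsubseteq> w) \<longleftrightarrow> C s l \<noteq> {} \<and> \<not> par (hi s l) \<sqsubseteq> w" for s l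
    using highest_hi[of s l] par_mono below_trans unfolding highest_def by blast
  show ?thesis
    unfolding dependent_def bex_Un 1 2 by (cases s) auto
qed

lemma finite_between: "x \<in> V \<Longrightarrow> finite {m. x \<sqsubseteq> m \<and> P m}"
  using finite_V by (rule rev_finite_subset) (use below_in in blast)

text \<open>Without cuts before \<open>y\<close> the upward walk stays in copy \<open>s\<close>;
  each step either passes an arc of type \<open>s\<close> or crosses a contracted one.\<close>

lemma telescope:
  fixes \<pi> :: "'v node \<Rightarrow> 'b :: ab_group_add"
  assumes \<pi>: "glued \<pi>" and "x \<in> V" "x \<sqsubseteq> y"
    and "\<And>m. x \<sqsubseteq> m \<Longrightarrow> m \<sqsubseteq> y \<Longrightarrow> m \<noteq> y \<Longrightarrow> \<not> D m s"
  shows "\<pi> (N s x) - \<pi> (N s y) = (\<Sum>m | x \<sqsubseteq> m \<and> m \<sqsubseteq> y \<and> m \<noteq> y \<and> ty m = s. drop \<pi> m)"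
proof -
  obtain k where "(par ^^ k) x = y" using assms(3) by (auto simp: below_def)
  then show ?thesis using assms(2,4)
  proof (induction k arbitrary: x)
    case 0
    then have e: "{m. x \<sqsubseteq> m \<and> m \<sqsubseteq> y \<and> m \<noteq> y \<and> ty m = s} = {}" using below_antisym by auto
    show ?case unfolding e using 0 by simp
  next
    case (Suc k)
    let ?A = "\<lambda>x. {m. x \<sqsubseteq> m \<and> m \<sqsubseteq> y \<and> m \<noteq> y \<and> ty m = s}"
    have y: "(par ^^ k) (par x) = y" using Suc.prems(1) by (simp add: funpow_swap1)
    then have le: "par x \<sqsubseteq> y" by (auto simp: below_def)
    show ?case
    proof (cases "x = y")
      case True
      then have e: "?A x = {}" using below_antisym[OF Suc.prems(2)] by auto
      show ?thesis unfolding e using True by simp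
    next
      case False
      then have xr: "x \<noteq> r" using le by (auto simp: par_root root_below)
      have nD: "\<not> D x s" using Suc.prems(3)[of x] False le below_trans[OF below_par le] by auto
      have IH: "\<pi> (N s (par x)) - \<pi> (N s y) = sum (drop \<pi>) (?A (par x))"
        by (rule Suc.IH[OF y par_in[OF Suc.prems(2)]]) (use Suc.prems(3) below_trans below_par in blast)
      have fin: "finite (?A (par x))" by (rule finite_between) (use Suc.prems par_in in auto)
      have xnot: "x \<notin> ?A (par x)" using not_par_below Suc.prems(2) xr by auto
      have step: "\<pi> (N s x) = \<pi> (up (N s x))" using \<pi> Suc.prems(2) unfolding glued_def by blast
      have xin: "x \<sqsubseteq> y" using below_trans[OF below_par le] .
      show ?thesis
      proof (cases "ty x = s")
        case True
        have "?A x = insert x (?A (par x))"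
          using below_iff[of x] True False xin by auto
        moreover have "\<pi> (N s x) = \<pi> (Q x)" using step nD xr True by simp
        moreover have "\<pi> (Q x) = drop \<pi> x + \<pi> (N s (par x))" using True by (simp add: drop_def)
        ultimately show ?thesis using IH fin xnot by (simp add: algebra_simps)
      next
        case False
        have "?A x = ?A (par x)"
          using below_iff[of x] False by auto
        moreover have "\<pi> (N s x) = \<pi> (N s (par x))" using step nD xr False by simp
        ultimately show ?thesis using IH by simp
      qed
    qed
  qed
qed

text \<open>The lowest arc is split off and the telescope begins at its upper end, because nothing
  prevents a cut in copy \<open>s\<close> at \<open>lo s l\<close> itself.\<close>

lemma segment:
  fixes \<pi> :: "'v node \<Rightarrow> 'b :: ab_group_add"
  assumes \<pi>: "glued \<pi>" and C: "C s l \<noteq> {}" and y: "par (lo s l) \<sqsubseteq> y"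
    and nD: "\<And>m. par (lo s l) \<sqsubseteq> m \<Longrightarrow> m \<sqsubseteq> y \<Longrightarrow> m \<noteq> y \<Longrightarrow> \<not> D m s"
    and eq: "C s l = {m. lo s l \<sqsubseteq> m \<and> m \<sqsubseteq> y \<and> m \<noteq> y \<and> ty m = s}"
  shows "\<pi> (Q (lo s l)) - \<pi> (N s y) = sum (drop \<pi>) (C s l)"
proof -
  let ?x = "lo s l"
  let ?A = "{m. par ?x \<sqsubseteq> m \<and> m \<sqsubseteq> y \<and> m \<noteq> y \<and> ty m = s}"
  have x: "?x \<in> V" "?x \<noteq> r" "ty ?x = s" "?x \<in> C s l"
    using lowest_lo[OF C] C_D[of ?x s l] by (auto simp: lowest_def)
  have "C s l = insert ?x ?A"
    using below_iff[of ?x] x(4) unfolding eq by auto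
  moreover have "?x \<notin> ?A" using not_par_below x by auto
  moreover have "finite ?A" by (rule finite_between) (use par_in x in auto)
  moreover have "\<pi> (N s (par ?x)) - \<pi> (N s y) = sum (drop \<pi>) ?A"
    by (rule telescope[OF \<pi> _ y nD]) (use par_in x in auto)
  moreover have "\<pi> (Q ?x) = drop \<pi> ?x + \<pi> (N s (par ?x))" using x by (simp add: drop_def)
  ultimately show ?thesis by (simp add: algebra_simps)
qed

lemma D_not_dependent: "D w s \<Longrightarrow> \<not> dependent s w"
  by (cases s) (auto simp: D_def)

text \<open>No vertex \<open>m\<close> between the extremes is cut in copy \<open>s\<close>: the
  link covers \<open>lo s l\<close> inside the subtree of \<open>m\<close> and \<open>hi s l\<close>
  outside, so \<open>m\<close> is dependent.\<close>

lemma one_sided: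
  fixes \<pi> :: "'v node \<Rightarrow> 'b :: ab_group_add"
  assumes \<pi>: "glued \<pi>" and l: "l \<in> L" and C: "C s l \<noteq> {}"
  shows "\<pi> (Q (lo s l)) - \<pi> (N s (par (hi s l))) = sum (drop \<pi>) (C s l)"
proof -
  let ?x = "lo s l" and ?y = "hi s l"
  have x: "?x \<in> C s l" "\<And>z. z \<in> C s l \<Longrightarrow> ?x \<sqsubseteq> z" using lowest_lo[OF C] by (auto simp: lowest_def)
  have y: "?y \<in> C s l" "\<And>z. z \<in> C s l \<Longrightarrow> z \<sqsubseteq> ?y" using highest_hi[OF C] by (auto simp: highest_def)
  have yV: "?y \<in> V" "?y \<noteq> r" using C_D[OF y(1)] by auto
  have below_hi: "m \<sqsubseteq> ?y" if "?x \<sqsubseteq> m" "m \<sqsubseteq> par ?y" "m \<noteq> par ?y" for m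
    using that below_linear[of ?x m ?y] x(2)[OF y(1)] below_iff[of ?y m] below_antisym[of m "par ?y"]
      below_in[of ?y m] par_in yV below_antisym[of "par ?y" m] by auto
  show ?thesis
  proof (rule segment[OF \<pi> C])
    show "par ?x \<sqsubseteq> par ?y"
      using x(2)[OF y(1)] by (metis below_iff below_par below_trans)
  next
    fix m assume m: "par ?x \<sqsubseteq> m" "m \<sqsubseteq> par ?y" "m \<noteq> par ?y"
    have "m \<sqsubseteq> ?y" by (rule below_hi) (use m below_trans[OF below_par m(1)] in auto)
    then have "\<not> par ?y \<sqsubseteq> m" using not_par_below[OF yV] below_trans by blast
    then have "dependent s m" using dependentI[OF l x(1) m(1) y(1)] by blast
    then show "\<not> D m s" using D_not_dependent by blast
  next
    show "C s l = {m. ?x \<sqsubseteq> m \<and> m \<sqsubseteq> par ?y \<and> m \<noteq> par ?y \<and> ty m = s}" (is "_ = ?R")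
    proof
      show "C s l \<subseteq> ?R"
      proof
        fix m assume m: "m \<in> C s l"
        have "m \<noteq> par ?y" using y(2)[OF m] not_par_below[OF yV] by auto
        then show "m \<in> ?R" using x(2)[OF m] y(2)[OF m] C_D[OF m] below_trans below_par by blast
      qed
      show "?R \<subseteq> C s l"
      proof
        fix m assume m: "m \<in> ?R"
        then have le: "m \<sqsubseteq> ?y" using below_hi by auto
        have "m \<in> V" using m below_in[of ?x m] C_D[OF x(1)] by auto
        moreover have "m \<noteq> r" using le yV by (auto simp: root_below)
        moreover have "endp s l \<sqsubseteq> m" using m C_D[OF x(1)] below_trans by blast
        moreover have "\<not> endp (\<not> s) l \<sqsubseteq> m" using le C_D[OF y(1)] below_trans by blast
        ultimately show "m \<in> C s l" using m by (auto simp: C_def)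
      qed
    qed
  qed
qed

text \<open>Up to the apex \<open>a\<close>, the covered arc that sticks out of the subtree of
  \<open>m\<close> is one of the other type, on the other branch; it again makes \<open>m\<close>
  dependent, so no cut occurs before \<open>a\<close>.\<close>

lemma two_sided:
  fixes \<pi> :: "'v node \<Rightarrow> 'b :: ab_group_add"
  assumes \<pi>: "glued \<pi>" and l: "l \<in> L" and C: "C s l \<noteq> {}" "C (\<not> s) l \<noteq> {}"
    and a: "endp s l \<sqsubseteq> a" "endp (\<not> s) l \<sqsubseteq> a"
      "\<And>z. endp s l \<sqsubseteq> z \<Longrightarrow> endp (\<not> s) l \<sqsubseteq> z \<Longrightarrow> a \<sqsubseteq> z"
  shows "\<pi> (Q (lo s l)) - \<pi> (N s a) = sum (drop \<pi>) (C s l)"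
proof -
  let ?x = "lo s l"
  have x: "?x \<in> C s l" "\<And>z. z \<in> C s l \<Longrightarrow> ?x \<sqsubseteq> z" using lowest_lo[OF C(1)] by (auto simp: lowest_def)
  note xC = C_D[OF x(1)]
  obtain z where z: "z \<in> C (\<not> s) l" using C by blast
  have aV: "a \<in> V" using a(1) below_in endp_in[OF l] by blast
  have inC: "\<not> endp (\<not> s) l \<sqsubseteq> m" if "m \<sqsubseteq> a" "m \<noteq> a" "endp s l \<sqsubseteq> m" for m
    using a(3)[of m] that below_antisym[OF aV, of m] by auto
  have xa: "?x \<sqsubseteq> a" "?x \<noteq> a"
    using below_linear[of "endp s l" ?x a] xC a below_trans by blast+
  show ?thesis
  proof (rule segment[OF \<pi> C(1)])
    show "par ?x \<sqsubseteq> a" using xa below_iff[of ?x a] by blast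
  next
    fix m assume m: "par ?x \<sqsubseteq> m" "m \<sqsubseteq> a" "m \<noteq> a"
    have "endp s l \<sqsubseteq> m" using xC m(1) below_trans[OF _ below_trans[OF below_par m(1)]] by blast
    then have "\<not> endp (\<not> s) l \<sqsubseteq> m" using inC m by blast
    moreover have "endp (\<not> s) l \<sqsubseteq> par z" using C_D[OF z] below_trans below_par by auto
    ultimately have "\<not> par z \<sqsubseteq> m" using below_trans by blast
    then have "dependent s m" using dependentI[OF l x(1) m(1) z] by blast
    then show "\<not> D m s" using D_not_dependent by blast
  next
    show "C s l = {m. ?x \<sqsubseteq> m \<and> m \<sqsubseteq> a \<and> m \<noteq> a \<and> ty m = s}" (is "_ = ?R")
    proof
      show "C s l \<subseteq> ?R"
      proof
        fix m assume m: "m \<in> C s l"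
        note mC = C_D[OF m]
        have "m \<noteq> a" "m \<sqsubseteq> a" using below_linear[of "endp s l" m a] mC a below_trans by blast+
        then show "m \<in> ?R" using x(2)[OF m] mC by blast
      qed
      show "?R \<subseteq> C s l"
      proof
        fix m assume m: "m \<in> ?R"
        have e: "endp s l \<sqsubseteq> m" using m xC below_trans by blast
        have "m \<in> V" using m below_in[of ?x m] xC by auto
        moreover have "m \<noteq> r" using m by (auto simp: root_below)
        ultimately show "m \<in> C s l" using m e inC[of m] by (auto simp: C_def)
      qed
    qed
  qed
qed

subsection \<open>The cuts of the auxiliary forest\<close>

text \<open>One side of the fundamental cut of the edge above \<open>Q x\<close>: all nodes whose
  upward walk uses this edge.\<close>

definition cut :: "'v \<Rightarrow> 'v node set" where
  "cut x = {z. \<exists>k. (up ^^ k) z = Q x}"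

lemma cut_iff: "z \<in> cut x \<longleftrightarrow> z = Q x \<or> up z \<in> cut x"
proof
  assume "z \<in> cut x"
  then obtain k where "(up ^^ k) z = Q x" by (auto simp: cut_def)
  then show "z = Q x \<or> up z \<in> cut x"
    unfolding cut_def by (cases k) (auto simp: funpow_swap1)
next
  assume "z = Q x \<or> up z \<in> cut x"
  then show "z \<in> cut x"
  proof
    assume "z = Q x"
    then show ?thesis unfolding cut_def by (auto intro: exI[of _ 0])
  next
    assume "up z \<in> cut x"
    then obtain k where "(up ^^ k) (up z) = Q x" by (auto simp: cut_def)
    then have "(up ^^ Suc k) z = Q x" by (simp add: funpow_swap1)
    then show ?thesis unfolding cut_def by blast
  qed
qed

text \<open>A node common to both cuts has a single upward walk, which meets \<open>Q x\<close> and
  \<open>Q y\<close>; whatever reaches the earlier one also reaches the later one.\<close>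

lemma cut_laminar: "cut x \<subseteq> cut y \<or> cut y \<subseteq> cut x \<or> cut x \<inter> cut y = {}"
proof -
  have *: "cut x \<subseteq> cut y" if "(up ^^ j) z = Q x" "(up ^^ k) z = Q y" "j \<le> k" for x y z j k
  proof
    fix z' assume "z' \<in> cut x"
    then obtain i where i: "(up ^^ i) z' = Q x" by (auto simp: cut_def)
    have "(up ^^ (k - j)) (Q x) = Q y"
      using that fun_cong[OF funpow_add[of "k - j" j up], of z] by simp
    then have "(up ^^ (k - j + i)) z' = Q y" using i by (simp add: funpow_add)
    then show "z' \<in> cut y" by (auto simp: cut_def)
  qed
  show ?thesis
  proof (rule ccontr)
    assume n: "\<not> ?thesis"
    then obtain z j k where "(up ^^ j) z = Q x" "(up ^^ k) z = Q y" by (auto simp: cut_def)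
    then show False using *[of j z x k y] *[of k z y j x] n by (cases "j \<le> k") auto
  qed
qed

fun valid :: "'v node \<Rightarrow> bool" where
  "valid (N s x) \<longleftrightarrow> x \<in> V"
| "valid (Q x) \<longleftrightarrow> x \<in> V \<and> x \<noteq> r"

text \<open>A measure that drops along \<open>up\<close> except at a fixed point, showing that the
  forest has no cycle. The factor \<open>3\<close> leaves room for a redirected copy, the other copy
  and the lower end at each depth.\<close>

fun rank :: "'v node \<Rightarrow> nat" where
  "rank (N s x) = 3 * depth x + (if D x s then 2 else 1)"
| "rank (Q x) = 3 * depth x"

text \<open>Here the preference for up-arcs in \<open>D\<close> pays off: two redirections at one
  vertex would send its copies to each other in a cycle.\<close>

lemma D_exclusive: "D x s \<Longrightarrow> \<not> D x (\<not> s)"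
  by (cases s) (auto simp: D_def)

lemma up_valid: "valid z \<Longrightarrow> valid (up z)"
  by (cases z) (auto simp: par_in)

lemma up_rank: "valid z \<Longrightarrow> up z = z \<or> rank (up z) < rank z"
proof (cases z)
  case (N s x)
  then show "valid z \<Longrightarrow> ?thesis" using D_exclusive[of x s] depth_par[of x] by auto
next
  case (Q x)
  then show "valid z \<Longrightarrow> ?thesis" using depth_par[of x] by auto
qed

lemma not_in_own_cut:
  assumes "x \<in> V" "x \<noteq> r"
  shows "up (Q x) \<notin> cut x"
proof
  assume "up (Q x) \<in> cut x"
  then obtain k where k: "(up ^^ k) (up (Q x)) = Q x" by (auto simp: cut_def)
  have v: "valid (Q x)" using assms by simp
  have "valid z \<Longrightarrow> valid ((up ^^ k) z) \<and> rank ((up ^^ k) z) \<le> rank z" for z k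
  proof (induction k)
    case (Suc k)
    then show ?case using up_rank[of "(up ^^ k) z"] up_valid[of "(up ^^ k) z"] by fastforce
  qed simp
  from this[OF up_valid[OF v], of k] have "rank (Q x) \<le> rank (up (Q x))" using k by simp
  moreover have "rank (up (Q x)) < rank (Q x)" using up_rank[OF v] by auto
  ultimately show False by simp
qed

lemma glued_cut: "glued (\<lambda>z. of_bool (z \<in> cut x) :: 'b :: zero_neq_one)"
  unfolding glued_def using cut_iff[of "N _ _" x] by auto

text \<open>The cut indicators are dual to the arcs, so they extract a single row from an identity
  between sums of drops.\<close>

lemma drop_cut:
  assumes "x \<in> V" "x \<noteq> r"
  shows "drop (\<lambda>z. of_bool (z \<in> cut x) :: 'b :: ring_1) y = of_bool (y = x)"
  using cut_iff[of "Q y" x] not_in_own_cut[OF assms] by (auto simp: drop_def)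

end

locale willow_links = rooted_links V r par ty L
  for V :: "'v set" and r :: 'v and par :: "'v \<Rightarrow> 'v" and ty :: "'v \<Rightarrow> bool"
    and L :: "('v \<times> 'v) set" +
  assumes willow_link: "l \<in> L \<Longrightarrow> fst l \<sqsubseteq> snd l \<or> snd l \<sqsubseteq> fst l \<or>
    (\<exists>w. fst l \<sqsubseteq> w \<and> snd l \<sqsubseteq> w \<and> (\<forall>z. fst l \<sqsubseteq> z \<longrightarrow> snd l \<sqsubseteq> z \<longrightarrow> w \<sqsubseteq> z) \<and>
       \<not> (dependent True w \<and> dependent False w))"
begin

text \<open>For a link covering both types the two segments meet at the apex \<open>w\<close>.
  Independence of \<open>w\<close> in one type yields \<open>D w True\<close> or
  \<open>D w False\<close>, so one of the copies of \<open>w\<close> hangs below the other and they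
  have equal potential. Up-arcs count negatively because the path descends along them.\<close>

theorem potential_difference:
  fixes \<pi> :: "'v node \<Rightarrow> 'b :: ab_group_add"
  assumes \<pi>: "glued \<pi>" and l: "l \<in> L"
  shows "\<pi> (link_end False l) - \<pi> (link_end True l) =
    sum (drop \<pi>) (C False l) - sum (drop \<pi>) (C True l)"
proof -
  consider "C False l = {}" "C True l = {}" | "C False l \<noteq> {}" "C True l = {}"
    | "C False l = {}" "C True l \<noteq> {}" | "C False l \<noteq> {}" "C True l \<noteq> {}" by blast
  then show ?thesis
  proof cases
    case 1
    then show ?thesis by (simp add: link_end_def)
  next
    case 2
    then show ?thesis using one_sided[OF \<pi> l 2(1)] by (simp add: link_end_def)
  next
    case 3
    then show ?thesis using one_sided[OF \<pi> l 3(2)] by (simp add: link_end_def algebra_simps)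
  next
    case 4
    obtain x y where "x \<in> C False l" "y \<in> C True l" using 4 by blast
    then have "\<not> fst l \<sqsubseteq> snd l" "\<not> snd l \<sqsubseteq> fst l"
      using C_D[of x False l] C_D[of y True l] below_trans unfolding endp_def by auto
    then obtain w where w: "fst l \<sqsubseteq> w" "snd l \<sqsubseteq> w"
      "\<And>z. fst l \<sqsubseteq> z \<Longrightarrow> snd l \<sqsubseteq> z \<Longrightarrow> w \<sqsubseteq> z" "\<not> (dependent True w \<and> dependent False w)"
      using willow_link[OF l] by blast
    have wV: "w \<in> V" using below_in[OF w(1)] l links_in by auto
    have "D w True \<or> D w False" using w(4) by (auto simp: D_def)
    then have "\<pi> (N False w) = \<pi> (N True w)"
      using \<pi> wV unfolding glued_def by (metis (full_types) up.simps(1))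
    moreover have "\<pi> (Q (lo False l)) - \<pi> (N False w) = sum (drop \<pi>) (C False l)"
      by (rule two_sided[OF \<pi> l]) (use 4 w in \<open>auto simp: endp_def\<close>)
    moreover have "\<pi> (Q (lo True l)) - \<pi> (N True w) = sum (drop \<pi>) (C True l)"
      by (rule two_sided[OF \<pi> l]) (use 4 w in \<open>auto simp: endp_def\<close>)
    ultimately show ?thesis using 4 by (simp add: link_end_def algebra_simps)
  qed
qed

end

section \<open>Oriented trees\<close>

theorem (in willow_links) covering_matrix_unimodular:
  assumes f: "f ` {..<k} \<subseteq> V - {r}" and g: "g ` {..<k} \<subseteq> L"
  shows "det (mat k k (\<lambda>(i, j). of_bool (f i \<in> C True (g j) \<union> C False (g j)) :: int)) \<in> {-1, 0, 1}"
proof -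
  \<comment> \<open>Orientation of the row: up-arcs enter \<open>potential_difference\<close> with a
    minus sign.\<close>
  define e :: "nat \<Rightarrow> int" where "e i = (if ty (f i) then -1 else 1)" for i
  have entry: "of_bool (f i \<in> C True (g j) \<union> C False (g j)) =
      e i * (of_bool (link_end False (g j) \<in> cut (f i)) - of_bool (link_end True (g j) \<in> cut (f i)))"
    if ij: "i < k" "j < k" for i j
  proof -
    let ?\<pi> = "\<lambda>z. of_bool (z \<in> cut (f i)) :: int"
    have fi: "f i \<in> V" "f i \<noteq> r" using f ij by auto
    have sum: "sum (drop ?\<pi>) (C s (g j)) = of_bool (f i \<in> C s (g j))" for s
      using finite_C[of s "g j"] by (simp add: drop_cut[OF fi] sum.If_cases)
    have "?\<pi> (link_end False (g j)) - ?\<pi> (link_end True (g j)) =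
        of_bool (f i \<in> C False (g j)) - of_bool (f i \<in> C True (g j))"
      using potential_difference[of ?\<pi> "g j", OF glued_cut] g ij unfolding sum by blast
    moreover have "of_bool (f i \<in> C True (g j) \<union> C False (g j)) =
        e i * (of_bool (f i \<in> C False (g j)) - of_bool (f i \<in> C True (g j)))"
      using C_D[of "f i" True "g j"] C_D[of "f i" False "g j"] by (auto simp: e_def)
    ultimately show ?thesis by simp
  qed
  have "mat k k (\<lambda>(i, j). of_bool (f i \<in> C True (g j) \<union> C False (g j)) :: int) =
      mat k k (\<lambda>(i, j). e i * (of_bool ((link_end False \<circ> g) j \<in> (cut \<circ> f) i)
        - of_bool ((link_end True \<circ> g) j \<in> (cut \<circ> f) i)))"
    by (intro eq_matI) (simp_all add: entry del: Un_iff)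
  also have "det \<dots> \<in> {-1, 0, 1}"
    by (rule det_laminar) (auto simp: laminar_on_def e_def cut_laminar)
  finally show ?thesis .
qed

lemma rtrancl_distinct_path:
  assumes "(a, b) \<in> R\<^sup>*"
  shows "\<exists>p. p \<noteq> [] \<and> hd p = a \<and> last p = b \<and> distinct p \<and> set (vwalk_arcs p) \<subseteq> R \<and>
    set p \<subseteq> insert a (Range R)"
  using assms
proof (induction rule: converse_rtrancl_induct)
  case base
  show ?case by (rule exI[of _ "[b]"]) auto
next
  case (step a a')
  then obtain p where p: "p \<noteq> []" "hd p = a'" "last p = b" "distinct p" "set (vwalk_arcs p) \<subseteq> R"
    "set p \<subseteq> insert a' (Range R)" by blast
  show ?case
  proof (cases "a \<in> set p")
    case True
    then obtain q q' where "p = q @ a # q'" by (auto simp: in_set_conv_decomp)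
    then show ?thesis
      using p step(1) set_vwalk_arcs_append2[of "a # q'" q] by (intro exI[of _ "a # q'"]) auto
  next
    case False
    then show ?thesis using p step(1) by (intro exI[of _ "a # p"]) auto
  qed
qed

section \<open>The parent function of an oriented tree\<close>

locale rooted_oriented_tree =
  fixes T :: "'v pair_pre_digraph" and r :: 'v
  assumes oriented_tree: "oriented_tree T" and root_in_verts: "r \<in> pverts T"
begin

definition adj :: "'v \<Rightarrow> 'v \<Rightarrow> bool" where
  "adj x y \<longleftrightarrow> (x, y) \<in> parcs T \<or> (y, x) \<in> parcs T"

definition edges :: "('v \<times> 'v) set" where "edges = {(x, y). adj x y}"

definition distance :: "'v \<Rightarrow> nat" where
  "distance x = (LEAST k. (x, r) \<in> edges ^^ k)"

text \<open>Connectedness alone provides such a neighbour and makes \<open>par\<close> reach the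
  root; absence of cycles enters in \<open>adj_parent\<close>, where every edge turns out to join a
  vertex to its parent.\<close>

definition par :: "'v \<Rightarrow> 'v" where
  "par x = (if x = r then r else SOME y. adj x y \<and> distance x = Suc (distance y))"

definition ty :: "'v \<Rightarrow> bool" where "ty x \<longleftrightarrow> (x, par x) \<in> parcs T"

definition low :: "'v \<times> 'v \<Rightarrow> 'v" where
  "low a = (if par (fst a) = snd a then fst a else snd a)"

lemma pair_digraph: "pair_digraph T"
  using oriented_tree by (simp add: oriented_tree_def)

interpretation pair_digraph T by (rule pair_digraph)

lemma arcs_sym: "parcs (mk_symmetric (with_proj T)) = edges"
  by (auto simp: parcs_mk_symmetric edges_def adj_def)

lemma vpath_iff: "vpath p (with_proj (mk_symmetric (with_proj T))) \<longleftrightarrow>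
    p \<noteq> [] \<and> distinct p \<and> set p \<subseteq> pverts T \<and> set (vwalk_arcs p) \<subseteq> edges"
  by (auto simp: vpath_def vwalk_def arcs_sym)

lemma adj_sym: "adj x y \<longleftrightarrow> adj y x"
  by (auto simp: adj_def)

lemma adj_in: "adj x y \<Longrightarrow> x \<in> pverts T \<and> y \<in> pverts T \<and> x \<noteq> y"
  using wellformed' no_loops' unfolding adj_def by blast

lemma antiparallel: "(x, y) \<in> parcs T \<Longrightarrow> (y, x) \<notin> parcs T"
  using oriented_tree by (auto simp: oriented_tree_def)

lemma connected_edges: "x \<in> pverts T \<Longrightarrow> y \<in> pverts T \<Longrightarrow> (x, y) \<in> edges\<^sup>*"
proof -
  assume "x \<in> pverts T" "y \<in> pverts T"
  then have "x \<rightarrow>\<^sup>*\<^bsub>with_proj (mk_symmetric (with_proj T))\<^esub> y"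
    using oriented_tree by (auto simp: oriented_tree_def connected_def strongly_connected_def)
  then show ?thesis using reachable_rtranclI arcs_sym by fastforce
qed

lemma no_cycle: "vpath p (with_proj (mk_symmetric (with_proj T))) \<Longrightarrow> 3 \<le> length p \<Longrightarrow>
    adj (last p) (hd p) \<Longrightarrow> False"
  using oriented_tree unfolding oriented_tree_def arcs_sym by (auto simp: edges_def)

lemma distance_witness:
  assumes "x \<in> pverts T" shows "(x, r) \<in> edges ^^ distance x"
proof -
  obtain k where "(x, r) \<in> edges ^^ k"
    using connected_edges[OF assms root_in_verts] rtrancl_power by blast
  then show ?thesis unfolding distance_def by (rule LeastI)
qed

lemma par_spec:
  assumes x: "x \<in> pverts T" "x \<noteq> r"
  shows "adj x (par x) \<and> distance x = Suc (distance (par x))"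
proof -
  obtain k where k: "distance x = Suc k"
    using distance_witness[OF x(1)] x(2) by (cases "distance x") auto
  then obtain y where y: "(x, y) \<in> edges" "(y, r) \<in> edges ^^ k"
    using distance_witness[OF x(1)] relpow_Suc_D2 by metis
  have "y \<in> pverts T" using y(1) adj_in by (auto simp: edges_def)
  have "distance y \<le> k" using y(2) unfolding distance_def by (rule Least_le)
  moreover have "distance x \<le> Suc (distance y)"
    using relpow_Suc_I2[OF y(1) distance_witness[OF \<open>y \<in> pverts T\<close>]]
    unfolding distance_def by (rule Least_le)
  ultimately have "adj x y \<and> distance x = Suc (distance y)"
    using k y(1) by (auto simp: edges_def)
  then show ?thesis
    using someI[of "\<lambda>y. adj x y \<and> distance x = Suc (distance y)" y] x(2) by (simp add: par_def)
qed

lemma distance_zero: "x \<in> pverts T \<Longrightarrow> distance x = 0 \<Longrightarrow> x = r"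
  using distance_witness by force

sublocale rooted_tree "pverts T" r par
proof
  show "finite (pverts T)" by (rule pair_finite_verts)
  show "r \<in> pverts T" by (rule root_in_verts)
  show "par r = r" by (simp add: par_def)
  show pin: "par x \<in> pverts T" if "x \<in> pverts T" for x
    using par_spec[OF that] adj_in root_in_verts by (cases "x = r") (auto simp: par_def)
  show "\<exists>k. (par ^^ k) x = r" if "x \<in> pverts T" for x
    using that
  proof (induction "distance x" arbitrary: x)
    case 0
    then show ?case using distance_zero[of x] by (intro exI[of _ 0]) simp
  next
    case (Suc n)
    show ?case
    proof (cases "x = r")
      case True
      then show ?thesis by (intro exI[of _ 0]) simp
    next
      case False
      then obtain k where "(par ^^ k) (par x) = r"
        using Suc par_spec[of x] pin[of x] by fastforce
      then show ?thesis by (intro exI[of _ "Suc k"]) (simp add: funpow_swap1)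
    qed
  qed
qed

notation below (infix "\<sqsubseteq>" 50)

lemma adj_par: "x \<in> pverts T \<Longrightarrow> x \<noteq> r \<Longrightarrow> adj x (par x)"
  using par_spec by blast

lemma distance_par: "x \<in> pverts T \<Longrightarrow> x \<noteq> r \<Longrightarrow> distance (par x) < distance x"
  using par_spec by fastforce

text \<open>
  Otherwise \<open>x\<close> has, besides its parent, a second neighbour that is not farther from the root, and
  the walk from one to the other via the root does not meet \<open>x\<close>: this closes a cycle.
\<close>

lemma adj_parent:
  assumes "adj x y"
  shows "par x = y \<or> par y = x"
proof -
  have main: "par x = y" if xy: "adj x y" "distance y \<le> distance x" for x y
  proof (rule ccontr)
    assume ny: "par x \<noteq> y"
    note in' = adj_in[OF xy(1)]
    have xr: "x \<noteq> r" using in' xy(2) distance_zero[of y] by (auto simp: distance_def)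
    let ?R = "{(a, b). adj a b \<and> a \<noteq> x \<and> b \<noteq> x}"
    \<comment> \<open>Parents are strictly closer to the root, so an ancestor walk from a vertex
      that is not farther than \<open>x\<close> cannot run into \<open>x\<close>.\<close>
    have to_root: "(z, r) \<in> ?R\<^sup>*" if "z \<in> pverts T" "z \<noteq> x" "distance z \<le> distance x" for z
      using that
    proof (induction rule: tree_induct)
      case (step z)
      have "par z \<noteq> x" using distance_par[OF step(1,2)] step(5) by auto
      moreover have "(par z, r) \<in> ?R\<^sup>*"
        using distance_par[OF step(1,2)] step(5) calculation by (intro step(3)) auto
      ultimately show ?case
        using adj_par[OF step(1,2)] step(4) by (intro converse_rtrancl_into_rtrancl[of z "par z"]) auto
    qed simp
    have "sym ?R" by (auto intro!: symI simp: adj_sym)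
    have px: "par x \<in> pverts T" "par x \<noteq> x" "distance (par x) \<le> distance x"
      using distance_par[of x] in' xr par_in by auto
    have "(y, r) \<in> ?R\<^sup>*" using to_root in' xy by auto
    moreover have "(r, par x) \<in> ?R\<^sup>*"
      using to_root[OF px] sym_rtrancl[OF \<open>sym ?R\<close>] by (auto dest: symD)
    ultimately have "(y, par x) \<in> ?R\<^sup>*" by (rule rtrancl_trans)
    from rtrancl_distinct_path[OF this] obtain p where p: "p \<noteq> []" "hd p = y" "last p = par x"
      "distinct p" "set (vwalk_arcs p) \<subseteq> ?R" "set p \<subseteq> insert y (Range ?R)"
      by (elim exE conjE) (rule that)
    have "x \<notin> set p" using p(6) in' by auto
    have "set p \<subseteq> pverts T" using p(6) in' adj_in by auto
    have "length p \<noteq> 1"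
    proof
      assume "length p = 1"
      then obtain z where "p = [z]" by (auto simp: length_Suc_conv)
      then show False using p ny by auto
    qed
    then have "2 \<le> length p" using p(1) by (cases p) (auto simp: Suc_le_eq)
    show False
    proof (rule no_cycle[of "x # p"])
      show "vpath (x # p) (with_proj (mk_symmetric (with_proj T)))"
        unfolding vpath_iff using p \<open>x \<notin> set p\<close> \<open>set p \<subseteq> pverts T\<close> in' xy
        by (auto simp: edges_def)
      show "3 \<le> length (x # p)" using \<open>2 \<le> length p\<close> by simp
      show "adj (last (x # p)) (hd (x # p))"
        using p adj_par[of x] in' xr by (auto simp: adj_sym)
    qed
  qed
  show ?thesis
    using main[OF assms] main[of y x] assms adj_sym[of x y] by (cases "distance y \<le> distance x") auto
qed

lemma par_neq: "x \<in> pverts T \<Longrightarrow> x \<noteq> r \<Longrightarrow> par x \<noteq> x \<and> par (par x) \<noteq> x"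
  using not_par_below[of x] below_par[of "par x"] by fastforce

lemma adj_cases:
  assumes "adj x y"
  obtains "y = par x" "x \<noteq> r" | "x = par y" "y \<noteq> r"
  using adj_parent[OF assms] adj_in[OF assms] par_root by metis

section \<open>Paths in terms of ancestors\<close>

definition tpath :: "'v \<Rightarrow> 'v \<Rightarrow> 'v list \<Rightarrow> bool" where
  "tpath u v p \<longleftrightarrow> vpath p (with_proj (mk_symmetric (with_proj T))) \<and> hd p = u \<and> last p = v"

text \<open>The only edge between the subtree of \<open>x\<close> and the rest joins
  \<open>x\<close> to \<open>par x\<close>. So a walk avoiding \<open>x\<close> cannot enter, and a
  walk avoiding \<open>par x\<close> cannot leave.\<close>

lemma walk_stays_outside:
  assumes "q \<noteq> []" "set (vwalk_arcs q) \<subseteq> edges" "x \<notin> set q" "\<not> hd q \<sqsubseteq> x"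
  shows "\<not> last q \<sqsubseteq> x"
  using assms
proof (induction q rule: vwalk_arcs.induct)
  case (3 a b q)
  have "adj a b" using 3 by (auto simp: edges_def)
  then have "\<not> b \<sqsubseteq> x"
    using 3(4,5) below_trans[of a b x] below_par[of a] below_iff[of b x] by (elim adj_cases) auto
  then show ?case using 3 by auto
qed auto

lemma walk_stays_inside:
  assumes "q \<noteq> []" "set (vwalk_arcs q) \<subseteq> edges" "par x \<notin> set q" "hd q \<sqsubseteq> x"
  shows "last q \<sqsubseteq> x"
  using assms
proof (induction q rule: vwalk_arcs.induct)
  case (3 a b q)
  have "adj a b" using 3 by (auto simp: edges_def)
  then have "b \<sqsubseteq> x"
    using 3(4,5) below_trans[of b a x] below_par[of b] below_iff[of a x] by (elim adj_cases) auto
  then show ?case using 3 by auto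
qed auto

text \<open>A path does not return to \<open>u\<close>: a step up leaves the subtree of
  \<open>u\<close> for good, and a step down to \<open>x\<close> stays in the subtree of
  \<open>x\<close>. The direction therefore reveals where \<open>v\<close> lies.\<close>

lemma first_step:
  assumes "tpath u v (u # x # p)"
  shows "(x = par u \<and> u \<noteq> r \<and> \<not> v \<sqsubseteq> u \<or> u = par x \<and> x \<noteq> r \<and> v \<sqsubseteq> x) \<and>
    tpath x v (x # p) \<and> u \<in> pverts T \<and> x \<in> pverts T"
proof -
  have p: "set (vwalk_arcs (x # p)) \<subseteq> edges" "u \<notin> set (x # p)" "adj u x" "v = last (x # p)"
    using assms unfolding tpath_def vpath_iff by (auto simp: edges_def)
  note in' = adj_in[OF p(3)]
  from p(3) have "x = par u \<and> u \<noteq> r \<and> \<not> v \<sqsubseteq> u \<or> u = par x \<and> x \<noteq> r \<and> v \<sqsubseteq> x"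
  proof (cases rule: adj_cases)
    case 1
    then have "\<not> x \<sqsubseteq> u" using not_par_below in' by auto
    then show ?thesis using walk_stays_outside[of "x # p" u] p 1 by auto
  next
    case 2
    then show ?thesis using walk_stays_inside[of "x # p" x] p by auto
  qed
  moreover have "tpath x v (x # p)" using assms unfolding tpath_def vpath_iff by auto
  ultimately show ?thesis using in' by blast
qed

lemma tpath_Nil [simp]: "\<not> tpath u v []"
  by (simp add: tpath_def vpath_iff)

lemma tpath_hd: "tpath u v (a # p) \<Longrightarrow> a = u"
  by (simp add: tpath_def)

lemma tpath_refl: "tpath u u p \<Longrightarrow> p = [u]"
  by (cases p) (auto simp: tpath_def vpath_iff split: if_splits)

text \<open>The first step is forced: up unless \<open>v \<sqsubseteq> u\<close>, and otherwise to
  the child of \<open>u\<close> above \<open>v\<close>, which is unique since two of them would be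
  comparable.\<close>

lemma tpath_unique: "tpath u v p \<Longrightarrow> tpath u v q \<Longrightarrow> p = q"
proof (induction p arbitrary: u q)
  case (Cons a p)
  have a: "a = u" using Cons.prems tpath_hd by blast
  show ?case
  proof (cases "u = v")
    case True
    then show ?thesis using Cons.prems tpath_refl by blast
  next
    case False
    obtain x p' where p: "p = x # p'"
      using Cons.prems(1) False a by (cases p) (auto simp: tpath_def)
    obtain y q' where q: "q = u # y # q'"
      using Cons.prems(2) False by (cases q rule: vwalk_arcs.cases) (auto simp: tpath_def)
    note fx = first_step[OF Cons.prems(1)[unfolded a p]]
    note fy = first_step[OF Cons.prems(2)[unfolded q]]
    have uV: "u \<in> pverts T" "x \<in> pverts T" "y \<in> pverts T" using fx fy by auto
    have "x = y"
    proof (cases "v \<sqsubseteq> u")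
      case True
      then have xy: "u = par x" "x \<noteq> r" "v \<sqsubseteq> x" "u = par y" "y \<noteq> r" "v \<sqsubseteq> y" using fx fy by auto
      have "x = y" if "x \<sqsubseteq> y" "par x = par y" "y \<in> pverts T" "y \<noteq> r" for x y
        using that below_iff[of x y] not_par_below[of y] by auto
      then show ?thesis using below_linear[of v x y] xy uV by metis
    next
      case False
      have "v \<sqsubseteq> u" if "v \<sqsubseteq> z" "u = par z" for z using that below_trans[of v z u] by auto
      then show ?thesis using fx fy False by blast
    qed
    then have "x # p' = y # q'" using Cons.IH[of x "y # q'"] fx fy p by auto
    then show ?thesis using a p q by simp
  qed
qed simp

lemma tpath_exists:
  assumes "u \<in> pverts T" "v \<in> pverts T"
  shows "\<exists>p. tpath u v p"
proof -
  obtain p where p: "p \<noteq> []" "hd p = u" "last p = v" "distinct p" "set (vwalk_arcs p) \<subseteq> edges"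
    "set p \<subseteq> insert u (Range edges)"
    using rtrancl_distinct_path[OF connected_edges[OF assms]] by blast
  have "set p \<subseteq> pverts T" using p(6) assms adj_in by (auto simp: edges_def)
  then show ?thesis using p by (auto simp: tpath_def vpath_iff)
qed

lemma tpath_tree_path:
  assumes "u \<in> pverts T" "v \<in> pverts T"
  shows "tpath u v (tree_path T u v)"
proof -
  have "\<exists>!p. tpath u v p" using tpath_exists[OF assms] tpath_unique by blast
  from theI'[OF this] show ?thesis unfolding tree_path_def tpath_def .
qed

text \<open>By induction along the path: moving to the next vertex changes the set of ancestors by
  one vertex, namely the lower end of the arc just traversed.\<close>

lemma tpath_arcs:
  assumes "tpath u v p"
  shows "(a, b) \<in> set (vwalk_arcs p) \<longleftrightarrow>
    (a \<noteq> r \<and> b = par a \<and> u \<sqsubseteq> a \<and> \<not> v \<sqsubseteq> a) \<or> (b \<noteq> r \<and> a = par b \<and> v \<sqsubseteq> b \<and> \<not> u \<sqsubseteq> b)"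
  using assms
proof (induction p arbitrary: u)
  case (Cons c p)
  have c: "c = u" using Cons.prems tpath_hd by blast
  show ?case
  proof (cases p)
    case Nil
    then have "u = v" using Cons.prems c by (auto simp: tpath_def)
    then show ?thesis using Nil by auto
  next
    case (Cons x p')
    note fs = first_step[OF \<open>tpath u v (c # p)\<close>[unfolded c Cons]]
    have IH: "(a, b) \<in> set (vwalk_arcs p) \<longleftrightarrow>
      (a \<noteq> r \<and> b = par a \<and> x \<sqsubseteq> a \<and> \<not> v \<sqsubseteq> a) \<or> (b \<noteq> r \<and> a = par b \<and> v \<sqsubseteq> b \<and> \<not> x \<sqsubseteq> b)"
      using Cons.IH[of x] fs Cons by simp
    have arcs: "(a, b) \<in> set (vwalk_arcs (c # p)) \<longleftrightarrow> (a = u \<and> b = x) \<or> (a, b) \<in> set (vwalk_arcs p)"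
      using c Cons by auto
    from fs consider "x = par u" "u \<noteq> r" "\<not> v \<sqsubseteq> u" | "u = par x" "x \<noteq> r" "v \<sqsubseteq> x" by blast
    then show ?thesis
    proof cases
      case 1
      then show ?thesis unfolding arcs IH using below_iff[of u a] below_iff[of u b] by auto
    next
      case 2
      have "\<not> u \<sqsubseteq> x" using 2 not_par_below fs by auto
      then show ?thesis unfolding arcs IH using 2 below_iff[of x a] below_iff[of x b] by auto
    qed
  qed
qed simp

lemma tpath_root:
  assumes "tpath w r p"
  shows "set p = {y. w \<sqsubseteq> y} \<and> length p = Suc (depth w)"
  using assms
proof (induction p arbitrary: w)
  case (Cons c p)
  have c: "c = w" using Cons.prems tpath_hd by blast
  show ?case
  proof (cases p)
    case Nil
    then have "w = r" using Cons.prems c by (auto simp: tpath_def)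
    then show ?thesis using Nil c by (auto simp: root_below)
  next
    case (Cons x p')
    note fs = first_step[OF \<open>tpath w r (c # p)\<close>[unfolded c Cons]]
    then have x: "x = par w" "w \<noteq> r" by (auto simp: root_below)
    have "set p = {y. x \<sqsubseteq> y} \<and> length p = Suc (depth x)" using Cons.IH[of x] fs Cons by simp
    then show ?thesis using c x depth_par[of w] fs below_iff[of w] by auto
  qed
qed simp

lemma descendants_eq: "v \<in> pverts T \<Longrightarrow> descendants T r v = {w \<in> pverts T. w \<sqsubseteq> v}"
  unfolding descendants_def using tpath_root[OF tpath_tree_path[OF _ root_in_verts]] by auto

lemma length_tree_path: "v \<in> pverts T \<Longrightarrow> length (tree_path T v r) = Suc (depth v)"
  using tpath_root[OF tpath_tree_path[OF _ root_in_verts]] by auto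

lemma arc_cases:
  assumes "(x, y) \<in> parcs T"
  obtains "y = par x" "x \<noteq> r" "ty x" "low (x, y) = x"
  | "x = par y" "y \<noteq> r" "\<not> ty y" "low (x, y) = y"
proof -
  have "adj x y" using assms by (simp add: adj_def)
  then show ?thesis
  proof (cases rule: adj_cases)
    case 1
    then show ?thesis using assms that(1) by (simp add: ty_def low_def)
  next
    case 2
    have "par x \<noteq> y" using 2 par_neq adj_in[OF \<open>adj x y\<close>] by auto
    then show ?thesis using 2 assms antiparallel[of x y] that(2) by (simp add: ty_def low_def)
  qed
qed

lemma low_in: "a \<in> parcs T \<Longrightarrow> low a \<in> pverts T - {r}"
proof -
  assume a: "a \<in> parcs T"
  obtain x y where xy: "a = (x, y)" by force
  have arc: "(x, y) \<in> parcs T" using a xy by simp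
  show ?thesis using arc wellformed'[OF arc] unfolding xy by (elim arc_cases) auto
qed

lemma low_inj: "inj_on low (parcs T)"
proof (rule inj_onI)
  fix a b assume "a \<in> parcs T" "b \<in> parcs T" "low a = low b"
  then show "a = b" by (cases a; cases b) (auto elim!: arc_cases)
qed

lemma low_surj:
  assumes "x \<in> pverts T" "x \<noteq> r"
  shows "\<exists>a\<in>parcs T. low a = x"
proof (cases "ty x")
  case True
  then show ?thesis by (intro bexI[of _ "(x, par x)"]) (auto simp: low_def ty_def)
next
  case False
  then have "(par x, x) \<in> parcs T" using adj_par[OF assms] by (auto simp: adj_def ty_def)
  then show ?thesis using par_neq[OF assms] by (intro bexI[of _ "(par x, x)"]) (auto simp: low_def)
qed

lemma up_arcs_iff: "a \<in> up_arcs T r \<longleftrightarrow> a \<in> parcs T \<and> ty (low a)"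
  and down_arcs_iff: "a \<in> down_arcs T r \<longleftrightarrow> a \<in> parcs T \<and> \<not> ty (low a)"
proof -
  obtain x y where a: "a = (x, y)" by force
  have *: "(depth y < depth x) = ty (low a) \<and> (depth x < depth y) = (\<not> ty (low a))"
    if "(x, y) \<in> parcs T"
    using that wellformed'[OF that] depth_par[of x] depth_par[of y] unfolding a
    by (elim arc_cases) auto
  show "a \<in> up_arcs T r \<longleftrightarrow> a \<in> parcs T \<and> ty (low a)"
    using * wellformed'[of x y] unfolding up_arcs_def a by (auto simp: length_tree_path)
  show "a \<in> down_arcs T r \<longleftrightarrow> a \<in> parcs T \<and> \<not> ty (low a)"
    using * wellformed'[of x y] unfolding down_arcs_def a by (auto simp: length_tree_path)
qed

text \<open>The upper end of \<open>a\<close> is \<open>par (low a)\<close>, and the lower end is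
  below everything the upper end is below.\<close>

lemma subtree_arcs_iff:
  assumes w: "w \<in> pverts T"
  shows "a \<in> subtree_arcs T r w \<longleftrightarrow> a \<in> parcs T \<and> par (low a) \<sqsubseteq> w"
proof -
  obtain x y where a: "a = (x, y)" by force
  have "(x \<sqsubseteq> w \<and> y \<sqsubseteq> w) = (par (low a) \<sqsubseteq> w)" if "(x, y) \<in> parcs T"
    using that below_iff[of x w] below_iff[of y w] unfolding a by (elim arc_cases) auto
  then show ?thesis
    using wellformed'[of x y] by (auto simp: subtree_arcs_def descendants_eq[OF w] a)
qed

end

section \<open>Coverage, independence and apex in terms of the parent function\<close>

locale rooted_instance = rooted_oriented_tree T r + rooted_links "pverts T" r par ty L
  for T :: "'v pair_pre_digraph" and r :: 'v and L :: "('v \<times> 'v) set"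
begin

lemma cov_iff:
  assumes l: "l \<in> L" and a: "a \<in> parcs T"
  shows "a \<in> cov T l \<longleftrightarrow> low a \<in> C True l \<union> C False l"
proof -
  obtain x y where xy: "a = (x, y)" by force
  obtain u v where uv: "l = (u, v)" by force
  have in': "u \<in> pverts T" "v \<in> pverts T" using l links_in uv by auto
  have "a \<in> cov T l \<longleftrightarrow> (y, x) \<in> set (vwalk_arcs (tree_path T u v))"
    using a by (simp add: cov_def xy uv)
  also have "\<dots> \<longleftrightarrow> (y \<noteq> r \<and> x = par y \<and> u \<sqsubseteq> y \<and> \<not> v \<sqsubseteq> y) \<or>
      (x \<noteq> r \<and> y = par x \<and> v \<sqsubseteq> x \<and> \<not> u \<sqsubseteq> x)"
    by (rule tpath_arcs[OF tpath_tree_path[OF in']])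
  also have "\<dots> \<longleftrightarrow> low a \<in> C True l \<union> C False l"
    using low_in[OF a] a unfolding xy
    by (elim arc_cases) (use par_neq[of x] par_neq[of y] in \<open>auto simp: C_def endp_def uv\<close>)
  finally show ?thesis .
qed

lemma cov_subset: "cov T l \<subseteq> parcs T"
  by (auto simp: cov_def)

lemma independent_imp:
  assumes w: "w \<in> pverts T" and ind: "up_independent T r L w \<or> down_independent T r L w"
  shows "\<not> (dependent True w \<and> dependent False w)"
proof -
  have *: False if dep: "dependent s w"
    and ind: "\<And>l. l \<in> L \<Longrightarrow> (\<forall>a\<in>cov T l. a \<in> subtree_arcs T r w \<longrightarrow> ty (low a) \<noteq> s) \<or>
      cov T l \<subseteq> subtree_arcs T r w" for s
  proof -
    obtain l x y where l: "l \<in> L" and x: "x \<in> C s l" "par x \<sqsubseteq> w"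
      and y: "y \<in> C True l \<union> C False l" "\<not> par y \<sqsubseteq> w"
      using dep unfolding dependent_def by blast
    obtain a where a: "a \<in> parcs T" "low a = x" using low_surj C_D[OF x(1)] by blast
    obtain b where b: "b \<in> parcs T" "low b = y" using low_surj C_D[of y] y(1) by blast
    have "a \<in> cov T l" "b \<in> cov T l" using cov_iff[OF l] a b x y by (cases s; auto)+
    then show False using ind[OF l] a b x y subtree_arcs_iff[OF w] C_D[OF x(1)] by blast
  qed
  have "\<not> dependent True w" if up: "up_independent T r L w"
  proof
    assume "dependent True w"
    then show False
    proof (rule *)
      fix l assume "l \<in> L"
      then show "(\<forall>a\<in>cov T l. a \<in> subtree_arcs T r w \<longrightarrow> ty (low a) \<noteq> True) \<or>
          cov T l \<subseteq> subtree_arcs T r w"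
        using up cov_subset[of l] up_arcs_iff unfolding up_independent_def by blast
    qed
  qed
  moreover have "\<not> dependent False w" if down: "down_independent T r L w"
  proof
    assume "dependent False w"
    then show False
    proof (rule *)
      fix l assume "l \<in> L"
      then show "(\<forall>a\<in>cov T l. a \<in> subtree_arcs T r w \<longrightarrow> ty (low a) \<noteq> False) \<or>
          cov T l \<subseteq> subtree_arcs T r w"
        using down cov_subset[of l] down_arcs_iff unfolding down_independent_def by blast
    qed
  qed
  ultimately show ?thesis using ind by blast
qed

text \<open>Climbing from \<open>fst l\<close>, the lowest ancestor that also lies above
  \<open>snd l\<close> is the least one. Antisymmetry provides the uniqueness that the definite
  description demands.\<close>

lemma apex_spec:
  assumes l: "l \<in> L"
  shows "fst l \<sqsubseteq> apex T r l \<and> snd l \<sqsubseteq> apex T r l \<and>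
    (\<forall>z. fst l \<sqsubseteq> z \<longrightarrow> snd l \<sqsubseteq> z \<longrightarrow> apex T r l \<sqsubseteq> z)"
proof -
  obtain u v where uv: "l = (u, v)" by force
  have in': "u \<in> pverts T" "v \<in> pverts T" using l links_in uv by auto
  have ca: "common_ancestor T r l w \<longleftrightarrow> u \<sqsubseteq> w \<and> v \<sqsubseteq> w" for w
    using descendants_eq[of w] in' below_in[of u w] by (auto simp: common_ancestor_def uv)
  have "\<exists>w. u \<sqsubseteq> w \<and> v \<sqsubseteq> w \<and> (\<forall>z. u \<sqsubseteq> z \<longrightarrow> v \<sqsubseteq> z \<longrightarrow> w \<sqsubseteq> z)"
    using in'(1)
  proof (induction rule: tree_induct)
    case root
    then show ?case using below_root[OF in'(2)] by (intro exI[of _ r]) auto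
  next
    case (step x)
    then obtain w where w: "par x \<sqsubseteq> w" "v \<sqsubseteq> w" "\<And>z. par x \<sqsubseteq> z \<Longrightarrow> v \<sqsubseteq> z \<Longrightarrow> w \<sqsubseteq> z" by blast
    show ?case
    proof (cases "v \<sqsubseteq> x")
      case True
      then show ?thesis by (intro exI[of _ x]) auto
    next
      case False
      then show ?thesis using w below_iff[of x] by (intro exI[of _ w]) auto
    qed
  qed
  then obtain w where w: "u \<sqsubseteq> w" "v \<sqsubseteq> w" "\<And>z. u \<sqsubseteq> z \<Longrightarrow> v \<sqsubseteq> z \<Longrightarrow> w \<sqsubseteq> z" by blast
  have wV: "w \<in> pverts T" using below_in w in' by blast
  have desc: "x \<in> descendants T r z \<longleftrightarrow> x \<sqsubseteq> z" if "u \<sqsubseteq> x" "u \<sqsubseteq> z" for x z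
    using descendants_eq[of z] that below_in in' by blast
  have "apex T r l = w"
    unfolding apex_def
  proof (rule the_equality)
    show "common_ancestor T r l w \<and> (\<forall>w'. common_ancestor T r l w' \<longrightarrow> w \<in> descendants T r w')"
      using w desc[OF w(1)] by (auto simp: ca)
  next
    fix z assume z: "common_ancestor T r l z \<and> (\<forall>w'. common_ancestor T r l w' \<longrightarrow> z \<in> descendants T r w')"
    then have "z \<sqsubseteq> w" using w desc[of z w] by (auto simp: ca)
    moreover have "w \<sqsubseteq> z" using z w by (auto simp: ca)
    ultimately show "z = w" using below_antisym[OF wV] by auto
  qed
  then show ?thesis using w by (simp add: uv)
qed

end

theorem willow_imp_willow_links:
  assumes "willow T L c r"
  shows "rooted_instance T r L" and "willow_links (pverts T) r (rooted_oriented_tree.par T r)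
    (rooted_oriented_tree.ty T r) L"
proof -
  obtain W where W: "W \<subseteq> pverts T"
    "\<And>w. w \<in> W \<Longrightarrow> up_independent T r L w \<or> down_independent T r L w"
    "\<And>l. l \<in> L \<Longrightarrow> up_link T r l \<or> down_link T r l \<or> cross_link T r W l"
    using assms by (auto simp: willow_def)
  have inst: "oriented_tree T" "r \<in> pverts T" "L \<subseteq> pverts T \<times> pverts T"
    using assms by (auto simp: willow_def rooted_wdtap_instance_def wdtap_instance_def)
  interpret rooted_oriented_tree T r using inst by unfold_locales
  interpret rooted_instance T r L using inst by unfold_locales
  show "rooted_instance T r L" by unfold_locales
  show "willow_links (pverts T) r par ty L"
  proof
    fix l assume l: "l \<in> L"
    from W(3)[OF l] show "below (fst l) (snd l) \<or> below (snd l) (fst l) \<or>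
      (\<exists>w. below (fst l) w \<and> below (snd l) w \<and> (\<forall>z. below (fst l) z \<longrightarrow> below (snd l) z \<longrightarrow> below w z) \<and>
        \<not> (dependent True w \<and> dependent False w))"
    proof (elim disjE)
      assume "up_link T r l"
      then show ?thesis using apex_spec[OF l] by (simp add: up_link_def)
    next
      assume "down_link T r l"
      then show ?thesis using apex_spec[OF l] by (simp add: down_link_def)
    next
      assume "cross_link T r W l"
      then have "apex T r l \<in> W" by (simp add: cross_link_def)
      then have "\<not> (dependent True (apex T r l) \<and> dependent False (apex T r l))"
        using W independent_imp by blast
      then show ?thesis using apex_spec[OF l] by blast
    qed
  qed
qed

theorem willow_totally_unimodular:
  assumes "willow T L c r"
  shows "totally_unimodular (parcs T) L (coverage_matrix T)"
proof -
  interpret rooted_instance T r L by (rule willow_imp_willow_links[OF assms])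
  interpret willow_links "pverts T" r par ty L by (rule willow_imp_willow_links[OF assms])
  show ?thesis
    unfolding totally_unimodular_def
  proof (intro allI impI)
    fix k :: nat and f g
    assume fg: "inj_on f {..<k} \<and> f ` {..<k} \<subseteq> parcs T \<and> inj_on g {..<k} \<and> g ` {..<k} \<subseteq> L"
    have "mat k k (\<lambda>(i, j). coverage_matrix T (f i) (g j)) =
        mat k k (\<lambda>(i, j). of_bool ((low \<circ> f) i \<in> C True (g j) \<union> C False (g j)))"
    proof (intro eq_matI)
      fix i j
      assume "i < dim_row (mat k k (\<lambda>(i, j). of_bool ((low \<circ> f) i \<in> C True (g j) \<union> C False (g j)) :: int))"
        "j < dim_col (mat k k (\<lambda>(i, j). of_bool ((low \<circ> f) i \<in> C True (g j) \<union> C False (g j)) :: int))"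
      then have ij: "i < k" "j < k" by auto
      then have "g j \<in> L" "f i \<in> parcs T" using fg by auto
      from cov_iff[OF this] show "mat k k (\<lambda>(i, j). coverage_matrix T (f i) (g j)) $$ (i, j) =
          mat k k (\<lambda>(i, j). of_bool ((low \<circ> f) i \<in> C True (g j) \<union> C False (g j))) $$ (i, j)"
        using ij by (simp add: coverage_matrix_def)
    qed auto
    also have "det \<dots> \<in> {-1, 0, 1}"
    proof (rule covering_matrix_unimodular)
      have "low (f i) \<in> pverts T - {r}" if "i < k" for i
      proof -
        have "f i \<in> parcs T" using fg that by (simp add: image_subset_iff)
        then show ?thesis by (rule low_in)
      qed
      then show "(low \<circ> f) ` {..<k} \<subseteq> pverts T - {r}" by (simp add: image_subset_iff)
      show "g ` {..<k} \<subseteq> L" using fg by simp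
    qed
    finally show "det (mat k k (\<lambda>(i, j). coverage_matrix T (f i) (g j))) \<in> {-1, 0, 1}" .
  qed
qed

section \<open>The network of a willow\<close>

locale willow_net = willow_links "{..<n}" r par ty "set ls"
  for n :: nat and r :: nat and par :: "nat \<Rightarrow> nat" and ty :: "nat \<Rightarrow> bool"
    and ls :: "(nat \<times> nat) list" +
  fixes c :: "nat \<times> nat \<Rightarrow> real"
  assumes distinct_links: "distinct ls" and cost_pos: "l \<in> set ls \<Longrightarrow> 0 < c l"
begin

abbreviation "m \<equiv> length ls"

fun enc :: "nat node \<Rightarrow> nat" where
  "enc (N s x) = (if s then x else n + x)"
| "enc (Q x) = 2 * n + x"

definition dec :: "nat \<Rightarrow> nat node" where
  "dec k = (if k < n then N True k else if k < 2 * n then N False (k - n) else Q (k - 2 * n))"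

text \<open>
  Arc \<open>m + b n + x\<close> for \<open>b = 0\<close> is the slack of row \<open>x\<close>; for \<open>b \<in> {1, 2}\<close> it connects
  the node \<open>N True x\<close> or \<open>N False x\<close> to its parent and for \<open>b \<in> {3, 4}\<close> it goes back.
\<close>

definition arc_nodes :: "nat \<Rightarrow> nat node \<times> nat node" where
  "arc_nodes e = (if e < m then (link_end False (ls ! e), link_end True (ls ! e)) else
     let x = (e - m) mod n; b = (e - m) div n in
     if b = 0 then
       (if x = r then (N True r, N True r) else if ty x then (Q x, up (Q x)) else (up (Q x), Q x))
     else if b = 1 then (N True x, up (N True x)) else if b = 2 then (N False x, up (N False x))
     else if b = 3 then (up (N True x), N True x) else (up (N False x), N False x))"

definition fr :: "nat \<Rightarrow> nat" where "fr e = enc (fst (arc_nodes e))"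
definition to :: "nat \<Rightarrow> nat" where "to e = enc (snd (arc_nodes e))"
definition cost :: "nat \<Rightarrow> real" where "cost e = (if e < m then c (ls ! e) else 0)"

lemma n_pos: "0 < n"
  using root_in by auto

lemma dec_enc: "valid z \<Longrightarrow> dec (enc z) = z"
  by (cases z) (auto simp: dec_def)

lemma enc_less: "valid z \<Longrightarrow> enc z < 3 * n"
  by (cases z) auto

lemma link_end_valid: "valid (link_end s l)"
  using lowest_lo[of s l] highest_hi[of "\<not> s" l] C_D[of _ s l] C_D[of _ "\<not> s" l] par_in[of "hi (\<not> s) l"]
    root_in
  by (auto simp: link_end_def lowest_def highest_def)

lemma arc_nodes_simps:
  "e < m \<Longrightarrow> arc_nodes e = (link_end False (ls ! e), link_end True (ls ! e))"
  "x < n \<Longrightarrow> arc_nodes (m + x) =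
     (if x = r then (N True r, N True r) else if ty x then (Q x, up (Q x)) else (up (Q x), Q x))"
  "x < n \<Longrightarrow> arc_nodes (m + n + x) = (N True x, up (N True x))"
  "x < n \<Longrightarrow> arc_nodes (m + 2 * n + x) = (N False x, up (N False x))"
  "x < n \<Longrightarrow> arc_nodes (m + 3 * n + x) = (up (N True x), N True x)"
  "x < n \<Longrightarrow> arc_nodes (m + 4 * n + x) = (up (N False x), N False x)"
proof -
  have dm: "(m + b * n + x - m) mod n = x" "(m + b * n + x - m) div n = b" if "x < n" for b x
    using that by simp_all
  show "e < m \<Longrightarrow> arc_nodes e = (link_end False (ls ! e), link_end True (ls ! e))"
    by (simp add: arc_nodes_def)
  show "x < n \<Longrightarrow> arc_nodes (m + x) =
     (if x = r then (N True r, N True r) else if ty x then (Q x, up (Q x)) else (up (Q x), Q x))"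
    using dm[of x 0] unfolding arc_nodes_def by (simp add: Let_def del: up.simps)
  show "x < n \<Longrightarrow> arc_nodes (m + n + x) = (N True x, up (N True x))"
    using dm[of x 1] unfolding arc_nodes_def by (simp add: Let_def del: up.simps)
  show "x < n \<Longrightarrow> arc_nodes (m + 2 * n + x) = (N False x, up (N False x))"
    using dm[of x 2] unfolding arc_nodes_def by (simp add: Let_def del: up.simps)
  show "x < n \<Longrightarrow> arc_nodes (m + 3 * n + x) = (up (N True x), N True x)"
    using dm[of x 3] unfolding arc_nodes_def by (simp add: Let_def del: up.simps)
  show "x < n \<Longrightarrow> arc_nodes (m + 4 * n + x) = (up (N False x), N False x)"
    using dm[of x 4] unfolding arc_nodes_def by (simp add: Let_def del: up.simps)
qed

lemma arc_cases_net:
  assumes "e < m + 5 * n"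
  obtains "e < m" | x where "x < n" "e = m + x" | x where "x < n" "e = m + n + x"
  | x where "x < n" "e = m + 2 * n + x" | x where "x < n" "e = m + 3 * n + x"
  | x where "x < n" "e = m + 4 * n + x"
proof (cases "e < m")
  case False
  define x where "x = (e - m) mod n"
  have x: "x < n" using n_pos by (simp add: x_def)
  have "(e - m) div n < 5" using assms False n_pos by (simp add: less_mult_imp_div_less)
  then consider "(e - m) div n = 0" | "(e - m) div n = 1" | "(e - m) div n = 2"
    | "(e - m) div n = 3" | "(e - m) div n = 4" by linarith
  moreover have "e = m + (e - m) div n * n + x" using False by (simp add: x_def)
  ultimately show ?thesis using that(2-6)[OF x] by cases auto
qed (rule that(1))

lemma up_valid': "x < n \<Longrightarrow> valid (up (N s x))"
  by (rule up_valid) simp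

lemma arc_valid:
  assumes "e < m + 5 * n"
  shows "valid (fst (arc_nodes e))" "valid (snd (arc_nodes e))"
proof -
  have Qv: "valid (Q x) \<and> valid (up (Q x))" if "x < n" "x \<noteq> r" for x
    using that up_valid[of "Q x"] by simp
  have *: "valid (fst (arc_nodes e)) \<and> valid (snd (arc_nodes e))"
    using assms
    by (cases rule: arc_cases_net)
      (use Qv up_valid' root_in in \<open>auto simp: arc_nodes_simps link_end_valid simp del: up.simps\<close>)
  then show "valid (fst (arc_nodes e))" "valid (snd (arc_nodes e))" by auto
qed

sublocale flow_net n m fr to cost
  by unfold_locales (auto simp: fr_def to_def enc_less arc_valid)

section \<open>Linear programming duality on the network\<close>

definition cover :: "nat \<times> nat \<Rightarrow> nat set" where "cover l = C True l \<union> C False l"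

lemma finite_cover: "finite (cover l)"
  by (simp add: cover_def finite_C)

lemma cover_D: "x \<in> cover l \<Longrightarrow> x < n \<and> x \<noteq> r"
  using C_D[of x True l] C_D[of x False l] by (auto simp: cover_def)

text \<open>The dual variable of row \<open>x\<close>: the drop, signed such that both types of
  covered arcs raise the potential from the tail of a link arc to its head.\<close>

definition gain :: "(nat node \<Rightarrow> real) \<Rightarrow> nat \<Rightarrow> real" where
  "gain \<pi> x = (if ty x then drop \<pi> x else - drop \<pi> x)"

lemma link_gain:
  assumes \<pi>: "glued \<pi>" and l: "l \<in> set ls"
  shows "\<pi> (link_end True l) - \<pi> (link_end False l) = sum (gain \<pi>) (cover l)"
proof -
  have "sum (gain \<pi>) (cover l) = sum (gain \<pi>) (C True l) + sum (gain \<pi>) (C False l)"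
    unfolding cover_def using C_D[of _ True l] C_D[of _ False l]
    by (intro sum.union_disjoint finite_C) blast
  moreover have "sum (gain \<pi>) (C True l) = sum (drop \<pi>) (C True l)"
    using C_D[of _ True l] by (intro sum.cong) (auto simp: gain_def)
  moreover have "sum (gain \<pi>) (C False l) = - sum (drop \<pi>) (C False l)"
    using C_D[of _ False l] by (subst sum_negf[symmetric], intro sum.cong) (auto simp: gain_def)
  ultimately show ?thesis using potential_difference[OF \<pi> l] by simp
qed

text \<open>The slack arc of the root is a loop, so its demand is void and the arc numbers stay
  uniform.\<close>

lemma slack_gain:
  assumes "x < n"
  shows "\<pi> (fst (arc_nodes (m + x))) - \<pi> (snd (arc_nodes (m + x))) = (if x = r then 0 else gain \<pi> x)"
  using assms by (auto simp: arc_nodes_simps gain_def drop_def)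

lemma glue_arcs:
  assumes "glued \<pi>" "n \<le> k" "k < 5 * n"
  shows "\<pi> (fst (arc_nodes (m + k))) = \<pi> (snd (arc_nodes (m + k)))"
proof -
  have g: "\<pi> (up (N s x)) = \<pi> (N s x)" if "x < n" for s x
    using assms(1) that by (auto simp: glued_def)
  have "m + k < m + 5 * n" using assms(3) by simp
  then show ?thesis
    by (cases rule: arc_cases_net)
      (use assms(2) in \<open>auto simp: arc_nodes_simps g add.assoc[symmetric] simp del: up.simps\<close>)
qed

text \<open>Each contracted edge is present in both directions, so monotonicity along all such arcs
  means equality.\<close>

lemma glued_if_mono:
  fixes \<pi> :: "nat node \<Rightarrow> real"
  assumes mono: "\<And>e. e < E \<Longrightarrow> m \<le> e \<Longrightarrow> \<pi> (snd (arc_nodes e)) \<le> \<pi> (fst (arc_nodes e))"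
  shows "glued \<pi>"
  unfolding glued_def
proof (intro ballI allI antisym)
  fix z s assume z: "z \<in> {..<n}"
  show "\<pi> (N s z) \<le> \<pi> (up (N s z))"
    using mono[of "m + 3 * n + z"] mono[of "m + 4 * n + z"] z
    by (cases s) (simp_all add: arc_nodes_simps del: up.simps)
  show "\<pi> (up (N s z)) \<le> \<pi> (N s z)"
    using mono[of "m + n + z"] mono[of "m + 2 * n + z"] z
    by (cases s) (simp_all add: arc_nodes_simps del: up.simps)
qed

lemma sum_split_arcs:
  fixes g :: "nat \<Rightarrow> real"
  assumes "\<And>k. n \<le> k \<Longrightarrow> k < 5 * n \<Longrightarrow> g (m + k) = 0"
  shows "sum g {..<E} = (\<Sum>j<m. g j) + (\<Sum>x<n. g (m + x))"
proof -
  have "(\<Sum>e<m + k. g e) = (\<Sum>j<m. g j) + (\<Sum>i<k. g (m + i))" for k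
    by (induction k) auto
  moreover have "(\<Sum>i<5 * n. g (m + i)) = (\<Sum>x<n. g (m + x))"
    using assms by (intro sum.mono_neutral_right) auto
  ultimately show ?thesis by simp
qed

lemma sum_links: "(\<Sum>l\<in>set ls. g l) = (\<Sum>j<m. g (ls ! j))"
  using sum.reindex_bij_betw[OF bij_betw_nth[OF distinct_links refl refl], of g] by simp

text \<open>Rows are indexed by the lower ends of the arcs of the tree.\<close>

definition covering :: "(nat \<times> nat \<Rightarrow> real) \<Rightarrow> bool" where
  "covering x \<longleftrightarrow> (\<forall>v\<in>{..<n} - {r}. 1 \<le> (\<Sum>l\<in>set ls. of_bool (v \<in> cover l) * x l)) \<and>
     (\<forall>l\<in>set ls. 0 \<le> x l)"

text \<open>The indicator of the complement of the closed set never increases along an arc. Hence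
  all gains are nonnegative and that of \<open>x\<close> is positive, so a link covering
  \<open>x\<close> would increase it: row \<open>x\<close> is covered by no link.\<close>

lemma blocked_not_covering:
  assumes x: "x < n" and b: "blocked x"
  shows "\<not> covering y"
proof
  assume y: "covering y"
  obtain S where S: "to (m + x) \<in> S" "fr (m + x) \<notin> S" "\<And>e. e < E \<Longrightarrow> fr e \<in> S \<Longrightarrow> to e \<in> S"
    using b by (auto simp: blocked_def)
  define \<pi> :: "nat node \<Rightarrow> real" where "\<pi> z = of_bool (enc z \<notin> S)" for z
  have mono: "\<pi> (snd (arc_nodes e)) \<le> \<pi> (fst (arc_nodes e))" if "e < E" for e
    using S(3)[OF that] by (auto simp: \<pi>_def fr_def to_def)
  have glued: "glued \<pi>" by (rule glued_if_mono) (rule mono)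
  have gain: "0 \<le> gain \<pi> z" if "z < n" "z \<noteq> r" for z
    using mono[of "m + z"] slack_gain[of z \<pi>] that by simp
  have xr: "x \<noteq> r" using S(1,2) x by (auto simp: fr_def to_def arc_nodes_simps)
  have gx: "0 < gain \<pi> x"
    using slack_gain[OF x, of \<pi>] S(1,2) xr by (simp add: \<pi>_def fr_def to_def)
  have "x \<notin> cover l" if l: "l \<in> set ls" for l
  proof
    assume "x \<in> cover l"
    then have "0 < sum (gain \<pi>) (cover l)"
      using gx gain cover_D finite_cover by (intro sum_pos2[of _ x]) auto
    moreover obtain j where "j < m" "l = ls ! j" using l by (auto simp: in_set_conv_nth)
    ultimately show False
      using link_gain[OF glued l] mono[of j] by (simp add: arc_nodes_simps)
  qed
  then have "(\<Sum>l\<in>set ls. of_bool (x \<in> cover l) * y l) = 0" by (intro sum.neutral) auto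
  moreover have "1 \<le> (\<Sum>l\<in>set ls. of_bool (x \<in> cover l) * y l)"
    using y x xr unfolding covering_def by blast
  ultimately show False by linarith
qed

text \<open>Conservation tested against the indicator of \<open>cut v\<close> isolates row
  \<open>v\<close>: the flow on links covering \<open>v\<close> is \<open>1\<close> plus the flow on
  the slack arc.\<close>

lemma flow_covering:
  assumes nonneg: "\<And>e. e < E \<Longrightarrow> 0 \<le> f e" and meets: "meets f n"
    and x: "\<And>j. j < m \<Longrightarrow> x (ls ! j) = of_int (f j)"
  shows "covering x"
  unfolding covering_def
proof (intro conjI ballI)
  fix l assume "l \<in> set ls"
  then obtain j where "j < m" "l = ls ! j" by (auto simp: in_set_conv_nth)
  then show "0 \<le> x l" using x nonneg[of j] by simp
next
  fix v assume v: "v \<in> {..<n} - {r}"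
  define \<chi> :: "nat node \<Rightarrow> real" where "\<chi> = (\<lambda>z. of_bool (z \<in> cut v))"
  \<comment> \<open>Potentials in \<open>meets\<close> live on node numbers, hence the
    decoding.\<close>
  define \<psi> where "\<psi> k = \<chi> (dec k)" for k
  have glued: "glued \<chi>" unfolding \<chi>_def by (rule glued_cut)
  define \<epsilon> :: real where "\<epsilon> = (if ty v then 1 else -1)"
  have gain: "gain \<chi> z = \<epsilon> * of_bool (z = v)" for z
    using drop_cut[of v, where ?'b = real] v by (auto simp: gain_def \<chi>_def \<epsilon>_def)
  have \<psi>: "\<psi> (fr e) = \<chi> (fst (arc_nodes e))" "\<psi> (to e) = \<chi> (snd (arc_nodes e))" if "e < E" for e
    using dec_enc[OF arc_valid(1)[OF that]] dec_enc[OF arc_valid(2)[OF that]]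
    by (simp_all add: \<psi>_def fr_def to_def)
  have slack: "\<psi> (fr (m + z)) - \<psi> (to (m + z)) = \<epsilon> * of_bool (z = v)" if "z < n" for z
    using slack_gain[OF that, of \<chi>] \<psi>[of "m + z"] that v by (auto simp: gain)
  have link: "\<psi> (to j) - \<psi> (fr j) = \<epsilon> * of_bool (v \<in> cover (ls ! j))" if "j < m" for j
  proof -
    have "\<psi> (to j) - \<psi> (fr j) = sum (gain \<chi>) (cover (ls ! j))"
      using link_gain[OF glued, of "ls ! j"] \<psi>[of j] that by (simp add: arc_nodes_simps)
    also have "\<dots> = \<epsilon> * of_bool (v \<in> cover (ls ! j))"
      using finite_cover[of "ls ! j"] by (simp add: gain sum_distrib_left[symmetric] sum.If_cases)
    finally show ?thesis .
  qed
  have "flow_sum f \<psi> = (\<Sum>j<m. of_int (f j) * (\<psi> (to j) - \<psi> (fr j))) +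
      (\<Sum>z<n. of_int (f (m + z)) * (\<psi> (to (m + z)) - \<psi> (fr (m + z))))"
    unfolding flow_sum_def
    by (rule sum_split_arcs) (use glue_arcs[OF glued] \<psi> in simp)
  also have "(\<Sum>j<m. of_int (f j) * (\<psi> (to j) - \<psi> (fr j))) =
      \<epsilon> * (\<Sum>j<m. of_bool (v \<in> cover (ls ! j)) * of_int (f j))"
    unfolding sum_distrib_left by (intro sum.cong) (auto simp: link)
  also have "(\<Sum>z<n. of_int (f (m + z)) * (\<psi> (to (m + z)) - \<psi> (fr (m + z)))) =
      (\<Sum>z<n. (if z = v then - (\<epsilon> * of_int (f (m + z))) else 0))"
    by (intro sum.cong refl) (use slack in \<open>force simp: algebra_simps\<close>)
  also have "\<dots> = - (\<epsilon> * of_int (f (m + v)))" using v by simp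
  also have "flow_sum f \<psi> = (\<Sum>z<n. \<epsilon> * of_bool (z = v))"
    using meets slack unfolding meets_def by (auto intro: sum.cong)
  also have "\<dots> = (\<Sum>z<n. if z = v then \<epsilon> else 0)" by (intro sum.cong) auto
  also have "\<dots> = \<epsilon>" using v by simp
  finally have "\<epsilon> * ((\<Sum>j<m. of_bool (v \<in> cover (ls ! j)) * of_int (f j)) - of_int (f (m + v)) - 1) = 0"
    by (simp add: algebra_simps)
  then have "(\<Sum>j<m. of_bool (v \<in> cover (ls ! j)) * of_int (f j)) = 1 + real_of_int (f (m + v))"
    by (auto simp: \<epsilon>_def split: if_splits)
  moreover have "0 \<le> f (m + v)" using nonneg[of "m + v"] v by simp
  moreover have "(\<Sum>l\<in>set ls. of_bool (v \<in> cover l) * x l) =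
      (\<Sum>j<m. of_bool (v \<in> cover (ls ! j)) * of_int (f j))"
    unfolding sum_links using x by (intro sum.cong) auto
  ultimately show "1 \<le> (\<Sum>l\<in>set ls. of_bool (v \<in> cover l) * x l)" by simp
qed

text \<open>Weak duality with the gains as dual solution: slack arcs make them nonnegative, link
  arcs bound their sums by the costs. By complementary slackness the flow costs exactly
  \<open>flow_sum f \<pi>\<close>, and since it meets all demands this is the dual value.\<close>

lemma flow_optimal:
  assumes opt: "optimal_pair \<pi> f" and meets: "meets f n"
    and x: "\<And>j. j < m \<Longrightarrow> x (ls ! j) = of_int (f j)" and y: "covering y"
  shows "(\<Sum>l\<in>set ls. c l * x l) \<le> (\<Sum>l\<in>set ls. c l * y l)"
proof -
  let ?\<pi> = "\<lambda>z. \<pi> (enc z)"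
  have rc: "0 \<le> cost e + ?\<pi> (fst (arc_nodes e)) - ?\<pi> (snd (arc_nodes e))"
    "0 < f e \<Longrightarrow> cost e + ?\<pi> (fst (arc_nodes e)) - ?\<pi> (snd (arc_nodes e)) = 0"
    "0 \<le> f e" if "e < E" for e
    using opt that by (auto simp: optimal_pair_def rc_def fr_def to_def)
  have glued: "glued ?\<pi>" by (rule glued_if_mono) (use rc(1) in \<open>fastforce simp: cost_def\<close>)
  have gain: "0 \<le> gain ?\<pi> z" if "z < n" "z \<noteq> r" for z
    using rc(1)[of "m + z"] slack_gain[of z ?\<pi>] that by (simp add: cost_def)
  have dual: "sum (gain ?\<pi>) (cover l) \<le> c l" if l: "l \<in> set ls" for l
  proof -
    obtain j where "j < m" "l = ls ! j" using l by (auto simp: in_set_conv_nth)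
    then show ?thesis
      using link_gain[OF glued l] rc(1)[of j] by (simp add: arc_nodes_simps cost_def)
  qed
  let ?R = "{..<n} - {r}"
  have "(\<Sum>l\<in>set ls. c l * x l) = (\<Sum>j<m. cost j * of_int (f j))"
    unfolding sum_links using x by (intro sum.cong) (auto simp: cost_def)
  also have "\<dots> = (\<Sum>e<E. cost e * of_int (f e))"
    by (rule sum.mono_neutral_left) (auto simp: cost_def)
  also have "\<dots> = flow_sum f \<pi>"
    unfolding flow_sum_def
  proof (rule sum.cong)
    fix e assume "e \<in> {..<E}"
    then have e: "e < E" by simp
    show "cost e * of_int (f e) = of_int (f e) * (\<pi> (to e) - \<pi> (fr e))"
    proof (cases "0 < f e")
      case True
      then have "cost e = \<pi> (to e) - \<pi> (fr e)" using rc(2)[OF e] by (simp add: fr_def to_def)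
      then show ?thesis by simp
    next
      case False
      then have "f e = 0" using rc(3)[OF e] by simp
      then show ?thesis by simp
    qed
  qed simp
  also have "\<dots> = (\<Sum>z<n. if z = r then 0 else gain ?\<pi> z)"
    using meets slack_gain[of _ ?\<pi>] by (auto simp: meets_def fr_def to_def intro!: sum.cong)
  also have "\<dots> = sum (gain ?\<pi>) ?R"
    by (rule sum.mono_neutral_cong_right) auto
  also have "\<dots> \<le> (\<Sum>z\<in>?R. gain ?\<pi> z * (\<Sum>l\<in>set ls. of_bool (z \<in> cover l) * y l))"
  proof (rule sum_mono)
    fix z assume z: "z \<in> ?R"
    then have "1 \<le> (\<Sum>l\<in>set ls. of_bool (z \<in> cover l) * y l)" using y by (simp add: covering_def)
    from mult_left_mono[OF this, of "gain ?\<pi> z"]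
    show "gain ?\<pi> z \<le> gain ?\<pi> z * (\<Sum>l\<in>set ls. of_bool (z \<in> cover l) * y l)"
      using gain z by auto
  qed
  also have "\<dots> = (\<Sum>l\<in>set ls. (\<Sum>z\<in>?R. of_bool (z \<in> cover l) * gain ?\<pi> z) * y l)"
    unfolding sum_distrib_left sum_distrib_right
    by (subst sum.swap) (simp add: mult_ac)
  also have "\<dots> = (\<Sum>l\<in>set ls. sum (gain ?\<pi>) (cover l) * y l)"
  proof (rule sum.cong)
    fix l assume "l \<in> set ls"
    have "(\<Sum>z\<in>?R. of_bool (z \<in> cover l) * gain ?\<pi> z) = sum (gain ?\<pi>) (cover l)"
      by (rule sum.mono_neutral_cong_right) (use cover_D[of _ l] in auto)
    then show "(\<Sum>z\<in>?R. of_bool (z \<in> cover l) * gain ?\<pi> z) * y l = sum (gain ?\<pi>) (cover l) * y l"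
      by simp
  qed simp
  also have "\<dots> \<le> (\<Sum>l\<in>set ls. c l * y l)"
    by (rule sum_mono) (use dual y in \<open>auto simp: covering_def intro!: mult_right_mono\<close>)
  finally show ?thesis .
qed

end

section \<open>The program\<close>

abbreviation root_exp :: iexp where "root_exp \<equiv> IGet 0 (IConst 1)"
abbreviation as_exp :: iexp where "as_exp \<equiv> IGet 0 (IConst 2)"

text \<open>
  Integer arrays: \<open>10\<close> parent, \<open>11\<close> type of the arc to the parent, \<open>12\<close> vertices seen so far,
  \<open>13\<close> offset of a row in the ancestor matrix \<open>14\<close>, which is stored row by row; \<open>15\<close>, \<open>16\<close> lowest
  and \<open>17\<close>, \<open>18\<close> highest covered up-arc and down-arc of a link, or \<open>-1\<close>; \<open>19\<close>, \<open>20\<close> vertices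
  that are not up-independent and not down-independent.
\<close>

definition par_body :: fcom where
  "par_body =
     FIf (BAnd (flag 12 (IGet 1 (scalar 51))) (BNot (flag 12 (IGet 2 (scalar 51)))))
       (FI 10 (IGet 2 (scalar 51)) (IGet 1 (scalar 51)) ;; FI 11 (IGet 2 (scalar 51)) (IConst 0) ;;
        FI 12 (IGet 2 (scalar 51)) (IConst 1))
       (FIf (BAnd (flag 12 (IGet 2 (scalar 51))) (BNot (flag 12 (IGet 1 (scalar 51)))))
         (FI 10 (IGet 1 (scalar 51)) (IGet 2 (scalar 51)) ;; FI 11 (IGet 1 (scalar 51)) (IConst 1) ;;
          FI 12 (IGet 1 (scalar 51)) (IConst 1))
         FSkip)"

definition par_round :: fcom where "par_round = FFor 51 as_exp par_body"

definition tree_prog :: fcom where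
  "tree_prog = FI 10 root_exp root_exp ;; FI 12 root_exp (IConst 1) ;; FFor 50 n_exp par_round"

text \<open>The machine does not multiply, so the multiples of \<open>n\<close> that address matrix
  rows are tabulated by repeated addition.\<close>

definition offset_prog :: fcom where
  "offset_prog = FFor 50 n_exp
     (FI 13 (IAdd (scalar 50) (IConst 1)) (IAdd (IGet 13 (scalar 50)) n_exp))"

definition climb_body :: fcom where
  "climb_body = FI 14 (IAdd (IGet 13 (scalar 50)) (scalar 30)) (IConst 1) ;;
     set_scalar 30 (IGet 10 (scalar 30))"

text \<open>The number of rounds does not depend on the depth: once at the root, the loop keeps
  marking the root.\<close>

definition climb :: fcom where
  "climb = set_scalar 30 (scalar 50) ;; FFor 51 n_exp climb_body"

definition ancestor_prog :: fcom where
  "ancestor_prog = offset_prog ;; FFor 50 n_exp climb"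

abbreviation anc :: "iexp \<Rightarrow> iexp \<Rightarrow> bexp" where
  "anc x y \<equiv> flag 14 (IAdd (IGet 13 x) y)"

abbreviation end_array :: "bool \<Rightarrow> nat" where "end_array s \<equiv> (if s then 4 else 3)"
abbreviation lo_array :: "bool \<Rightarrow> nat" where "lo_array s \<equiv> (if s then 15 else 16)"
abbreviation hi_array :: "bool \<Rightarrow> nat" where "hi_array s \<equiv> (if s then 17 else 18)"
abbreviation dep_array :: "bool \<Rightarrow> nat" where "dep_array s \<equiv> (if s then 19 else 20)"
abbreviation has_type :: "bool \<Rightarrow> iexp \<Rightarrow> bexp" where
  "has_type s x \<equiv> (if s then flag 11 x else BNot (flag 11 x))"

definition extremes_body :: "bool \<Rightarrow> fcom" where
  "extremes_body s =
     FIf (BAnd (BNot (beq (scalar 51) root_exp)) (BAnd (has_type s (scalar 51))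
           (BAnd (anc (IGet (end_array s) (scalar 50)) (scalar 51))
             (BNot (anc (IGet (end_array (\<not> s)) (scalar 50)) (scalar 51))))))
       (FIf (bor (ILess (IGet (lo_array s) (scalar 50)) (IConst 0))
             (anc (scalar 51) (IGet (lo_array s) (scalar 50))))
          (FI (lo_array s) (scalar 50) (scalar 51)) FSkip ;;
        FIf (bor (ILess (IGet (hi_array s) (scalar 50)) (IConst 0))
             (anc (IGet (hi_array s) (scalar 50)) (scalar 51)))
          (FI (hi_array s) (scalar 50) (scalar 51)) FSkip)
       FSkip"

definition extremes_of_link :: "bool \<Rightarrow> fcom" where
  "extremes_of_link s = FI (lo_array s) (scalar 50) (IConst (-1)) ;;
     FI (hi_array s) (scalar 50) (IConst (-1)) ;; FFor 51 n_exp (extremes_body s)"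

definition extremes_prog :: "bool \<Rightarrow> fcom" where
  "extremes_prog s = FFor 50 m_exp (extremes_of_link s)"

abbreviation sticks_out :: "bool \<Rightarrow> bexp" where
  "sticks_out s \<equiv> BAnd (BNot (ILess (IGet (hi_array s) (scalar 51)) (IConst 0)))
     (BNot (anc (IGet 10 (IGet (hi_array s) (scalar 51))) (scalar 50)))"

definition dependent_body :: "bool \<Rightarrow> fcom" where
  "dependent_body s =
     FIf (BAnd (BNot (ILess (IGet (lo_array s) (scalar 51)) (IConst 0)))
           (BAnd (anc (IGet 10 (IGet (lo_array s) (scalar 51))) (scalar 50))
             (bor (sticks_out s) (sticks_out (\<not> s)))))
       (FI (dep_array s) (scalar 50) (IConst 1)) FSkip"

definition dependent_prog :: "bool \<Rightarrow> fcom" where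
  "dependent_prog s = FFor 50 n_exp (FFor 51 m_exp (dependent_body s))"

abbreviation node_exp :: "bool \<Rightarrow> iexp \<Rightarrow> iexp" where
  "node_exp s x \<equiv> (if s then x else IAdd n_exp x)"

definition link_end_prog :: "nat \<Rightarrow> bool \<Rightarrow> fcom" where
  "link_end_prog a s =
     FIf (BNot (ILess (IGet (lo_array s) (scalar 50)) (IConst 0)))
       (FI a (scalar 50) (IAdd n2_exp (IGet (lo_array s) (scalar 50))))
       (FIf (BNot (ILess (IGet (hi_array (\<not> s)) (scalar 50)) (IConst 0)))
         (FI a (scalar 50) (node_exp (\<not> s) (IGet 10 (IGet (hi_array (\<not> s)) (scalar 50)))))
         (FI a (scalar 50) root_exp))"

definition link_arcs_prog :: fcom where
  "link_arcs_prog = FFor 50 m_exp (link_end_prog 23 False ;; link_end_prog 24 True)"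

text \<open>The outer test is \<open>D\<close> spelled out on the dependence flags; the rest follows
  the equations of \<open>up\<close> on node numbers.\<close>

definition up_prog :: "nat \<Rightarrow> bool \<Rightarrow> fcom" where
  "up_prog k s =
     FIf (if s then BNot (flag 19 (scalar 50)) else BAnd (flag 19 (scalar 50)) (BNot (flag 20 (scalar 50))))
       (set_scalar k (node_exp (\<not> s) (scalar 50)))
       (FIf (beq (scalar 50) root_exp) (set_scalar k (node_exp s (scalar 50)))
         (FIf (has_type s (scalar 50)) (set_scalar k (IAdd n2_exp (scalar 50)))
           (set_scalar k (node_exp s (IGet 10 (scalar 50))))))"

definition set_arc :: "iexp \<Rightarrow> iexp \<Rightarrow> iexp \<Rightarrow> fcom" where
  "set_arc e a b = FI 23 e a ;; FI 24 e b"

definition slack_prog :: fcom where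
  "slack_prog =
     FIf (beq (scalar 50) root_exp) (set_arc (IAdd m_exp (scalar 50)) root_exp root_exp)
       (FIf (flag 11 (scalar 50))
         (set_arc (IAdd m_exp (scalar 50)) (IAdd n2_exp (scalar 50)) (IGet 10 (scalar 50)))
         (set_arc (IAdd m_exp (scalar 50)) (IAdd n_exp (IGet 10 (scalar 50))) (IAdd n2_exp (scalar 50))))"

definition glue_prog :: fcom where
  "glue_prog = set_arc (IAdd m_exp (IAdd n_exp (scalar 50))) (scalar 50) (scalar 34) ;;
     set_arc (IAdd m_exp (IAdd n2_exp (scalar 50))) (IAdd n_exp (scalar 50)) (scalar 35) ;;
     set_arc (IAdd m_exp (IAdd n3_exp (scalar 50))) (scalar 34) (scalar 50) ;;
     set_arc (IAdd m_exp (IAdd n2_exp (IAdd n2_exp (scalar 50)))) (scalar 35) (IAdd n_exp (scalar 50))"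

definition vertex_arcs :: fcom where
  "vertex_arcs = up_prog 34 True ;; up_prog 35 False ;; slack_prog ;; glue_prog"

definition vertex_arcs_prog :: fcom where
  "vertex_arcs_prog = FFor 50 n_exp vertex_arcs"

lemma writes_tree:
  "iw par_body = {10, 11, 12}" "rw par_body = {}"
  "iw par_round = {10, 11, 12, 51}" "rw par_round = {}"
  "iw tree_prog = {10, 11, 12, 50, 51}" "rw tree_prog = {}"
  "iw climb_body = {14, 30}" "rw climb_body = {}"
  "iw climb = {14, 30, 51}" "rw climb = {}"
  "iw offset_prog = {13, 50}" "rw offset_prog = {}"
  "iw ancestor_prog = {13, 14, 30, 50, 51}" "rw ancestor_prog = {}"
  "iw (extremes_body s) = {lo_array s, hi_array s}" "rw (extremes_body s) = {}"
  "iw (extremes_of_link s) = {lo_array s, hi_array s, 51}" "rw (extremes_of_link s) = {}"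
  "iw (extremes_prog s) = {lo_array s, hi_array s, 50, 51}" "rw (extremes_prog s) = {}"
  "iw (dependent_body s) = {dep_array s}" "rw (dependent_body s) = {}"
  "iw (dependent_prog s) = {dep_array s, 50, 51}" "rw (dependent_prog s) = {}"
  "iw (link_end_prog a s) = {a}" "rw (link_end_prog a s) = {}"
  "iw link_arcs_prog = {23, 24, 50}" "rw link_arcs_prog = {}"
  "iw (up_prog k s) = {k}" "rw (up_prog k s) = {}"
  "iw vertex_arcs = {23, 24, 34, 35}" "rw vertex_arcs = {}"
  "iw vertex_arcs_prog = {23, 24, 34, 35, 50}" "rw vertex_arcs_prog = {}"
  by (auto simp: par_body_def par_round_def tree_prog_def climb_body_def climb_def offset_prog_def
      ancestor_prog_def extremes_body_def extremes_of_link_def extremes_prog_def dependent_body_def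
      dependent_prog_def link_end_prog_def link_arcs_prog_def up_prog_def set_arc_def slack_prog_def
      glue_prog_def vertex_arcs_def vertex_arcs_prog_def)

locale willow_input = willow_net n r par ty ls c
  for n :: nat and r :: nat and par :: "nat \<Rightarrow> nat" and ty :: "nat \<Rightarrow> bool"
    and ls :: "(nat \<times> nat) list" and c :: "nat \<times> nat \<Rightarrow> real" +
  fixes as :: "(nat \<times> nat) list"
  assumes arc_cases_input: "(x, y) \<in> set as \<Longrightarrow>
      (y = par x \<and> x < n \<and> x \<noteq> r \<and> ty x) \<or> (x = par y \<and> y < n \<and> y \<noteq> r \<and> \<not> ty y)"
    and arc_exists: "x < n \<Longrightarrow> x \<noteq> r \<Longrightarrow> (if ty x then (x, par x) else (par x, x)) \<in> set as"
begin

notation below (infix "\<sqsubseteq>" 50)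

definition has_input :: "state \<Rightarrow> bool" where
  "has_input s \<longleftrightarrow> ints s 0 0 = int n \<and> ints s 0 1 = int r \<and> ints s 0 2 = int (length as) \<and>
     ints s 0 3 = int m \<and>
     (\<forall>j<length as. ints s (Suc 0) (int j) = int (fst (as ! j)) \<and> ints s 2 (int j) = int (snd (as ! j))) \<and>
     (\<forall>j<m. ints s 3 (int j) = int (fst (ls ! j)) \<and> ints s 4 (int j) = int (snd (ls ! j)))"

definition has_tree :: "state \<Rightarrow> bool" where
  "has_tree s \<longleftrightarrow> (\<forall>x<n. ints s 10 (int x) = int (par x) \<and> (x \<noteq> r \<longrightarrow> (ints s 11 (int x) = 1) = ty x))"

definition has_ancestors :: "state \<Rightarrow> bool" where
  "has_ancestors s \<longleftrightarrow> (\<forall>x<n. ints s 13 (int x) = int (x * n)) \<and>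
     (\<forall>x<n. \<forall>y<n. (ints s 14 (int (x * n + y)) = 1) = (x \<sqsubseteq> y))"

definition has_extremes :: "bool \<Rightarrow> nat \<Rightarrow> state \<Rightarrow> bool" where
  "has_extremes \<sigma> k s \<longleftrightarrow> (\<forall>j<k.
     ints s (lo_array \<sigma>) (int j) = (if C \<sigma> (ls ! j) = {} then -1 else int (lo \<sigma> (ls ! j))) \<and>
     ints s (hi_array \<sigma>) (int j) = (if C \<sigma> (ls ! j) = {} then -1 else int (hi \<sigma> (ls ! j))))"

definition has_dependent :: "bool \<Rightarrow> state \<Rightarrow> bool" where
  "has_dependent \<sigma> s \<longleftrightarrow> (\<forall>w<n. (ints s (dep_array \<sigma>) (int w) = 1) = dependent \<sigma> w)"

definition has_arc :: "state \<Rightarrow> nat \<Rightarrow> bool" where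
  "has_arc s e \<longleftrightarrow> ints s 23 (int e) = int (fr e) \<and> ints s 24 (int e) = int (to e)"

lemma has_inputD:
  assumes "has_input s"
  shows "ints s 0 0 = int n" "ints s 0 1 = int r" "ints s 0 2 = int (length as)" "ints s 0 3 = int m"
    "j < length as \<Longrightarrow> ints s (Suc 0) (int j) = int (fst (as ! j))"
    "j < length as \<Longrightarrow> ints s 2 (int j) = int (snd (as ! j))"
    "j < m \<Longrightarrow> ints s 3 (int j) = int (fst (ls ! j))"
    "j < m \<Longrightarrow> ints s 4 (int j) = int (snd (ls ! j))"
  using assms by (auto simp: has_input_def)

lemma has_input_cong:
  "has_input s \<Longrightarrow> (\<And>a. a < 5 \<Longrightarrow> ints s' a = ints s a) \<Longrightarrow> has_input s'"
  unfolding has_input_def by simp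

lemma has_tree_cong:
  "has_tree s \<Longrightarrow> ints s' 10 = ints s 10 \<Longrightarrow> ints s' 11 = ints s 11 \<Longrightarrow> has_tree s'"
  unfolding has_tree_def by simp

lemma has_ancestors_cong:
  "has_ancestors s \<Longrightarrow> ints s' 13 = ints s 13 \<Longrightarrow> ints s' 14 = ints s 14 \<Longrightarrow> has_ancestors s'"
  unfolding has_ancestors_def by simp

lemma has_extremes_cong:
  "has_extremes \<sigma> k s \<Longrightarrow> ints s' (lo_array \<sigma>) = ints s (lo_array \<sigma>) \<Longrightarrow>
    ints s' (hi_array \<sigma>) = ints s (hi_array \<sigma>) \<Longrightarrow> has_extremes \<sigma> k s'"
  unfolding has_extremes_def by simp

lemma has_dependent_cong:
  "has_dependent \<sigma> s \<Longrightarrow> ints s' (dep_array \<sigma>) = ints s (dep_array \<sigma>) \<Longrightarrow> has_dependent \<sigma> s'"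
  unfolding has_dependent_def by simp

lemma below_lt: "x < n \<Longrightarrow> x \<sqsubseteq> y \<Longrightarrow> y < n"
  using below_in[of x y] by simp

lemma par_lt: "x < n \<Longrightarrow> par x < n"
  using par_in[of x] by simp

lemma endp_lt: "j < m \<Longrightarrow> endp \<sigma> (ls ! j) < n"
  using endp_in[of "ls ! j" \<sigma>] nth_mem[of j ls] by simp

lemma lo_hi_lt: "C \<sigma> l \<noteq> {} \<Longrightarrow> lo \<sigma> l < n \<and> hi \<sigma> l < n"
  using lowest_lo[of \<sigma> l] highest_hi[of \<sigma> l] C_D[of "lo \<sigma> l" \<sigma> l] C_D[of "hi \<sigma> l" \<sigma> l]
  by (auto simp: lowest_def highest_def)

subsection \<open>Parents and ancestors\<close>

definition seen :: "state \<Rightarrow> nat set" where "seen s = {x. x < n \<and> ints s 12 (int x) = 1}"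

definition partial_tree :: "state \<Rightarrow> bool" where
  "partial_tree s \<longleftrightarrow> r \<in> seen s \<and> (\<forall>x\<in>seen s. ints s 10 (int x) = int (par x) \<and> par x \<in> seen s \<and>
     (x \<noteq> r \<longrightarrow> (ints s 11 (int x) = 1) = ty x))"

lemma seen_set_int [simp]: "a \<noteq> 12 \<Longrightarrow> seen (set_int a i z s) = seen s"
  by (simp add: seen_def)

lemma partial_tree_set_int [simp]:
  "a \<notin> {10, 11, 12} \<Longrightarrow> partial_tree (set_int a i z s) = partial_tree s"
  by (simp add: partial_tree_def)

lemma partial_tree_extend:
  assumes "partial_tree s" "y < n" "y \<noteq> r" "par y \<in> seen s"
  defines "s' \<equiv> set_int 12 (int y) 1 (set_int 11 (int y) (if ty y then 1 else 0)
    (set_int 10 (int y) (int (par y)) s))"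
  shows "partial_tree s' \<and> seen s' = insert y (seen s)"
proof -
  have seen: "seen s' = insert y (seen s)" using assms(2) by (auto simp: seen_def s'_def)
  show ?thesis
    unfolding partial_tree_def seen using assms(1,3,4) by (auto simp: partial_tree_def s'_def)
qed

lemma par_round_spec:
  assumes inp: "has_input s0" and P: "partial_tree s0"
  defines "s \<equiv> den par_round s0"
  shows "partial_tree s \<and> seen s0 \<subseteq> seen s \<and>
    (\<forall>(x, y)\<in>set as. (x \<in> seen s0 \<longrightarrow> y \<in> seen s) \<and> (y \<in> seen s0 \<longrightarrow> x \<in> seen s))"
proof -
  let ?I = "\<lambda>j s. partial_tree s \<and> seen s0 \<subseteq> seen s \<and>
    (\<forall>k<j. (fst (as ! k) \<in> seen s0 \<longrightarrow> snd (as ! k) \<in> seen s) \<and>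
      (snd (as ! k) \<in> seen s0 \<longrightarrow> fst (as ! k) \<in> seen s))"
  have "?I (length as) s"
    unfolding s_def par_round_def
  proof (rule for_invariant[where I = ?I and N = "length as"])
    show "ival as_exp s0 = int (length as)" using has_inputD[OF inp] by simp
    show "51 \<notin> iw par_body" by (simp add: writes_tree)
    show "?I 0 (set_int 51 0 0 s0)" using P by simp
  next
    fix j and s :: state assume j: "j < length as" and I: "?I j s" and k: "ints s 51 0 = int j"
      and fi: "\<And>a. a \<notin> iw par_body \<Longrightarrow> a \<noteq> 51 \<Longrightarrow> ints s a = ints s0 a"
    obtain x y where xy: "as ! j = (x, y)" by force
    then have arc: "(x, y) \<in> set as" using nth_mem[OF j] by simp
    have lt: "x < n" "y < n" using arc_cases_input[OF arc] par_lt by auto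
    have cells: "ints s (Suc 0) (int j) = int x" "ints s 2 (int j) = int y"
      using fi[of 1] fi[of 2] has_inputD(5,6)[OF inp j] xy by (auto simp: writes_tree)
    have sn: "ints s 12 (int x) = 1 \<longleftrightarrow> x \<in> seen s" "ints s 12 (int y) = 1 \<longleftrightarrow> y \<in> seen s"
      using lt by (auto simp: seen_def)
    have P: "partial_tree s" "seen s0 \<subseteq> seen s" using I by auto
    have closed: "z \<in> seen s \<Longrightarrow> par z \<in> seen s" for z using P by (auto simp: partial_tree_def)
    have rs: "r \<in> seen s" using P by (auto simp: partial_tree_def)
    define s' where "s' = den par_body s"
    have "partial_tree s' \<and> seen s' = (if x \<in> seen s \<or> y \<in> seen s then {x, y} \<union> seen s else seen s)"
    proof -
      consider "x \<in> seen s" "y \<notin> seen s" | "y \<in> seen s" "x \<notin> seen s" | "x \<in> seen s \<longleftrightarrow> y \<in> seen s"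
        by blast
      then show ?thesis
      proof cases
        case 1
        \<comment> \<open>The seen vertices are closed under \<open>par\<close>, so the unseen end
          of the arc must be the child.\<close>
        then have y: "x = par y" "y \<noteq> r" "\<not> ty y" using arc_cases_input[OF arc] closed by auto
        have "s' = set_int 12 (int y) 1 (set_int 11 (int y) 0 (set_int 10 (int y) (int x) s))"
          using 1 k cells sn by (simp add: s'_def par_body_def eq_iff_not_less)
        then show ?thesis using partial_tree_extend[OF P(1) lt(2) y(2)] 1 y by auto
      next
        case 2
        then have x: "y = par x" "x \<noteq> r" "ty x" using arc_cases_input[OF arc] closed by auto
        have "s' = set_int 12 (int x) 1 (set_int 11 (int x) 1 (set_int 10 (int x) (int y) s))"
          using 2 k cells sn by (simp add: s'_def par_body_def eq_iff_not_less)
        then show ?thesis using partial_tree_extend[OF P(1) lt(1) x(2)] 2 x by auto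
      next
        case 3
        then have "s' = s" using k cells sn by (auto simp: s'_def par_body_def eq_iff_not_less)
        then show ?thesis using P 3 by auto
      qed
    qed
    then show "?I (Suc j) (set_int 51 0 (int (Suc j)) (den par_body s))"
      using I xy unfolding s'_def[symmetric] by (auto simp: less_Suc_eq)
  qed
  moreover have "\<exists>k<length as. as ! k = (x, y)" if "(x, y) \<in> set as" for x y
    using that by (simp add: in_set_conv_nth)
  ultimately show ?thesis by fastforce
qed

text \<open>Every round reaches at least one further level, whatever the order of the arcs in the
  list, and all depths are below \<open>n\<close>.\<close>

lemma tree_prog_spec:
  assumes inp: "has_input s0" and unseen: "\<And>i. ints s0 12 i = 0"
  shows "has_tree (den tree_prog s0)"
proof -
  let ?s1 = "set_int 12 (int r) 1 (set_int 10 (int r) (int r) s0)"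
  let ?I = "\<lambda>i s. partial_tree s \<and> (\<forall>x<n. depth x \<le> i \<longrightarrow> x \<in> seen s)"
  have rn: "r < n" using root_in by simp
  have seen1: "seen ?s1 = {r}" using unseen rn by (auto simp: seen_def)
  have inp1: "has_input ?s1" using inp by (rule has_input_cong) auto
  have "?I n (den (FFor 50 n_exp par_round) ?s1)"
  proof (rule for_invariant[where I = ?I and N = n])
    show "ival n_exp ?s1 = int n" using has_inputD[OF inp] by simp
    show "50 \<notin> iw par_round" by (simp add: writes_tree)
    have "partial_tree ?s1" unfolding partial_tree_def seen1 by (simp add: par_root)
    moreover have "x = r" if "x < n" "depth x = 0" for x using depth_par[of x] that by auto
    ultimately show "?I 0 (set_int 50 0 0 ?s1)" using seen1 by auto
  next
    fix i and s :: state assume I: "?I i s"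
      and fi: "\<And>a. a \<notin> iw par_round \<Longrightarrow> a \<noteq> 50 \<Longrightarrow> ints s a = ints ?s1 a"
    have "has_input s" using inp1 by (rule has_input_cong) (use fi in \<open>auto simp: writes_tree\<close>)
    from par_round_spec[OF this] I have round: "partial_tree (den par_round s)"
      "seen s \<subseteq> seen (den par_round s)"
      "\<And>x y. (x, y) \<in> set as \<Longrightarrow> x \<in> seen s \<Longrightarrow> y \<in> seen (den par_round s)"
      "\<And>x y. (x, y) \<in> set as \<Longrightarrow> y \<in> seen s \<Longrightarrow> x \<in> seen (den par_round s)" by auto
    have "x \<in> seen (den par_round s)" if x: "x < n" "depth x \<le> Suc i" for x
    proof (cases "x = r")
      case True
      then show ?thesis using round(1) by (simp add: partial_tree_def)
    next
      case False
      then have "par x \<in> seen s" using depth_par[of x] x I par_lt by auto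
      then show ?thesis using arc_exists[OF x(1) False] round(3,4) by (auto split: if_splits)
    qed
    then show "?I (Suc i) (set_int 50 0 (int (Suc i)) (den par_round s))"
      using round(1) by simp
  qed
  moreover have "depth x \<le> n" if "x < n" for x using depth_less_card[of x] that by simp
  moreover have "den tree_prog s0 = den (FFor 50 n_exp par_round) ?s1"
    using has_inputD(2)[OF inp] by (simp add: tree_prog_def)
  ultimately show ?thesis by (auto simp: has_tree_def partial_tree_def)
qed

lemma offset_spec:
  assumes inp: "has_input s0" and z: "ints s0 13 0 = 0"
  shows "\<forall>x\<le>n. ints (den offset_prog s0) 13 (int x) = int (x * n)"
  unfolding offset_prog_def
proof (rule for_invariant[where I = "\<lambda>i s. \<forall>x\<le>i. ints s 13 (int x) = int (x * n)" and N = n])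
  show "ival n_exp s0 = int n" using has_inputD[OF inp] by simp
next
  fix i and s :: state assume I: "\<forall>x\<le>i. ints s 13 (int x) = int (x * n)" and k: "ints s 50 0 = int i"
    and fi: "\<And>a. a \<notin> iw (FI 13 (IAdd (scalar 50) (IConst 1)) (IAdd (IGet 13 (scalar 50)) n_exp)) \<Longrightarrow>
      a \<noteq> 50 \<Longrightarrow> ints s a = ints s0 a"
  have "ints s 0 0 = int n" using fi[of 0] has_inputD[OF inp] by simp
  then show "\<forall>x\<le>Suc i. ints (set_int 50 0 (int (Suc i))
      (den (FI 13 (IAdd (scalar 50) (IConst 1)) (IAdd (IGet 13 (scalar 50)) n_exp)) s)) 13 (int x) =
      int (x * n)"
    using I k by (auto simp: le_Suc_eq algebra_simps)
qed (use z in auto)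

lemma below_bounded: "x < n \<Longrightarrow> x \<sqsubseteq> y \<longleftrightarrow> (\<exists>k<n. (par ^^ k) x = y)"
proof
  assume x: "x < n" and y: "x \<sqsubseteq> y"
  have "x \<in> {..<n}" using x by simp
  then have "\<exists>k\<le>depth x. (par ^^ k) x = y"
    using y
  proof (induction rule: tree_induct)
    case root
    then show ?case by (intro exI[of _ 0]) (simp add: root_below)
  next
    case (step x)
    show ?case
    proof (cases "x = y")
      case True
      then show ?thesis by (intro exI[of _ 0]) simp
    next
      case False
      then obtain k where "k \<le> depth (par x)" "(par ^^ k) (par x) = y" using step below_iff[of x] by auto
      then show ?thesis using depth_par[OF step(1,2)]
        by (intro exI[of _ "Suc k"]) (simp add: funpow_swap1)
    qed
  qed
  moreover have "depth x < n" using depth_less_card[of x] x by simp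
  ultimately show "\<exists>k<n. (par ^^ k) x = y" using le_less_trans by blast
qed (auto simp: below_def)

lemma climb_spec:
  assumes inp: "has_input s0" and tree: "has_tree s0" and x: "ints s0 50 0 = int x" "x < n"
    and off: "ints s0 13 (int x) = int (x * n)"
  shows "ints (den climb s0) 14 i = (if \<exists>y. x \<sqsubseteq> y \<and> i = int (x * n + y) then 1 else ints s0 14 i)"
proof -
  let ?s1 = "set_int 30 0 (int x) s0"
  let ?I = "\<lambda>j s. ints s 30 0 = int ((par ^^ j) x) \<and>
    (\<forall>i. ints s 14 i = (if \<exists>k<j. i = int (x * n + (par ^^ k) x) then 1 else ints s0 14 i))"
  have "?I n (den (FFor 51 n_exp climb_body) ?s1)"
  proof (rule for_invariant[where I = ?I and N = n])
    show "ival n_exp ?s1 = int n" using has_inputD[OF inp] by simp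
    show "51 \<notin> iw climb_body" by (simp add: writes_tree)
    show "?I 0 (set_int 51 0 0 ?s1)" by simp
  next
    fix j and s :: state assume I: "?I j s"
      and fi: "\<And>a. a \<notin> iw climb_body \<Longrightarrow> a \<noteq> 51 \<Longrightarrow> ints s a = ints ?s1 a"
    have "(par ^^ j) x < n" using below_lt[OF x(2)] by (auto simp: below_def)
    then have cells: "ints s 50 0 = int x" "ints s 13 (int x) = int (x * n)"
      "ints s 10 (int ((par ^^ j) x)) = int (par ((par ^^ j) x))"
      using fi x off tree by (auto simp: writes_tree has_tree_def)
    show "?I (Suc j) (set_int 51 0 (int (Suc j)) (den climb_body s))"
    proof -
      let ?p = "(par ^^ j) x"
      have d: "ints (den climb_body s) 14 = (ints s 14)(int (x * n + ?p) := 1)"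
        "ints (den climb_body s) 30 0 = int (par ?p)"
        using I cells by (simp_all add: climb_body_def)
      have "(\<exists>k<Suc j. i = int (x * n + (par ^^ k) x)) \<longleftrightarrow>
          i = int (x * n + ?p) \<or> (\<exists>k<j. i = int (x * n + (par ^^ k) x))" for i
        unfolding less_Suc_eq by blast
      then show ?thesis using I d by auto
    qed
  qed
  moreover have "den climb s0 = den (FFor 51 n_exp climb_body) ?s1"
    using x by (simp add: climb_def)
  moreover have "(\<exists>k<n. i = int (x * n + (par ^^ k) x)) \<longleftrightarrow> (\<exists>y. x \<sqsubseteq> y \<and> i = int (x * n + y))"
    by (auto simp: below_bounded[OF x(2)])
  ultimately show ?thesis by simp
qed

lemma pair_index_inj:
  fixes x y x' y' :: nat
  assumes "x * n + y = x' * n + y'" "y < n" "y' < n"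
  shows "x = x' \<and> y = y'"
proof -
  have "(x * n + y) div n = x" "(x' * n + y') div n = x'" using assms(2,3) by simp_all
  then show ?thesis using assms(1) by simp
qed

lemma ancestor_prog_spec:
  assumes inp: "has_input s0" and tree: "has_tree s0"
    and z: "\<And>i. ints s0 13 i = 0" "\<And>i. ints s0 14 i = 0"
  shows "has_ancestors (den ancestor_prog s0)"
proof -
  define s1 where "s1 = den offset_prog s0"
  have fr1: "\<And>a. a \<notin> {13, 50} \<Longrightarrow> ints s1 a = ints s0 a"
    unfolding s1_def using den_frame[of _ offset_prog s0] by (simp add: writes_tree)
  have off: "\<forall>x\<le>n. ints s1 13 (int x) = int (x * n)"
    unfolding s1_def by (rule offset_spec[OF inp]) (simp add: z)
  have inp1: "has_input s1" using inp by (rule has_input_cong) (simp add: fr1)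
  have tree1: "has_tree s1" using tree by (rule has_tree_cong) (simp_all add: fr1)
  let ?I = "\<lambda>j s. \<forall>i. ints s 14 i = (if \<exists>x<j. \<exists>y. x \<sqsubseteq> y \<and> i = int (x * n + y) then 1 else 0)"
  define s2 where "s2 = den (FFor 50 n_exp climb) s1"
  have "?I n s2"
    unfolding s2_def
  proof (rule for_invariant[where I = ?I and N = n])
    show "ival n_exp s1 = int n" using has_inputD[OF inp1] by simp
    show "50 \<notin> iw climb" by (simp add: writes_tree)
    show "?I 0 (set_int 50 0 0 s1)" using z fr1 by simp
  next
    fix j and s :: state assume j: "j < n" and I: "?I j s" and k: "ints s 50 0 = int j"
      and fi: "\<And>a. a \<notin> iw climb \<Longrightarrow> a \<noteq> 50 \<Longrightarrow> ints s a = ints s1 a"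
    have inp': "has_input s" using inp1 by (rule has_input_cong) (use fi in \<open>auto simp: writes_tree\<close>)
    have tree': "has_tree s" using tree1 by (rule has_tree_cong) (use fi in \<open>auto simp: writes_tree\<close>)
    have off': "ints s 13 (int j) = int (j * n)" using off fi j by (simp add: writes_tree)
    show "?I (Suc j) (set_int 50 0 (int (Suc j)) (den climb s))"
      using climb_spec[OF inp' tree' k j off'] I by (auto simp: less_Suc_eq)
  qed
  moreover have "ints s2 13 = ints s1 13"
    unfolding s2_def by (rule den_frame) (simp add: writes_tree)
  moreover have "(\<exists>x'<n. \<exists>y'. x' \<sqsubseteq> y' \<and> int (x * n + y) = int (x' * n + y')) \<longleftrightarrow> x \<sqsubseteq> y"
    if "x < n" "y < n" for x y
    using that pair_index_inj[of x y] below_lt by (metis of_nat_eq_iff)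
  ultimately have "has_ancestors s2" using off unfolding has_ancestors_def by simp
  then show ?thesis by (simp add: ancestor_prog_def s2_def s1_def)
qed

end

text \<open>Membership of \<open>x\<close> in \<open>C \<sigma> (ls ! j)\<close> as it is read off
  the arrays.\<close>

definition covered_cell :: "bool \<Rightarrow> nat \<Rightarrow> nat \<Rightarrow> state \<Rightarrow> bool" where
  "covered_cell \<sigma> j x s \<longleftrightarrow> int x \<noteq> ints s 0 1 \<and> (ints s 11 (int x) = 1) = \<sigma> \<and>
     ints s 14 (ints s 13 (ints s (end_array \<sigma>) (int j)) + int x) = 1 \<and>
     ints s 14 (ints s 13 (ints s (end_array (\<not> \<sigma>)) (int j)) + int x) \<noteq> 1"

text \<open>Pure evaluation of the loop body, kept apart from the meaning of the arrays; splitting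
  on \<open>\<sigma>\<close> to resolve the array numbers happens here.\<close>

lemma den_extremes_body:
  assumes "ints s 50 0 = int j" "ints s 51 0 = int x"
  shows "\<not> covered_cell \<sigma> j x s \<Longrightarrow> den (extremes_body \<sigma>) s = s" (is "_ \<Longrightarrow> ?skip")
    and "covered_cell \<sigma> j x s \<Longrightarrow> ints (den (extremes_body \<sigma>) s) (lo_array \<sigma>) =
      (if ints s (lo_array \<sigma>) (int j) < 0 \<or> ints s 14 (ints s 13 (int x) + ints s (lo_array \<sigma>) (int j)) = 1
       then (ints s (lo_array \<sigma>))(int j := int x) else ints s (lo_array \<sigma>))" (is "_ \<Longrightarrow> ?lo")
    and "covered_cell \<sigma> j x s \<Longrightarrow> ints (den (extremes_body \<sigma>) s) (hi_array \<sigma>) =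
      (if ints s (hi_array \<sigma>) (int j) < 0 \<or> ints s 14 (ints s 13 (ints s (hi_array \<sigma>) (int j)) + int x) = 1
       then (ints s (hi_array \<sigma>))(int j := int x) else ints s (hi_array \<sigma>))" (is "_ \<Longrightarrow> ?hi")
proof -
  let ?c = "BAnd (BNot (beq (scalar 51) root_exp)) (BAnd (has_type \<sigma> (scalar 51))
     (BAnd (anc (IGet (end_array \<sigma>) (scalar 50)) (scalar 51))
       (BNot (anc (IGet (end_array (\<not> \<sigma>)) (scalar 50)) (scalar 51)))))"
  have c: "bval ?c s = covered_cell \<sigma> j x s"
    using assms by (cases \<sigma>) (simp_all add: covered_cell_def eq_iff_not_less)
  show "\<not> covered_cell \<sigma> j x s \<Longrightarrow> ?skip"
    unfolding extremes_body_def den.simps(5) c by simp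
  show "covered_cell \<sigma> j x s \<Longrightarrow> ?lo" "covered_cell \<sigma> j x s \<Longrightarrow> ?hi"
    using assms unfolding extremes_body_def den.simps(5)[of ?c] c
    by (cases \<sigma>; simp add: eq_iff_not_less)+
qed

lemma den_dependent_body:
  assumes "ints s 50 0 = int w" "ints s 51 0 = int j"
  shows "den (dependent_body \<sigma>) s =
    (if 0 \<le> ints s (lo_array \<sigma>) (int j) \<and>
        ints s 14 (ints s 13 (ints s 10 (ints s (lo_array \<sigma>) (int j))) + int w) = 1 \<and>
        (0 \<le> ints s (hi_array \<sigma>) (int j) \<and>
           ints s 14 (ints s 13 (ints s 10 (ints s (hi_array \<sigma>) (int j))) + int w) \<noteq> 1 \<or>
         0 \<le> ints s (hi_array (\<not> \<sigma>)) (int j) \<and>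
           ints s 14 (ints s 13 (ints s 10 (ints s (hi_array (\<not> \<sigma>)) (int j))) + int w) \<noteq> 1)
     then set_int (dep_array \<sigma>) (int w) 1 s else s)" (is "_ = (if ?P then _ else _)")
proof -
  let ?c = "BAnd (BNot (ILess (IGet (lo_array \<sigma>) (scalar 51)) (IConst 0)))
     (BAnd (anc (IGet 10 (IGet (lo_array \<sigma>) (scalar 51))) (scalar 50))
       (bor (sticks_out \<sigma>) (sticks_out (\<not> \<sigma>))))"
  have c: "bval ?c s \<longleftrightarrow> ?P"
    using assms unfolding bval.simps(3,4) eq_iff_not_less bval.simps(1) by (auto simp: not_less)
  have "den (dependent_body \<sigma>) s = (if bval ?c s then set_int (dep_array \<sigma>) (int w) 1 s else s)"
    by (simp only: dependent_body_def den.simps ival.simps assms(1))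
  then show ?thesis unfolding c .
qed

context willow_input
begin

lemma anc_cell:
  "has_ancestors s \<Longrightarrow> a < n \<Longrightarrow> b < n \<Longrightarrow> (ints s 14 (ints s 13 (int a) + int b) = 1) = (a \<sqsubseteq> b)"
  by (simp add: has_ancestors_def)

lemma end_cell:
  "has_input s \<Longrightarrow> j < m \<Longrightarrow> ints s (end_array \<sigma>) (int j) = int (endp \<sigma> (ls ! j))"
  using has_inputD(7,8)[of s j] by (auto simp: endp_def)

lemma tree_cell:
  "has_tree s \<Longrightarrow> x < n \<Longrightarrow> ints s 10 (int x) = int (par x)"
  "has_tree s \<Longrightarrow> x < n \<Longrightarrow> x \<noteq> r \<Longrightarrow> (ints s 11 (int x) = 1) = ty x"
  by (auto simp: has_tree_def)

text \<open>Vertices are scanned in numerical order, unrelated to the tree order. Since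
  \<open>C \<sigma> l\<close> is a chain, comparing each new member with the current extremes is
  enough.\<close>

lemma extremes_of_link_spec:
  fixes \<sigma> :: bool
  assumes inp: "has_input s0" and tree: "has_tree s0" and an: "has_ancestors s0"
    and j: "ints s0 50 0 = int j" "j < m"
  defines "s \<equiv> den (extremes_of_link \<sigma>) s0" and "l \<equiv> ls ! j"
  shows "ints s (lo_array \<sigma>) = (ints s0 (lo_array \<sigma>))(int j := if C \<sigma> l = {} then -1 else int (lo \<sigma> l)) \<and>
    ints s (hi_array \<sigma>) = (ints s0 (hi_array \<sigma>))(int j := if C \<sigma> l = {} then -1 else int (hi \<sigma> l))"
proof -
  let ?lo = "lo_array \<sigma>" and ?hi = "hi_array \<sigma>"
  let ?A = "\<lambda>x. C \<sigma> l \<inter> {..<x}"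
  let ?s1 = "set_int ?hi (int j) (-1) (set_int ?lo (int j) (-1) s0)"
  let ?I = "\<lambda>x s. (?A x = {} \<and> ints s ?lo (int j) = -1 \<and> ints s ?hi (int j) = -1 \<or>
      (\<exists>a\<in>?A x. \<exists>b\<in>?A x. ints s ?lo (int j) = int a \<and> ints s ?hi (int j) = int b \<and>
        (\<forall>y\<in>?A x. a \<sqsubseteq> y \<and> y \<sqsubseteq> b))) \<and>
    (\<forall>i. i \<noteq> int j \<longrightarrow> ints s ?lo i = ints s0 ?lo i \<and> ints s ?hi i = ints s0 ?hi i)"
  have lohi: "?lo \<noteq> ?hi" "?lo \<noteq> 51" "?hi \<noteq> 51" "?lo \<noteq> 50" "?hi \<noteq> 50" by auto
  have inp1: "has_input ?s1" using inp by (rule has_input_cong) auto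
  have tree1: "has_tree ?s1" using tree by (rule has_tree_cong) auto
  have an1: "has_ancestors ?s1" using an by (rule has_ancestors_cong) auto
  have s: "s = den (FFor 51 n_exp (extremes_body \<sigma>)) ?s1"
    using j(1) lohi by (simp add: s_def extremes_of_link_def)
  have "?I n s"
    unfolding s
  proof (rule for_invariant[where I = ?I and N = n])
    show "ival n_exp ?s1 = int n" using has_inputD(1)[OF inp1] by simp
    show "51 \<notin> iw (extremes_body \<sigma>)" using lohi by (simp add: writes_tree)
    show "?I 0 (set_int 51 0 0 ?s1)" using lohi by simp
  next
    fix x and s :: state assume x: "x < n" and I: "?I x s" and k: "ints s 51 0 = int x"
      and fi: "\<And>a. a \<notin> iw (extremes_body \<sigma>) \<Longrightarrow> a \<noteq> 51 \<Longrightarrow> ints s a = ints ?s1 a"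
    have inp': "has_input s" using inp1 by (rule has_input_cong) (auto simp: fi writes_tree)
    have tree': "has_tree s" using tree1 by (rule has_tree_cong) (auto simp: fi writes_tree)
    have an': "has_ancestors s" using an1 by (rule has_ancestors_cong) (auto simp: fi writes_tree)
    have j': "ints s 50 0 = int j" using fi[of 50] lohi j by (simp add: writes_tree)
    have ends: "endp \<tau> l < n" for \<tau> using endp_lt[OF j(2)] by (simp add: l_def)
    have inC: "covered_cell \<sigma> j x s \<longleftrightarrow> x \<in> C \<sigma> l"
      unfolding covered_cell_def end_cell[OF inp' j(2)] l_def[symmetric] anc_cell[OF an' ends x]
        has_inputD(2)[OF inp']
      using tree_cell(2)[OF tree' x] x by (auto simp: C_def)
    define s' where "s' = den (extremes_body \<sigma>) s"
    note body = den_extremes_body[OF j' k, of \<sigma>, unfolded inC, folded s'_def]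
    show "?I (Suc x) (set_int 51 0 (int (Suc x)) (den (extremes_body \<sigma>) s))"
    proof (cases "x \<in> C \<sigma> l")
      case False
      then have "s' = s" using body(1) by simp
      moreover have "?A (Suc x) = ?A x" using False by (auto simp: less_Suc_eq)
      ultimately show ?thesis using I lohi unfolding s'_def[symmetric] by simp
    next
      case True
      have A: "?A (Suc x) = insert x (?A x)" using True by (auto simp: less_Suc_eq)
      have upd_if: "(if b then f(k := y) else f) i = f i" if "i \<noteq> k"
        for b and f :: "int \<Rightarrow> int" and i k y using that by simp
      have "ints s' ?lo i = ints s ?lo i" "ints s' ?hi i = ints s ?hi i" if "i \<noteq> int j" for i
        unfolding body(2,3)[OF True] by (rule upd_if[OF that])+
      then have unch: "\<forall>i. i \<noteq> int j \<longrightarrow> ints s' ?lo i = ints s0 ?lo i \<and> ints s' ?hi i = ints s0 ?hi i"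
        using I by metis
      have "\<exists>a\<in>?A (Suc x). \<exists>b\<in>?A (Suc x). ints s' ?lo (int j) = int a \<and> ints s' ?hi (int j) = int b \<and>
        (\<forall>y\<in>?A (Suc x). a \<sqsubseteq> y \<and> y \<sqsubseteq> b)"
      proof (cases "?A x = {}")
        case empty: True
        then have "ints s ?lo (int j) = -1" "ints s ?hi (int j) = -1" using I by auto
        then have "ints s' ?lo (int j) = int x" "ints s' ?hi (int j) = int x"
          unfolding body(2,3)[OF True] by auto
        then show ?thesis unfolding A empty by auto
      next
        case False
        then obtain a b where ab: "a \<in> ?A x" "b \<in> ?A x" "ints s ?lo (int j) = int a"
          "ints s ?hi (int j) = int b" "\<And>y. y \<in> ?A x \<Longrightarrow> a \<sqsubseteq> y \<and> y \<sqsubseteq> b" using I by auto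
        have lt: "a < n" "b < n" using ab x by auto
        define a' where "a' = (if x \<sqsubseteq> a then x else a)"
        define b' where "b' = (if b \<sqsubseteq> x then x else b)"
        have "ints s' ?lo (int j) = int a'" "ints s' ?hi (int j) = int b'"
          using ab(3,4) anc_cell[OF an' x lt(1)] anc_cell[OF an' lt(2) x] unfolding body(2,3)[OF True]
          by (auto simp: a'_def b'_def)
        moreover have "a' \<in> insert x (?A x)" "b' \<in> insert x (?A x)" using ab by (auto simp: a'_def b'_def)
        moreover have "x \<sqsubseteq> a \<or> a \<sqsubseteq> x" "x \<sqsubseteq> b \<or> b \<sqsubseteq> x"
          using C_comparable[OF True, of a] C_comparable[OF True, of b] ab by auto
        then have "a' \<sqsubseteq> x \<and> x \<sqsubseteq> b'" by (auto simp: a'_def b'_def)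
        moreover have "a' \<sqsubseteq> y \<and> y \<sqsubseteq> b'" if "y \<in> ?A x" for y
          using ab(5)[OF that] below_trans[of x a y] below_trans[of y b x] by (auto simp: a'_def b'_def)
        ultimately show ?thesis unfolding A by blast
      qed
      then show ?thesis using unch lohi unfolding s'_def[symmetric] by simp
    qed
  qed
  moreover have A: "?A n = C \<sigma> l" using C_D[of _ \<sigma> l] by auto
  ultimately have res: "C \<sigma> l = {} \<and> ints s ?lo (int j) = -1 \<and> ints s ?hi (int j) = -1 \<or>
      (\<exists>a\<in>C \<sigma> l. \<exists>b\<in>C \<sigma> l. ints s ?lo (int j) = int a \<and> ints s ?hi (int j) = int b \<and>
        (\<forall>y\<in>C \<sigma> l. a \<sqsubseteq> y \<and> y \<sqsubseteq> b))"
    and unch: "\<And>i. i \<noteq> int j \<Longrightarrow> ints s ?lo i = ints s0 ?lo i"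
      "\<And>i. i \<noteq> int j \<Longrightarrow> ints s ?hi i = ints s0 ?hi i"
    unfolding A by auto
  have "ints s ?lo (int j) = (if C \<sigma> l = {} then -1 else int (lo \<sigma> l)) \<and>
      ints s ?hi (int j) = (if C \<sigma> l = {} then -1 else int (hi \<sigma> l))"
    using res
  proof
    assume "\<exists>a\<in>C \<sigma> l. \<exists>b\<in>C \<sigma> l. ints s ?lo (int j) = int a \<and> ints s ?hi (int j) = int b \<and>
        (\<forall>y\<in>C \<sigma> l. a \<sqsubseteq> y \<and> y \<sqsubseteq> b)"
    then obtain a b where ab: "a \<in> C \<sigma> l" "b \<in> C \<sigma> l" "ints s ?lo (int j) = int a"
      "ints s ?hi (int j) = int b" "\<forall>y\<in>C \<sigma> l. a \<sqsubseteq> y \<and> y \<sqsubseteq> b" by blast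
    then have "lo \<sigma> l = a" "hi \<sigma> l = b"
      by (auto intro!: lo_eq hi_eq simp: lowest_def highest_def)
    then show ?thesis using ab by auto
  qed simp
  then show ?thesis using unch by (cases \<sigma>) (auto simp: fun_eq_iff)
qed

lemma extremes_prog_spec:
  assumes inp: "has_input s0" and tree: "has_tree s0" and an: "has_ancestors s0"
  shows "has_extremes \<sigma> m (den (extremes_prog \<sigma>) s0)"
  unfolding extremes_prog_def
proof (rule for_invariant[where I = "has_extremes \<sigma>" and N = m])
  show "ival m_exp s0 = int m" using has_inputD[OF inp] by simp
  show "50 \<notin> iw (extremes_of_link \<sigma>)" by (simp add: writes_tree)
  show "has_extremes \<sigma> 0 (set_int 50 0 0 s0)" by (simp add: has_extremes_def)
next
  fix j and s :: state assume j: "j < m" and I: "has_extremes \<sigma> j s" and k: "ints s 50 0 = int j"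
    and fi: "\<And>a. a \<notin> iw (extremes_of_link \<sigma>) \<Longrightarrow> a \<noteq> 50 \<Longrightarrow> ints s a = ints s0 a"
  have inp': "has_input s" using inp by (rule has_input_cong) (auto simp: fi writes_tree)
  have tree': "has_tree s" using tree by (rule has_tree_cong) (auto simp: fi writes_tree)
  have an': "has_ancestors s" using an by (rule has_ancestors_cong) (auto simp: fi writes_tree)
  have lohi: "lo_array \<sigma> \<noteq> 50" "hi_array \<sigma> \<noteq> 50" by auto
  show "has_extremes \<sigma> (Suc j) (set_int 50 0 (int (Suc j)) (den (extremes_of_link \<sigma>) s))"
    using I extremes_of_link_spec[OF inp' tree' an' k j, of \<sigma>] lohi
    unfolding has_extremes_def by (simp add: less_Suc_eq)
qed

lemma dependent_row_spec:
  fixes \<sigma> :: bool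
  assumes inp: "has_input s0" and tree: "has_tree s0" and an: "has_ancestors s0"
    and ext: "has_extremes True m s0" "has_extremes False m s0"
    and w: "ints s0 50 0 = int w" "w < n"
  defines "s \<equiv> den (FFor 51 m_exp (dependent_body \<sigma>)) s0"
  shows "ints s (dep_array \<sigma>) = (ints s0 (dep_array \<sigma>))
    (int w := if dependent \<sigma> w then 1 else ints s0 (dep_array \<sigma>) (int w))"
proof -
  let ?d = "dep_array \<sigma>"
  \<comment> \<open>The contribution of a single link to the right-hand side of
    \<open>dependent_iff\<close>.\<close>
  define P where "P j \<longleftrightarrow> C \<sigma> (ls ! j) \<noteq> {} \<and> par (lo \<sigma> (ls ! j)) \<sqsubseteq> w \<and>
     ((C \<sigma> (ls ! j) \<noteq> {} \<and> \<not> par (hi \<sigma> (ls ! j)) \<sqsubseteq> w) \<or>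
      (C (\<not> \<sigma>) (ls ! j) \<noteq> {} \<and> \<not> par (hi (\<not> \<sigma>) (ls ! j)) \<sqsubseteq> w))" for j
  let ?I = "\<lambda>j s. ints s ?d = (ints s0 ?d)(int w := if \<exists>k<j. P k then 1 else ints s0 ?d (int w))"
  have d: "?d \<noteq> 50" "?d \<noteq> 51" by auto
  have "?I m s"
    unfolding s_def
  proof (rule for_invariant[where I = ?I and N = m])
    show "ival m_exp s0 = int m" using has_inputD[OF inp] by simp
    show "51 \<notin> iw (dependent_body \<sigma>)" by (simp add: writes_tree)
    show "?I 0 (set_int 51 0 0 s0)" using d by simp
  next
    fix j and s :: state assume j: "j < m" and I: "?I j s" and k: "ints s 51 0 = int j"
      and fi: "\<And>a. a \<notin> iw (dependent_body \<sigma>) \<Longrightarrow> a \<noteq> 51 \<Longrightarrow> ints s a = ints s0 a"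
    have tree': "has_tree s" using tree by (rule has_tree_cong) (auto simp: fi writes_tree)
    have an': "has_ancestors s" using an by (rule has_ancestors_cong) (auto simp: fi writes_tree)
    have ext0: "has_extremes \<tau> m s0" for \<tau> using ext by (cases \<tau>) auto
    have ext': "has_extremes \<tau> m s" for \<tau>
      using ext0[of \<tau>] by (rule has_extremes_cong) (auto simp: fi writes_tree)
    have w': "ints s 50 0 = int w" using fi[of 50] w d by (simp add: writes_tree)
    have cells: "ints s (lo_array \<tau>) (int j) = (if C \<tau> (ls ! j) = {} then -1 else int (lo \<tau> (ls ! j)))"
      "ints s (hi_array \<tau>) (int j) = (if C \<tau> (ls ! j) = {} then -1 else int (hi \<tau> (ls ! j)))" for \<tau>
      using ext'[of \<tau>] j unfolding has_extremes_def by blast+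
    have anc_par: "(ints s 14 (ints s 13 (ints s 10 (int x)) + int w) = 1) = (par x \<sqsubseteq> w)" if "x < n" for x
      using anc_cell[OF an' par_lt[OF that] w(2)] tree_cell(1)[OF tree' that] by simp
    have lo: "0 \<le> ints s (lo_array \<tau>) (int j) \<and>
        ints s 14 (ints s 13 (ints s 10 (ints s (lo_array \<tau>) (int j))) + int w) = 1 \<longleftrightarrow>
        C \<tau> (ls ! j) \<noteq> {} \<and> par (lo \<tau> (ls ! j)) \<sqsubseteq> w" for \<tau>
      using anc_par lo_hi_lt[of \<tau> "ls ! j"] unfolding cells by auto
    have hi: "0 \<le> ints s (hi_array \<tau>) (int j) \<and>
        ints s 14 (ints s 13 (ints s 10 (ints s (hi_array \<tau>) (int j))) + int w) \<noteq> 1 \<longleftrightarrow>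
        C \<tau> (ls ! j) \<noteq> {} \<and> \<not> par (hi \<tau> (ls ! j)) \<sqsubseteq> w" for \<tau>
      using anc_par lo_hi_lt[of \<tau> "ls ! j"] unfolding cells by auto
    have "den (dependent_body \<sigma>) s = (if P j then set_int ?d (int w) 1 s else s)"
      unfolding den_dependent_body[OF w' k] P_def using lo[of \<sigma>] hi[of \<sigma>] hi[of "\<not> \<sigma>"]
      by (intro if_cong refl) blast
    moreover have "ints (set_int 51 0 z t) ?d = ints t ?d" "ints (set_int ?d i z t) ?d = (ints t ?d)(i := z)"
      for i z t using d by simp_all
    moreover have "(\<exists>k<Suc j. P k) \<longleftrightarrow> (\<exists>k<j. P k) \<or> P j" unfolding less_Suc_eq by blast
    ultimately show "?I (Suc j) (set_int 51 0 (int (Suc j)) (den (dependent_body \<sigma>) s))"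
      using I by (cases "P j") (simp_all only: if_True if_False simp_thms fun_upd_upd)
  qed
  moreover have "(\<exists>k<m. P k) \<longleftrightarrow> dependent \<sigma> w"
    unfolding dependent_iff P_def by (metis in_set_conv_nth)
  ultimately show ?thesis by simp
qed

lemma dependent_prog_spec:
  assumes inp: "has_input s0" and tree: "has_tree s0" and an: "has_ancestors s0"
    and ext: "has_extremes True m s0" "has_extremes False m s0"
    and z: "\<And>i. ints s0 (dep_array \<sigma>) i = 0"
  shows "has_dependent \<sigma> (den (dependent_prog \<sigma>) s0)"
proof -
  let ?d = "dep_array \<sigma>" and ?row = "FFor 51 m_exp (dependent_body \<sigma>)"
  let ?I = "\<lambda>k s. \<forall>i. ints s ?d i = (if \<exists>w<k. i = int w \<and> dependent \<sigma> w then 1 else 0)"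
  have iw: "iw ?row = {?d, 51}" by (auto simp: writes_tree)
  have d: "?d \<noteq> 50" "?d \<noteq> 51" by auto
  have "?I n (den (dependent_prog \<sigma>) s0)"
    unfolding dependent_prog_def
  proof (rule for_invariant[where I = ?I and N = n])
    show "ival n_exp s0 = int n" using has_inputD[OF inp] by simp
    show "50 \<notin> iw ?row" unfolding iw using d by auto
    show "?I 0 (set_int 50 0 0 s0)" using d z by simp
  next
    fix w and s :: state assume w: "w < n" and I: "?I w s" and k: "ints s 50 0 = int w"
      and fi: "\<And>a. a \<notin> iw ?row \<Longrightarrow> a \<noteq> 50 \<Longrightarrow> ints s a = ints s0 a"
    have fi': "ints s a = ints s0 a" if "a \<notin> {?d, 50, 51}" for a
      using fi[unfolded iw] that by simp
    have inp': "has_input s" using inp by (rule has_input_cong) (rule fi', auto)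
    have tree': "has_tree s" using tree by (rule has_tree_cong) (rule fi', auto)+
    have an': "has_ancestors s" using an by (rule has_ancestors_cong) (rule fi', auto)+
    have ext': "has_extremes True m s" using ext(1) by (rule has_extremes_cong) (rule fi', auto)+
    have ext'': "has_extremes False m s" using ext(2) by (rule has_extremes_cong) (rule fi', auto)+
    have e: "ints (set_int 50 0 z (den ?row s)) ?d = ints (den ?row s) ?d" for z
      using d by (simp del: den.simps)
    show "?I (Suc w) (set_int 50 0 (int (Suc w)) (den ?row s))"
      unfolding e dependent_row_spec[OF inp' tree' an' ext' ext'' k w]
      using I by (auto simp: less_Suc_eq)
  qed
  then show ?thesis by (auto simp: has_dependent_def)
qed

subsection \<open>The arcs of the network\<close>

lemma link_end_prog_spec:
  assumes inp: "has_input s" and tree: "has_tree s"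
    and ext: "has_extremes True m s" "has_extremes False m s" and j: "ints s 50 0 = int j" "j < m"
  shows "den (link_end_prog a \<tau>) s = set_int a (int j) (int (enc (link_end \<tau> (ls ! j)))) s"
proof -
  have ext': "has_extremes \<tau> m s" for \<tau> using ext by (cases \<tau>) auto
  have cells: "ints s (lo_array \<tau>) (int j) = (if C \<tau> (ls ! j) = {} then -1 else int (lo \<tau> (ls ! j)))"
    "ints s (hi_array \<tau>) (int j) = (if C \<tau> (ls ! j) = {} then -1 else int (hi \<tau> (ls ! j)))" for \<tau>
    using ext'[of \<tau>] j(2) unfolding has_extremes_def by blast+
  have pc: "C (\<not> \<tau>) (ls ! j) \<noteq> {} \<Longrightarrow>
      ints s 10 (int (hi (\<not> \<tau>) (ls ! j))) = int (par (hi (\<not> \<tau>) (ls ! j)))"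
    using tree_cell(1)[OF tree] lo_hi_lt by blast
  show ?thesis
    using j(1) has_inputD(1,2)[OF inp] cells[of True] cells[of False] pc
    by (cases \<tau>; cases "C \<tau> (ls ! j) = {}"; cases "C (\<not> \<tau>) (ls ! j) = {}")
      (simp_all add: link_end_prog_def link_end_def)
qed

lemma link_arcs_prog_spec:
  assumes inp: "has_input s0" and tree: "has_tree s0"
    and ext: "has_extremes True m s0" "has_extremes False m s0"
  shows "\<forall>e<m. has_arc (den link_arcs_prog s0) e"
proof -
  let ?body = "link_end_prog 23 False ;; link_end_prog 24 True"
  have iw: "iw ?body = {23, 24}" by (auto simp: writes_tree)
  show ?thesis
    unfolding link_arcs_prog_def
  proof (rule for_invariant[where I = "\<lambda>j s. \<forall>e<j. has_arc s e" and N = m])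
    show "ival m_exp s0 = int m" using has_inputD[OF inp] by simp
    show "50 \<notin> iw ?body" unfolding iw by simp
  next
    fix j and s :: state assume j: "j < m" and I: "\<forall>e<j. has_arc s e" and k: "ints s 50 0 = int j"
      and fi: "\<And>a. a \<notin> iw ?body \<Longrightarrow> a \<noteq> 50 \<Longrightarrow> ints s a = ints s0 a"
    have fi': "ints s a = ints s0 a" if "a \<notin> {23, 24, 50}" for a
      using fi[unfolded iw] that by simp
    have inp': "has_input s" using inp by (rule has_input_cong) (rule fi', auto)
    have tree': "has_tree s" using tree by (rule has_tree_cong) (rule fi', auto)+
    have extT: "has_extremes True m s" using ext(1) by (rule has_extremes_cong) (rule fi', auto)+
    have extF: "has_extremes False m s" using ext(2) by (rule has_extremes_cong) (rule fi', auto)+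
    note ext' = extT extF
    let ?s1 = "set_int 23 (int j) (int (enc (link_end False (ls ! j)))) s"
    have 1: "den (link_end_prog 23 False) s = ?s1" by (rule link_end_prog_spec[OF inp' tree' ext' k j])
    have "den (link_end_prog 24 True) ?s1 = set_int 24 (int j) (int (enc (link_end True (ls ! j)))) ?s1"
    proof (rule link_end_prog_spec[OF _ _ _ _ _ j])
      show "has_input ?s1" using inp' by (rule has_input_cong) auto
      show "has_tree ?s1" using tree' by (rule has_tree_cong) auto
      show "has_extremes True m ?s1" using ext'(1) by (rule has_extremes_cong) auto
      show "has_extremes False m ?s1" using ext'(2) by (rule has_extremes_cong) auto
      show "ints ?s1 50 0 = int j" using k by simp
    qed
    then show "\<forall>e<Suc j. has_arc (set_int 50 0 (int (Suc j)) (den ?body s)) e"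
      using I 1 j by (auto simp: has_arc_def less_Suc_eq fr_def to_def arc_nodes_simps)
  qed simp
qed

definition put_arc :: "nat \<Rightarrow> state \<Rightarrow> state" where
  "put_arc e s = set_int 24 (int e) (int (to e)) (set_int 23 (int e) (int (fr e)) s)"

lemma has_arc_put_arc: "has_arc s e \<or> e = k \<Longrightarrow> has_arc (put_arc k s) e"
  by (auto simp: has_arc_def put_arc_def)

lemma ints_put_arc [simp]: "a \<noteq> 23 \<Longrightarrow> a \<noteq> 24 \<Longrightarrow> ints (put_arc e s) a = ints s a"
  by (simp add: put_arc_def)

lemma den_set_arc:
  assumes "ival e s = int k" "ival a s = int (fr k)"
    and "ival e (set_int 23 (int k) (int (fr k)) s) = int k"
    and "ival b (set_int 23 (int k) (int (fr k)) s) = int (to k)"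
  shows "den (set_arc e a b) s = put_arc k s"
  using assms by (simp add: set_arc_def put_arc_def)

lemma up_prog_spec:
  assumes inp: "has_input s" and tree: "has_tree s"
    and dep: "has_dependent True s" "has_dependent False s" and x: "ints s 50 0 = int x" "x < n"
  shows "den (up_prog k \<tau>) s = set_int k 0 (int (enc (up (N \<tau> x)))) s"
proof -
  have cells: "(ints s 19 (int x) = 1) = dependent True x" "(ints s 20 (int x) = 1) = dependent False x"
    using dep x by (auto simp: has_dependent_def)
  show ?thesis
    using x has_inputD(1,2)[OF inp] tree_cell[OF tree x(2)] cells
    by (cases \<tau>) (auto simp: up_prog_def eq_iff_not_less D_def)
qed

lemma slack_prog_spec:
  assumes inp: "has_input s" and tree: "has_tree s" and x: "ints s 50 0 = int x" "x < n"
  shows "den slack_prog s = put_arc (m + x) s"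
  using x has_inputD(1,2,4)[OF inp] tree_cell[OF tree x(2)]
  by (auto simp: slack_prog_def set_arc_def put_arc_def eq_iff_not_less fr_def to_def arc_nodes_simps)

lemma glue_prog_spec:
  assumes inp: "has_input s" and x: "ints s 50 0 = int x" "x < n"
    and u: "ints s 34 0 = int (enc (up (N True x)))" "ints s 35 0 = int (enc (up (N False x)))"
  shows "den glue_prog s =
    put_arc (m + 4 * n + x) (put_arc (m + 3 * n + x) (put_arc (m + 2 * n + x) (put_arc (m + n + x) s)))"
proof -
  let ?x = "scalar 50"
  have "den (set_arc (IAdd m_exp (IAdd n_exp ?x)) ?x (scalar 34)) t = put_arc (m + n + x) t"
    "den (set_arc (IAdd m_exp (IAdd n2_exp ?x)) (IAdd n_exp ?x) (scalar 35)) t = put_arc (m + 2 * n + x) t"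
    "den (set_arc (IAdd m_exp (IAdd n3_exp ?x)) (scalar 34) ?x) t = put_arc (m + 3 * n + x) t"
    "den (set_arc (IAdd m_exp (IAdd n2_exp (IAdd n2_exp ?x))) (scalar 35) (IAdd n_exp ?x)) t =
      put_arc (m + 4 * n + x) t"
    if "ints t 0 = ints s 0" "ints t 50 = ints s 50" "ints t 34 = ints s 34" "ints t 35 = ints s 35" for t
    using that x u has_inputD(1,4)[OF inp]
    by - (rule den_set_arc; simp add: fr_def to_def arc_nodes_simps del: up.simps)+
  then show ?thesis by (simp add: glue_prog_def)
qed

lemma vertex_arcs_prog_spec:
  assumes inp: "has_input s0" and tree: "has_tree s0"
    and dep: "has_dependent True s0" "has_dependent False s0"
    and links: "\<forall>e<m. has_arc s0 e"
  shows "\<forall>e<E. has_arc (den vertex_arcs_prog s0) e"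
proof -
  let ?I = "\<lambda>i s. (\<forall>e<m. has_arc s e) \<and> (\<forall>x<i. has_arc s (m + x) \<and> has_arc s (m + n + x) \<and>
    has_arc s (m + 2 * n + x) \<and> has_arc s (m + 3 * n + x) \<and> has_arc s (m + 4 * n + x))"
  have frame: "has_arc (set_int a i z s) e = has_arc s e" if "a \<noteq> 23" "a \<noteq> 24" for a i z s e
    using that by (simp add: has_arc_def)
  have "?I n (den vertex_arcs_prog s0)"
    unfolding vertex_arcs_prog_def
  proof (rule for_invariant[where I = ?I and N = n])
    show "ival n_exp s0 = int n" using has_inputD[OF inp] by simp
    show "50 \<notin> iw vertex_arcs" by (simp add: writes_tree)
    show "?I 0 (set_int 50 0 0 s0)" using links by (simp add: frame)
  next
    fix x and s :: state assume x: "x < n" and I: "?I x s" and k: "ints s 50 0 = int x"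
      and fi: "\<And>a. a \<notin> iw vertex_arcs \<Longrightarrow> a \<noteq> 50 \<Longrightarrow> ints s a = ints s0 a"
    have inp1: "has_input s" using inp by (rule has_input_cong) (auto simp: fi writes_tree)
    have tree1: "has_tree s" using tree by (rule has_tree_cong) (auto simp: fi writes_tree)
    have dep1: "has_dependent True s" "has_dependent False s"
      using dep by (auto elim!: has_dependent_cong simp: fi writes_tree)
    define s2 where "s2 = set_int 34 0 (int (enc (up (N True x)))) s"
    define s3 where "s3 = set_int 35 0 (int (enc (up (N False x)))) s2"
    define s4 where "s4 = put_arc (m + x) s3"
    have u1: "den (up_prog 34 True) s = s2" unfolding s2_def by (rule up_prog_spec[OF inp1 tree1 dep1 k x])
    have u2: "den (up_prog 35 False) s2 = s3"
      unfolding s3_def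
    proof (rule up_prog_spec[OF _ _ _ _ _ x])
      show "has_input s2" using inp1 by (rule has_input_cong) (auto simp: s2_def)
      show "has_tree s2" using tree1 by (rule has_tree_cong) (auto simp: s2_def)
      show "has_dependent True s2" using dep1(1) by (rule has_dependent_cong) (auto simp: s2_def)
      show "has_dependent False s2" using dep1(2) by (rule has_dependent_cong) (auto simp: s2_def)
      show "ints s2 50 0 = int x" using k by (simp add: s2_def)
    qed
    have u3: "den slack_prog s3 = s4"
      unfolding s4_def
    proof (rule slack_prog_spec[OF _ _ _ x])
      show "has_input s3" using inp1 by (rule has_input_cong) (auto simp: s3_def s2_def)
      show "has_tree s3" using tree1 by (rule has_tree_cong) (auto simp: s3_def s2_def)
      show "ints s3 50 0 = int x" using k by (simp add: s3_def s2_def)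
    qed
    have u4: "den glue_prog s4 = put_arc (m + 4 * n + x) (put_arc (m + 3 * n + x)
        (put_arc (m + 2 * n + x) (put_arc (m + n + x) s4)))"
    proof (rule glue_prog_spec[OF _ _ x])
      show "has_input s4" using inp1 by (rule has_input_cong) (auto simp: s4_def s3_def s2_def)
      show "ints s4 50 0 = int x" using k by (simp add: s4_def s3_def s2_def)
      show "ints s4 34 0 = int (enc (up (N True x)))" by (simp add: s4_def s3_def s2_def)
      show "ints s4 35 0 = int (enc (up (N False x)))" by (simp add: s4_def s3_def s2_def)
    qed
    have den: "den vertex_arcs s = put_arc (m + 4 * n + x) (put_arc (m + 3 * n + x)
        (put_arc (m + 2 * n + x) (put_arc (m + n + x) s4)))"
      by (simp add: vertex_arcs_def u1 u2 u3 u4)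
    have "has_arc s3 e = has_arc s e" for e by (simp add: s3_def s2_def frame)
    then show "?I (Suc x) (set_int 50 0 (int (Suc x)) (den vertex_arcs s))"
      using I unfolding den s4_def by (auto simp: frame less_Suc_eq intro!: has_arc_put_arc)
  qed
  then show ?thesis by (auto elim!: arc_cases_net)
qed

end

section \<open>The theorem\<close>

text \<open>Array \<open>5\<close> is written on success only; its initial \<open>0\<close> already
  reports infeasibility.\<close>

definition main_prog :: fcom where
  "main_prog = tree_prog ;; ancestor_prog ;; extremes_prog True ;; extremes_prog False ;;
     dependent_prog True ;; dependent_prog False ;; link_arcs_prog ;; vertex_arcs_prog ;; flow_prog ;;
     FIf (beq (scalar 31) (IConst 0)) (set_scalar 5 (IConst 1)) FSkip"

lemma wf_main_prog: "wf_fcom main_prog"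
  by (simp add: main_prog_def tree_prog_def par_round_def par_body_def ancestor_prog_def
      offset_prog_def climb_def climb_body_def extremes_prog_def extremes_of_link_def
      extremes_body_def dependent_prog_def dependent_body_def link_arcs_prog_def link_end_prog_def
      vertex_arcs_prog_def vertex_arcs_def up_prog_def slack_prog_def glue_prog_def set_arc_def
      flow_prog_def meet_demand_def walk_step_prog_def search_step_def add_node_def shift_body_def
      scan_def scan_body_def)

lemma (in willow_input) main_prog_spec:
  assumes inp: "has_input s0" and zero: "\<And>a i. 5 \<le> a \<Longrightarrow> ints s0 a i = 0"
    and costs: "\<And>e. reals s0 0 (int e) = cost e" and pot0: "\<And>i. reals s0 4 i = 0"
  defines "s \<equiv> den main_prog s0"
  shows "(\<exists>x. covering x \<and> (\<forall>y. covering y \<longrightarrow> (\<Sum>l\<in>set ls. c l * x l) \<le> (\<Sum>l\<in>set ls. c l * y l)) \<and>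
      (\<forall>l\<in>set ls. x l \<in> \<int>) \<and> (\<forall>j<m. x (ls ! j) = of_int (ints s 6 (int j)))) \<and> ints s 5 0 = 1 \<or>
    (\<nexists>y. covering y) \<and> ints s 5 0 = 0"
proof -
  define s1 where "s1 = den tree_prog s0"
  define s2 where "s2 = den ancestor_prog s1"
  define s3 where "s3 = den (extremes_prog True) s2"
  define s4 where "s4 = den (extremes_prog False) s3"
  define s5 where "s5 = den (dependent_prog True) s4"
  define s6 where "s6 = den (dependent_prog False) s5"
  define s7 where "s7 = den link_arcs_prog s6"
  define s8 where "s8 = den vertex_arcs_prog s7"
  define s9 where "s9 = den flow_prog s8"
  note frames = writes_tree den_frame[of _ tree_prog s0, folded s1_def]
    den_frame[of _ ancestor_prog s1, folded s2_def] den_frame[of _ "extremes_prog True" s2, folded s3_def]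
    den_frame[of _ "extremes_prog False" s3, folded s4_def]
    den_frame[of _ "dependent_prog True" s4, folded s5_def]
    den_frame[of _ "dependent_prog False" s5, folded s6_def]
    den_frame[of _ link_arcs_prog s6, folded s7_def] den_frame[of _ vertex_arcs_prog s7, folded s8_def]
  have reals8: "reals s8 a = reals s0 a" for a
    unfolding s8_def s7_def s6_def s5_def s4_def s3_def s2_def s1_def
    by (simp add: den_frame_reals writes_tree del: den.simps)
  have inp': "has_input s1" "has_input s2" "has_input s3" "has_input s4" "has_input s5"
    "has_input s6" "has_input s7" "has_input s8"
    by (rule has_input_cong[OF inp]; simp add: frames)+
  have tree1: "has_tree s1" unfolding s1_def by (rule tree_prog_spec[OF inp]) (simp add: zero)
  have tree: "has_tree s2" "has_tree s3" "has_tree s4" "has_tree s5" "has_tree s6" "has_tree s7"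
    by (rule has_tree_cong[OF tree1]; simp add: frames)+
  have an2: "has_ancestors s2"
    unfolding s2_def by (rule ancestor_prog_spec[OF inp'(1) tree1]) (simp_all add: frames zero)
  have an: "has_ancestors s3" "has_ancestors s4" "has_ancestors s5"
    by (rule has_ancestors_cong[OF an2]; simp add: frames)+
  have ext3: "has_extremes True m s3"
    unfolding s3_def by (rule extremes_prog_spec[OF inp'(2) tree(1) an2])
  have extT: "has_extremes True m s4" "has_extremes True m s5" "has_extremes True m s6"
    by (rule has_extremes_cong[OF ext3]; simp add: frames)+
  have ext4: "has_extremes False m s4"
    unfolding s4_def by (rule extremes_prog_spec[OF inp'(3) tree(2) an(1)])
  have extF: "has_extremes False m s5" "has_extremes False m s6"
    by (rule has_extremes_cong[OF ext4]; simp add: frames)+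
  have dep5: "has_dependent True s5"
    unfolding s5_def
    by (rule dependent_prog_spec[OF inp'(4) tree(3) an(2) extT(1) ext4]) (simp add: frames zero)
  have dep6: "has_dependent False s6"
    unfolding s6_def
    by (rule dependent_prog_spec[OF inp'(5) tree(4) an(3) extT(2) extF(1)]) (simp add: frames zero)
  have links7: "\<forall>e<m. has_arc s7 e"
    unfolding s7_def by (rule link_arcs_prog_spec[OF inp'(6) tree(5) extT(3) extF(2)])
  have dep7: "has_dependent True s7" by (rule has_dependent_cong[OF dep5]) (simp add: frames)
  have dep7': "has_dependent False s7" by (rule has_dependent_cong[OF dep6]) (simp add: frames)
  have arcs8: "\<forall>e<E. has_arc s8 e"
    unfolding s8_def by (rule vertex_arcs_prog_spec[OF inp'(7) tree(6) dep7 dep7' links7])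
  have rep: "represents s8"
    using arcs8 has_inputD(1,4)[OF inp'(8)] costs by (simp add: represents_def has_arc_def reals8)
  have flow: "ints s9 31 0 = 0 \<and> (\<exists>\<pi>. optimal_pair \<pi> (fl s9)) \<and> meets (fl s9) n \<or>
      ints s9 31 0 = 1 \<and> (\<exists>y<n. blocked y)"
    unfolding s9_def
  proof (rule flow_prog_spec[OF rep])
    show "fl s8 = (\<lambda>_. 0)" by (simp add: fl_def fun_eq_iff frames zero)
    show "pot s8 = (\<lambda>_. 0)" by (simp add: pot_def fun_eq_iff reals8 pot0)
    show "ints s8 31 0 = 0" by (simp add: frames zero)
    show "0 \<le> cost e" for e using cost_pos[of "ls ! e"] by (simp add: cost_def less_imp_le)
  qed
  have s: "s = (if ints s9 31 0 = 0 then set_int 5 0 1 s9 else s9)"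
    unfolding s_def main_prog_def den.simps(4) s1_def[symmetric] s2_def[symmetric] s3_def[symmetric]
      s4_def[symmetric] s5_def[symmetric] s6_def[symmetric] s7_def[symmetric] s8_def[symmetric]
      s9_def[symmetric] by (simp add: eq_iff_not_less)
  have five: "ints s9 5 0 = 0"
    unfolding s9_def
    by (subst den_frame) (simp_all add: flow_prog_def writes_flow frames zero del: den.simps)
  from flow show ?thesis
  proof
    assume ok: "ints s9 31 0 = 0 \<and> (\<exists>\<pi>. optimal_pair \<pi> (fl s9)) \<and> meets (fl s9) n"
    then obtain \<pi> where \<pi>: "optimal_pair \<pi> (fl s9)" and meets: "meets (fl s9) n" by blast
    define x :: "nat \<times> nat \<Rightarrow> real" where
      "x l = of_int (fl s9 (the_inv_into {..<m} ((!) ls) l))" for l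
    have "inj_on ((!) ls) {..<m}" by (rule inj_on_nth[OF distinct_links]) simp
    then have x: "x (ls ! j) = of_int (fl s9 j)" if "j < m" for j
      using that by (simp add: x_def the_inv_into_f_f)
    have nonneg: "0 \<le> fl s9 e" if "e < E" for e using \<pi> that by (simp add: optimal_pair_def)
    have "covering x" by (rule flow_covering[OF nonneg meets x])
    moreover have "(\<Sum>l\<in>set ls. c l * x l) \<le> (\<Sum>l\<in>set ls. c l * y l)" if "covering y" for y
      by (rule flow_optimal[OF \<pi> meets x that])
    moreover have "x l \<in> \<int>" for l by (simp add: x_def)
    moreover have "x (ls ! j) = of_int (ints s 6 (int j))" if "j < m" for j
      using x[OF that] ok by (simp add: s fl_def)
    ultimately show ?thesis using ok by (intro disjI1 conjI exI[of _ x]) (auto simp: s)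
  next
    assume fail: "ints s9 31 0 = 1 \<and> (\<exists>y<n. blocked y)"
    then show ?thesis using blocked_not_covering five by (auto simp: s)
  qed
qed

lemma willow_input_instance:
  fixes n :: nat
  defines "T as \<equiv> \<lparr>pverts = {..<n}, parcs = set as\<rparr>"
  assumes "distinct ls" "willow (T as) (set ls) c r"
  shows "willow_input n r (rooted_oriented_tree.par (T as) r) (rooted_oriented_tree.ty (T as) r) ls c as"
proof -
  have V: "pverts (T as) = {..<n}" and A: "parcs (T as) = set as" by (simp_all add: T_def)
  interpret rooted_instance "T as" r "set ls" by (rule willow_imp_willow_links[OF assms(3)])
  show ?thesis
  proof (intro willow_input.intro willow_net.intro willow_input_axioms.intro willow_net_axioms.intro)
    show "willow_links {..<n} r par ty (set ls)" using willow_imp_willow_links(2)[OF assms(3)] V by simp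
    show "0 < c l" if "l \<in> set ls" for l
      using assms(3) that by (auto simp: willow_def rooted_wdtap_instance_def wdtap_instance_def)
    fix x y assume xy: "(x, y) \<in> set as"
    then have "low (x, y) < n" using low_in[of "(x, y)"] V A by auto
    moreover have "(x, y) \<in> parcs (T as)" using xy A by simp
    ultimately show "y = par x \<and> x < n \<and> x \<noteq> r \<and> ty x \<or> x = par y \<and> y < n \<and> y \<noteq> r \<and> \<not> ty y"
      by (elim arc_cases) auto
  next
    fix x assume "x < n" "x \<noteq> r"
    then have "adj x (par x)" using adj_par[of x] V by simp
    then show "(if ty x then (x, par x) else (par x, x)) \<in> set as"
      using A by (auto simp: adj_def ty_def)
  qed (use assms(2) in simp)
qed

text \<open>\<open>low\<close> maps the arcs onto the non-root vertices and turns the rows of the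
  coverage matrix into those of \<open>covering\<close>.\<close>

lemma lp_feasible_iff_covering:
  fixes n :: nat
  defines "T as \<equiv> \<lparr>pverts = {..<n}, parcs = set as\<rparr>"
  assumes "distinct ls" "willow (T as) (set ls) c r"
  shows "lp_feasible (parcs (T as)) (set ls) (coverage_matrix (T as)) x \<longleftrightarrow>
    willow_net.covering n r (rooted_oriented_tree.par (T as) r) (rooted_oriented_tree.ty (T as) r) ls x"
proof -
  have V: "pverts (T as) = {..<n}" by (simp add: T_def)
  interpret rooted_instance "T as" r "set ls" by (rule willow_imp_willow_links[OF assms(3)])
  interpret W: willow_input n r par ty ls c as
    unfolding T_def by (rule willow_input_instance[OF assms(2) assms(3)[unfolded T_def]])
  have M: "real_of_int (coverage_matrix (T as) a l) = of_bool (low a \<in> W.cover l)"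
    if "a \<in> parcs (T as)" "l \<in> set ls" for a l
    using cov_iff[OF that(2,1)] unfolding W.cover_def V by (simp add: coverage_matrix_def)
  have rows: "low ` parcs (T as) = {..<n} - {r}"
    using low_in low_surj unfolding V by (auto simp: image_iff)
  have "(\<forall>v\<in>{..<n} - {r}. 1 \<le> (\<Sum>l\<in>set ls. of_bool (v \<in> W.cover l) * x l)) \<longleftrightarrow>
      (\<forall>a\<in>parcs (T as). 1 \<le> (\<Sum>l\<in>set ls. of_bool (low a \<in> W.cover l) * x l))"
    unfolding rows[symmetric] by (simp only: ball_simps)
  moreover have "(\<Sum>l\<in>set ls. real_of_int (coverage_matrix (T as) a l) * x l) =
      (\<Sum>l\<in>set ls. of_bool (low a \<in> W.cover l) * x l)" if "a \<in> parcs (T as)" for a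
    using M[OF that] by (intro sum.cong) auto
  ultimately show ?thesis unfolding lp_feasible_def W.covering_def by auto
qed

text \<open>Serves the running time: it keeps the length of the arc list, which is a loop bound,
  below the number of vertices.\<close>

lemma number_of_arcs:
  assumes "rooted_oriented_tree T r"
  shows "card (parcs T) \<le> card (pverts T)"
proof -
  interpret rooted_oriented_tree T r by (rule assms)
  show ?thesis using low_in finite_V by (intro card_inj_on_le[OF low_inj]) auto
qed

theorem theorem5p3:
  shows "(\<forall>(T :: 'v pair_pre_digraph) L c r.
            willow T L c r \<longrightarrow> totally_unimodular (parcs T) L (coverage_matrix T)) \<and>
         (\<exists>(prog :: com) (p :: nat poly). \<forall>n r as ls c.
            let T = \<lparr>pverts = {..<n}, parcs = set as\<rparr> in
            distinct as \<and> distinct ls \<and> willow T (set ls) c r \<longrightarrow>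
            (\<exists>t s. exec prog (encode_input n r as ls c) t s \<and>
                   t \<le> poly p (n + length ls) \<and>
                   correct_output (parcs T) ls (coverage_matrix T) c s))"
    (is "_ \<and> (\<exists>prog p. \<forall>n r as ls c. ?correct prog p n r as ls c)")
proof (intro conjI allI impI)
  show "totally_unimodular (parcs T) L (coverage_matrix T)" if "willow T L c r"
    for T :: "'v pair_pre_digraph" and L c r
    using that by (rule willow_totally_unimodular)
  show "\<exists>(prog :: com) (p :: nat poly). \<forall>n r as ls c. ?correct prog p n r as ls c"
  proof (intro exI allI)
    fix n r :: nat and as ls :: "(nat \<times> nat) list" and c :: "nat \<times> nat \<Rightarrow> real"
    let ?T = "\<lparr>pverts = {..<n}, parcs = set as\<rparr>" and ?start = "encode_input n r as ls c"
    let ?final = "den main_prog ?start"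
    have "\<exists>t s. exec (compile main_prog) ?start t s \<and> t \<le> poly (time_poly main_prog) (n + length ls) \<and>
        correct_output (parcs ?T) ls (coverage_matrix ?T) c s"
      if as: "distinct as" and ls: "distinct ls" and w: "willow ?T (set ls) c r"
    proof -
      interpret W: willow_input n r "rooted_oriented_tree.par ?T r" "rooted_oriented_tree.ty ?T r" ls c as
        by (rule willow_input_instance[OF ls w])
      interpret T: rooted_instance ?T r "set ls" by (rule willow_imp_willow_links[OF w])
      have rn: "r < n" using W.root_in by simp
      have "card (set as) \<le> card {..<n}"
        using number_of_arcs[OF T.rooted_oriented_tree_axioms] by simp
      then have "length as \<le> n" using distinct_card[OF as] by simp
      \<comment> \<open>Array \<open>0\<close> holds \<open>n\<close>, the root and the lengths of
        the two lists, so the time polynomial may be evaluated at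
        \<open>n + length ls\<close>.\<close>
      then have bound: "ints ?start 0 i \<le> int (n + length ls)" for i
        using rn by (auto simp: encode_input_def array_of_def nth_Cons split: nat.split)
      obtain t where t: "exec (compile main_prog) ?start t ?final" "t \<le> poly (time_poly main_prog) (n + length ls)"
        using exec_compile[OF wf_main_prog bound] by blast
      have "W.has_input ?start"
        by (simp add: W.has_input_def encode_input_def array_of_def nth_Cons)
      moreover have "ints ?start a i = 0" if "5 \<le> a" for a i
        using that by (auto simp: encode_input_def)
      moreover have "reals ?start 0 (int e) = W.cost e" for e
        by (simp add: encode_input_def array_of_def W.cost_def)
      moreover have "reals ?start 4 i = 0" for i by (simp add: encode_input_def)
      ultimately have spec: "(\<exists>x. W.covering x \<and>
            (\<forall>y. W.covering y \<longrightarrow> (\<Sum>l\<in>set ls. c l * x l) \<le> (\<Sum>l\<in>set ls. c l * y l)) \<and>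
            (\<forall>l\<in>set ls. x l \<in> \<int>) \<and> (\<forall>j<length ls. x (ls ! j) = of_int (ints ?final 6 (int j)))) \<and>
          ints ?final 5 0 = 1 \<or> (\<nexists>y. W.covering y) \<and> ints ?final 5 0 = 0"
        by (rule W.main_prog_spec)
      have "correct_output (parcs ?T) ls (coverage_matrix ?T) c ?final"
        unfolding correct_output_def lp_optimal_def lp_feasible_iff_covering[OF ls w] using spec by auto
      then show ?thesis using t by blast
    qed
    then show "?correct (compile main_prog) (time_poly main_prog) n r as ls c"
      unfolding Let_def by blast
  qed
qed

end
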